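(* Let $h:[0,1]\to(0,\infty)$ and $f:[0,\infty)\to[0,\infty)$ be continuously differentiable, suppose there is $t_0\ge0$ with $f>0$ on $[t_0,\infty)$ and $f\in C^2([t_0,\infty))$, put $g=\log f$ on $[t_0,\infty)$, and assume condition (H1) of the context with $q\in[1,2)$. Let $(\lambda_n,\mu_n,u_n)\in(0,\infty)\times(0,\infty)\times C^2([0,1])$ satisfy $-u_n''-\frac1r u_n'=\lambda_n h(r)f(u_n)$, $u_n>0$ in $(0,1)$, $u_n(0)=\mu_n$, $u_n'(0)=0=u_n(1)$, with $\mu_n\to\infty$. Then, after extracting a subsequence if necessary, for each $k\in\mathbb{N}$ there exists a sequence $(r_{k,n})\subset(0,1)$ such that $u_n(r_{k,n})/\mu_n\to\delta_k$ and $$\lambda_n r_{k,n}^2 h(r_{k,n}) f'(u_n(r_{k,n}))\to \frac{a_k^2}{2}$$ as $n\to\infty$, and, defining for each large $n$ the number $\gamma_{k,n}>0$ by $\lambda_n h(r_{k,n})f'(u_n(r_{k,n}))\gamma_{k,n}^2=1$ and the function $z_{k,n}(r)=g'(u_n(r_{k,n}))(u_n(\gamma_{k,n}r)-u_n(r_{k,n}))$ for $r\in[0,1/\gamma_{k,n}]$, we have $\gamma_{k,n}\to0$, and there exist sequences $(\bar\rho_{k,n}),(\rho_{k,n})\subset[0,1)$, with $\bar\rho_{1,n}=0$ for all $n$ when $k=1$, such that $\rho_{k,n}\to0$, $\bar\rho_{k,n}/\gamma_{k,n}\to0$, $\rho_{k,n}/\gamma_{k,n}\to\infty$, $u_n(\bar\rho_{k,n})/\mu_n\to\delta_k$,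 $u_n(\rho_{k,n})/\mu_n\to\delta_k$, and $$\|z_{k,n}-z_k\|_{C^2([\bar\rho_{k,n}/\gamma_{k,n},\,\rho_{k,n}/\gamma_{k,n}])}\to0$$ as $n\to\infty$. Further, if $q=1$, then for each of the sequences $(r_n)=(r_{k,n}),(\rho_{k,n}),(\bar\rho_{k,n})$, $$u_n(r_n)=\mu_n-\Big(\log\frac1{\eta_k}+o(1)\Big)\frac{g(\mu_n)}{g'(\mu_n)}\quad (n\to\infty).$$ Moreover, for all $k\in\mathbb{N}$, $$\lim_{n\to\infty} g'(u_n(r_{k,n}))\int_{\bar\rho_{k,n}}^{\rho_{k,n}}\lambda_n h f(u_n)\,r\,dr=2a_k=\lim_{n\to\infty}\int_{\bar\rho_{k,n}}^{\rho_{k,n}}\lambda_n h f'(u_n)\,r\,dr$$ and $$\lim_{n\to\infty} g'(\mu_n)\int_{\rho_{k,n}}^{\bar\rho_{k+1,n}}\lambda_n h f(u_n)\,r\,dr=0.$$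
   Context: Condition (H1): (i) $g'(t)>0$ and $g''(t)>0$ for all $t\ge t_0$, and there is a pair $(q,p)$ with either $q=1$ and $p\in(0,\infty]$, or $q\in(1,\infty)$ and $p\in(0,\infty)$, such that $\lim_{t\to\infty}\frac{g'(t)^2}{g(t)g''(t)}=q$ and $\lim_{t\to\infty}\frac{tg'(t)}{g(t)}=p$; (ii) if $q=1$, then $tg'(t)/g(t)$ is nondecreasing on $[t_0,\infty)$ and there exist $k\in\mathbb{N}$ and $\hat g\in C^2([t_0,\infty))$ with $f=\exp_k\circ\hat g$ and $\hat g'/\hat g$ nonincreasing on $[t_0,\infty)$ ($\exp_1=\exp$, $\exp_k=\exp_{k-1}\circ\exp$). Under (H1) one has $1/p+1/q=1$ (with $1/\infty=0$), so for $q\in(1,2)$, $p=q/(q-1)\in(2,\infty)$, and for $q=1$, $p=\infty$. Sequences: $a_1=2$, $\delta_1=1$, $\eta_1=1$. If $q\in(1,2)$: for $k\ge1$, $\delta_{k+1}\in(0,\delta_k)$ is determined by $\frac{2p}{2+a_k}\big(1-\frac{\delta_{k+1}}{\delta_k}\big)-1+\big(\frac{\delta_{k+1}}{\delta_k}\big)^p=0$, and $a_{k+1}=2-\big(\frac{\delta_{k+1}}{\delta_k}\big)^{p-1}(2+a_k)$; set $\eta_k=\delta_k^p$. If $q=1$: $\eta_{k+1}\in(0,\eta_k)$ is determined by $\frac{2}{2+a_k}\log\frac{\eta_k}{\eta_{k+1}}-1+\frac{\eta_{k+1}}{\eta_k}=0$, $a_{k+1}=2-\frac{\eta_{k+1}}{\eta_k}(2+a_k)$,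 and $\delta_k=1$ for all $k$. These sequences are well-defined with $a_k\in(0,2]$. Profiles: for $k\in\mathbb{N}$, $b_k=(\sqrt2/a_k)^{a_k}$ and $z_k(r)=\log\frac{2a_k^2 b_k}{r^{2-a_k}(1+b_k r^{a_k})^2}$ (for $r\ge0$ if $k=1$, $r>0$ if $k>1$); these solve $-z''-\frac1r z'=e^{z}$ on $(0,\infty)$ with $\int_0^\infty e^{z_k}r\,dr=2a_k$. In integrals $h=h(r)$, $f(u_n)=f(u_n(r))$. *)

theory Defs
  imports "HOL-Analysis.Analysis"
begin

definition p_of :: "real \<Rightarrow> real" where
  "p_of q = q / (q - 1)"

text \<open>The ratio eta_(k+1)/eta_k (case q = 1) resp. delta_(k+1)/delta_k (case q in (1,2)),
  determined as the unique root in (0,1) of the defining equation, given a = a_k.\<close>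
definition step_ratio :: "real \<Rightarrow> real \<Rightarrow> real" where
  "step_ratio q a =
    (if q = 1 then (THE s. 0 < s \<and> s < 1 \<and> 2 / (2 + a) * ln (1 / s) - 1 + s = 0)
     else (THE t. 0 < t \<and> t < 1 \<and>
              2 * p_of q / (2 + a) * (1 - t) - 1 + t powr (p_of q) = 0))"

text \<open>adeta q j = (a_(j+1), delta_(j+1), eta_(j+1)).\<close>
primrec adeta :: "real \<Rightarrow> nat \<Rightarrow> real \<times> real \<times> real" where
  "adeta q 0 = (2, 1, 1)"
| "adeta q (Suc j) =
     (case adeta q j of (a, d, e) \<Rightarrow>
        (let t = step_ratio q a in
         if q = 1 then (2 - t * (2 + a), 1, e * t)
         else (2 - t powr (p_of q - 1) * (2 + a), d * t, (d * t) powr (p_of q))))"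

definition a_seq :: "real \<Rightarrow> nat \<Rightarrow> real" where
  "a_seq q k = fst (adeta q (k - 1))"
definition delta_seq :: "real \<Rightarrow> nat \<Rightarrow> real" where
  "delta_seq q k = fst (snd (adeta q (k - 1)))"
definition eta_seq :: "real \<Rightarrow> nat \<Rightarrow> real" where
  "eta_seq q k = snd (snd (adeta q (k - 1)))"

definition b_of :: "real \<Rightarrow> real" where
  "b_of a = (sqrt 2 / a) powr a"

text \<open>Profile z(r) = log (2 a^2 b / (r^(2-a) (1 + b r^a)^2)) and its first two derivatives
  (the factor r^(2-a) resp. r^(a-2) is 1 when a = 2, also at r = 0).\<close>
definition zprof :: "real \<Rightarrow> real \<Rightarrow> real" where
  "zprof a r = ln (2 * a^2 * b_of a) - (if a = 2 then 0 else (2 - a) * ln r)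
                - 2 * ln (1 + b_of a * r powr a)"

definition zprof1 :: "real \<Rightarrow> real \<Rightarrow> real" where
  "zprof1 a r = - (2 - a) / r - 2 * a * b_of a * r powr (a - 1) / (1 + b_of a * r powr a)"

definition zprof2 :: "real \<Rightarrow> real \<Rightarrow> real" where
  "zprof2 a r = (2 - a) / r^2
     - 2 * a * b_of a * (if a = 2 then 1 else r powr (a - 2)) * (a - 1 - b_of a * r powr a)
       / (1 + b_of a * r powr a)^2"

text \<open>C^2([A_n,B_n]) distance between w_n (with derivatives w1_n, w2_n) and v (with
  derivatives v1, v2) tends to 0.\<close>
definition C2_to_zero ::
  "(nat \<Rightarrow> real) \<Rightarrow> (nat \<Rightarrow> real) \<Rightarrow> (nat \<Rightarrow> real \<Rightarrow> real) \<Rightarrow> (nat \<Rightarrow> real \<Rightarrow> real) \<Rightarrow>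
   (nat \<Rightarrow> real \<Rightarrow> real) \<Rightarrow> (real \<Rightarrow> real) \<Rightarrow> (real \<Rightarrow> real) \<Rightarrow> (real \<Rightarrow> real) \<Rightarrow> bool" where
  "C2_to_zero A B w w1 w2 v v1 v2 \<longleftrightarrow>
     (\<forall>\<epsilon>>0. eventually (\<lambda>n. \<forall>x\<in>{A n..B n}.
        \<bar>w n x - v x\<bar> + \<bar>w1 n x - v1 x\<bar> + \<bar>w2 n x - v2 x\<bar> < \<epsilon>) sequentially)"

definition oint :: "real \<Rightarrow> real \<Rightarrow> (real \<Rightarrow> real) \<Rightarrow> real" where
  "oint a b F = (if a \<le> b then integral {a..b} F else - integral {b..a} F)"

end

theory Submission
  imports Defs
begin

text \<open>In the variable $s = \log r$ put $y = -g'(u)\, u_s$ and $F = \lambda r^2 h f'(u)$. Then $y' \approx F$ and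
  $F' \approx F (2 - y)$ with errors of order $1/g(\mu)$, and the limit system has the first integral
  $F + (y - 2)^2 / 2$. Its orbits $y = 2 + a \tanh (a s / 2)$ are the profiles $z_k$: a bubble takes $y$ from
  $2 - a$ to $2 + a$ within a time $o(g(\mu))$, during which the errors are negligible.

  After a bubble $F$ is exponentially small, $u_s$ is almost constant and $\log F$ is, up to $o(g(\mu))$, an
  explicit convex function of $u$, whose next zero is where the following bubble starts. Since
  $g' \sim g^{1/q}$ and $(t - t') g'(t) / g(t)$ is asymptotically a function of $g(t') / g(t)$, in the scale
  of $g(\mu)$ this zero is the root of the equation that defines $\eta_{k+1} / \eta_k$, and there
  $y = (2 + a_k) (\eta_{k+1} / \eta_k)^{1/q} = 2 - a_{k+1}$. The first bubble starts from $y = 0$, that is $a_1 = 2$. The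
  integrals over the gaps are differences of $-r u'$, which is almost constant there.\<close>

section \<open>The defining equation of the sequences\<close>

text \<open>The perturbation has size 1/g(mu), but a gap between two bubbles lasts a time of order
  g(mu), so the errors accumulated over a gap are not small: y itself drops by a fixed factor,
  because g'(u) does. What survives is -u_s, whose increase over a gap is the integral of an
  exponentially small quantity. Bubbles are therefore followed in (y, F) through the first integral,
  gaps in (u, -u_s) through the convexity of g. The two descriptions meet at times where F tends to
  0 but log F = o(g(mu)), which is exactly what allows a bubble to unfold within a time o(g(mu)).

  The control of a gap degenerates at its end, since the exponential smallness is lost at the root
  of \<open>gap\<close>. The estimate is made at levels strictly above the root, and a diagonal
  choice reaches the root. The same device lets windows of fixed length around a bubble grow to
  infinity.

  Levels are measured by g(u)/g(mu) and not by u/mu: for q = 1 the latter tends to 1 at every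
  bubble. Logarithmic time never reaches r = 0, so everything that starts at the centre needs an
  argument in r.\<close>

text \<open>The derivative of \<open>log_q\<close> is $-s^{-1/q}$ for all \<open>q\<close>, including $q = 1$. For $s = \eta_{k+1}/\eta_k$
  (also when $q > 1$, where $\delta_{k+1}/\delta_k = s^{1/p}$) the equation that defines the sequences is
  \<open>gap q a s = 0\<close>.\<close>

definition log_q :: "real \<Rightarrow> real \<Rightarrow> real" where
  "log_q q s = (if q = 1 then - ln s else p_of q * (1 - s powr (1 / p_of q)))"

definition gap :: "real \<Rightarrow> real \<Rightarrow> real \<Rightarrow> real" where
  "gap q a s = 2 / (2 + a) * log_q q s - 1 + s"

lemma p_of_bounds:
  assumes "1 < q" "q < 2"
  shows "p_of q > 2" "1 / p_of q = 1 - 1 / q"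
  using assms by (auto simp: p_of_def field_simps)

lemma log_q_deriv:
  assumes "1 \<le> q" "s > 0"
  shows "(log_q q has_real_derivative - (s powr (- 1 / q))) (at s)"
proof (cases "q = 1")
  case True
  have "log_q q = (\<lambda>s. - ln s)"
    using True by (auto simp: log_q_def)
  moreover have "((\<lambda>s. - ln s) has_real_derivative - (s powr (- 1 / q))) (at s)"
    using assms True by (auto intro!: derivative_eq_intros simp: powr_minus field_simps)
  ultimately show ?thesis by simp
next
  case False
  define p where "p = p_of q"
  have p: "1 / p - 1 = - 1 / q" "p \<noteq> 0"
    using assms False by (auto simp: p_def p_of_def field_simps)
  have "((\<lambda>s. p * (1 - s powr (1 / p))) has_real_derivative
      p * (0 - (1 / p) * s powr (1 / p - 1))) (at s)"
    by (rule DERIV_cmult[OF DERIV_diff[OF DERIV_const has_real_derivative_powr]]) fact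
  moreover have "log_q q = (\<lambda>s. p * (1 - s powr (1 / p)))"
    using False by (auto simp: log_q_def p_def)
  ultimately show ?thesis using p by simp
qed

lemma log_q_pos:
  assumes "1 \<le> q" "q < 2" "0 < s" "s < 1"
  shows "log_q q s > 0"
proof (cases "q = 1")
  case False
  then have "1 < q" using assms by auto
  then have p: "p_of q > 2" using p_of_bounds assms by auto
  have "s powr (1 / p_of q) < s powr 0"
    using assms p by (intro powr_less_mono') auto
  then show ?thesis using False p assms by (simp add: log_q_def)
qed (use assms in \<open>auto simp: log_q_def\<close>)

lemma log_q_1 [simp]: "log_q q 1 = 0"
  by (simp add: log_q_def)

lemma continuous_on_log_q: "1 \<le> q \<Longrightarrow> continuous_on {0<..} (log_q q)"
  by (rule DERIV_continuous_on) (auto intro: DERIV_subset log_q_deriv)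

lemma gap_deriv:
  assumes "1 \<le> q" "s > 0"
  shows "(gap q a has_real_derivative 1 - 2 / (2 + a) * s powr (- 1 / q)) (at s)"
proof -
  have "((\<lambda>s. 2 / (2 + a) * log_q q s - 1 + s) has_real_derivative
      (2 / (2 + a) * (- (s powr (- 1 / q))) - 0 + 1)) (at s)"
    by (intro derivative_intros DERIV_cmult log_q_deriv assms)
  then show ?thesis unfolding gap_def[abs_def] by simp
qed

lemma continuous_on_gap: "1 \<le> q \<Longrightarrow> continuous_on {0<..} (gap q a)"
  unfolding gap_def[abs_def] by (intro continuous_intros continuous_on_log_q)

definition gap_root :: "real \<Rightarrow> real \<Rightarrow> real" where
  "gap_root q a = (THE s. 0 < s \<and> s < 1 \<and> gap q a s = 0)"

text \<open>\<open>gap\<close> vanishes at 1 and has a single critical point \<open>sc\<close>,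
  where s^(1/q) = 2/(2+a): it decreases before \<open>sc\<close> and increases after it, so it is
  negative on [\<open>sc\<close>, 1). A point where it is positive then forces exactly one root in
  (0, 1), and this root lies left of \<open>sc\<close>. The last claim is this position; for the
  sequences it says a_(k+1) > 0.\<close>

lemma gap_root_properties:
  assumes q: "1 \<le> q" "q < 2" and a: "0 < a" "a \<le> 2"
  shows gap_root_bounds: "0 < gap_root q a" "gap_root q a < 1"
    and gap_gap_root: "gap q a (gap_root q a) = 0"
    and gap_root_unique: "\<And>s. 0 < s \<Longrightarrow> s < 1 \<Longrightarrow> gap q a s = 0 \<Longrightarrow> s = gap_root q a"
    and gap_neg: "\<And>x. gap_root q a < x \<Longrightarrow> x < 1 \<Longrightarrow> gap q a x < 0"
    and gap_root_powr_less: "gap_root q a powr (1 / q) * (2 + a) < 2"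
proof -
  define w where "w = 2 / (2 + a)"
  have w: "0 < w" "w < 1" using a by (auto simp: w_def)
  define sc where "sc = w powr q"
  have sc: "0 < sc" "sc < 1"
    using w q powr_less_mono'[of w 0 q] by (auto simp: sc_def)
  have scq: "sc powr (- 1 / q) = 1 / w"
  proof -
    have "sc powr (- 1 / q) = w powr (q * (- 1 / q))" unfolding sc_def by (rule powr_powr)
    also have "q * (- 1 / q) = -1" using q by simp
    finally show ?thesis using w by (simp add: powr_minus_divide)
  qed
  have decr: "gap q a y < gap q a x" if "0 < x" "x < y" "y \<le> sc" for x y
  proof (rule DERIV_neg_imp_decreasing_open[OF \<open>x < y\<close>])
    fix z assume z: "x < z" "z < y"
    have "sc powr (- 1 / q) < z powr (- 1 / q)"
      using powr_less_mono2_neg[of "- 1 / q" z sc] z that q by auto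
    then have "1 < w * z powr (- 1 / q)" using scq w by (simp add: pos_divide_less_eq mult.commute)
    then show "\<exists>d. (gap q a has_real_derivative d) (at z) \<and> d < 0"
      using gap_deriv[of q z a] z that q unfolding w_def
      by (intro exI[of _ "1 - 2 / (2 + a) * z powr (- 1 / q)"]) auto
  next
    show "continuous_on {x..y} (gap q a)"
      using that q by (intro continuous_on_subset[OF continuous_on_gap]) auto
  qed
  have incr: "gap q a x < gap q a y" if "sc \<le> x" "x < y" for x y
  proof (rule DERIV_pos_imp_increasing_open[OF \<open>x < y\<close>])
    fix z assume z: "x < z" "z < y"
    have "z powr (- 1 / q) < sc powr (- 1 / q)"
      using powr_less_mono2_neg[of "- 1 / q" sc z] z that q sc by auto
    then have "w * z powr (- 1 / q) < 1" using scq w by (simp add: pos_less_divide_eq mult.commute)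
    then show "\<exists>d. (gap q a has_real_derivative d) (at z) \<and> d > 0"
      using gap_deriv[of q z a] z that q sc unfolding w_def
      by (intro exI[of _ "1 - 2 / (2 + a) * z powr (- 1 / q)"]) auto
  next
    show "continuous_on {x..y} (gap q a)"
      using that q sc by (intro continuous_on_subset[OF continuous_on_gap]) auto
  qed
  have g1: "gap q a 1 = 0" by (simp add: gap_def)
  have neg: "gap q a x < 0" if "sc \<le> x" "x < 1" for x
    using incr[OF that] g1 by simp
  \<comment> \<open>For q = 1 the witness makes the logarithmic term of \<open>gap\<close> equal to
    1. For q > 1, t = 1 - 2/p makes p (1 - t) = 2, and 4/(2+a) >= 1 because a <= 2; here p > 2
    ensures t > 0. In both cases the value of \<open>gap\<close> is at least the point
    itself.\<close>
  obtain x0 where x0: "0 < x0" "x0 < 1" "gap q a x0 > 0"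
  proof (cases "q = 1")
    case True
    have "gap q a (exp (- (2 + a) / 2)) > 0"
      using a True by (simp add: gap_def log_q_def field_simps)
    moreover have "exp (- (2 + a) / 2) < 1" using a by simp
    ultimately show ?thesis using that[of "exp (- (2 + a) / 2)"] by simp
  next
    case False
    then have "1 < q" using q by auto
    then have p: "p_of q > 2" using p_of_bounds q by auto
    define p where "p = p_of q"
    define t where "t = 1 - 2 / p"
    have t: "0 < t" "t < 1" "p > 2" using p by (auto simp: t_def p_def)
    have tp: "0 < t powr p" "t powr p < 1" using powr_less_mono'[of t 0 p] t by auto
    have "(t powr p) powr (1 / p) = t" using t by (simp add: powr_powr)
    then have "gap q a (t powr p) = 2 / (2 + a) * (p * (1 - t)) - 1 + t powr p"
      using False by (simp add: gap_def log_q_def p_def)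
    also have "p * (1 - t) = 2" using t by (simp add: t_def)
    finally have "gap q a (t powr p) = 2 / (2 + a) * 2 - 1 + t powr p" .
    moreover have "2 / (2 + a) * 2 \<ge> 1" using a by (simp add: field_simps)
    ultimately have "gap q a (t powr p) > 0" using tp by linarith
    then show ?thesis using that tp by blast
  qed
  have x0sc: "x0 < sc" using neg[of x0] x0 by force
  obtain s where s: "x0 \<le> s" "s \<le> sc" "gap q a s = 0"
    using IVT2'[of "gap q a" sc 0 x0] x0 x0sc neg[of sc] sc
      continuous_on_subset[OF continuous_on_gap[of q a], of "{x0..sc}"] q by force
  have s': "0 < s" "s < sc" "s < 1"
    using s x0 sc neg[of sc] by (auto simp: less_le)
  have uniq: "x = s" if "0 < x" "x < 1" "gap q a x = 0" for x
  proof -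
    have "x < sc" using neg[of x] that(2,3) by linarith
    then have "\<not> x < s" "\<not> s < x"
      using decr[OF \<open>0 < x\<close>, of s] decr[OF s'(1), of x] that(3) s(2,3) by linarith+
    then show ?thesis by simp
  qed
  have root: "gap_root q a = s"
    unfolding gap_root_def by (rule the_equality) (use s(3) s' uniq in blast)+
  show "0 < gap_root q a" "gap_root q a < 1" "gap q a (gap_root q a) = 0"
    using root s s' by auto
  show "x = gap_root q a" if "0 < x" "x < 1" "gap q a x = 0" for x
    using uniq that root by auto
  show "gap q a x < 0" if "gap_root q a < x" "x < 1" for x
    using decr[of s x] neg[of x] that s s' root by (cases "x \<le> sc") auto
  have "s powr (1 / q) < sc powr (1 / q)"
    using s' q by (intro powr_less_mono2) auto
  also have "\<dots> = w" using w q by (simp add: sc_def powr_powr)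
  finally show "gap_root q a powr (1 / q) * (2 + a) < 2"
    using a by (simp add: root w_def field_simps)
qed

text \<open>For q > 1 the defining equation is stated for the ratio t of consecutive deltas; s = t^p
  turns it into \<open>gap q a s = 0\<close>, hence the p-th root.\<close>

lemma step_ratio_eq:
  assumes q: "1 \<le> q" "q < 2" and a: "0 < a" "a \<le> 2"
  shows "step_ratio q a = (if q = 1 then gap_root q a else gap_root q a powr (1 / p_of q))"
proof (cases "q = 1")
  case True
  have "(0 < s \<and> s < 1 \<and> 2 / (2 + a) * ln (1 / s) - 1 + s = 0) \<longleftrightarrow>
      (0 < s \<and> s < 1 \<and> gap q a s = 0)" for s
    using True by (auto simp: gap_def log_q_def ln_div)
  then show ?thesis using True by (simp add: step_ratio_def gap_root_def)
next
  case False
  then have q1: "1 < q" using q by auto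
  define p where "p = p_of q"
  have p: "p > 2" using p_of_bounds[OF q1 q(2)] by (simp add: p_def)
  let ?s = "gap_root q a"
  have *: "gap q a (t powr p) = 2 * p / (2 + a) * (1 - t) - 1 + t powr p" if "0 < t" for t
    using that False p by (simp add: gap_def log_q_def p_def[symmetric] powr_powr)
  have "(THE t. 0 < t \<and> t < 1 \<and> 2 * p / (2 + a) * (1 - t) - 1 + t powr p = 0) = ?s powr (1 / p)"
  proof (rule the_equality)
    have s: "0 < ?s" "?s < 1" "gap q a ?s = 0"
      using gap_root_bounds[OF q a] gap_gap_root[OF q a] by auto
    have "(?s powr (1 / p)) powr p = ?s" using s p by (simp add: powr_powr)
    moreover have "?s powr (1 / p) < 1"
      using powr_less_mono2[of "1 / p" ?s 1] s p by auto
    ultimately show "0 < ?s powr (1 / p) \<and> ?s powr (1 / p) < 1 \<and>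
        2 * p / (2 + a) * (1 - ?s powr (1 / p)) - 1 + (?s powr (1 / p)) powr p = 0"
      using *[of "?s powr (1 / p)"] s by simp
  next
    fix t assume t: "0 < t \<and> t < 1 \<and> 2 * p / (2 + a) * (1 - t) - 1 + t powr p = 0"
    have "t powr p < 1" using powr_less_mono2[of p t 1] t p by auto
    then have "t powr p = ?s"
      using gap_root_unique[OF q a, of "t powr p"] * t by auto
    then have "?s powr (1 / p) = (t powr p) powr (1 / p)" by simp
    then show "t = ?s powr (1 / p)" using t p by (simp add: powr_powr)
  qed
  then show ?thesis using False by (simp add: step_ratio_def p_def)
qed

section \<open>The sequences in terms of the roots of \<open>gap\<close>\<close>

context
  fixes q :: real
  assumes q: "1 \<le> q" "q < 2"
begin

lemma seq_1: "a_seq q 1 = 2" "delta_seq q 1 = 1" "eta_seq q 1 = 1"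
  by (auto simp: a_seq_def delta_seq_def eta_seq_def)

text \<open>The next step belongs to the invariant because computing it needs all the rest: the
  bounds on a for \<open>step_ratio_eq\<close>, and d = e^(1/p) so that the update (d t)^p of eta
  becomes e s. The factor t^(p-1) in the update of a becomes s^(1/q), since (p-1)/p = 1/q.\<close>

lemma adeta_invariant:
  "case adeta q j of (a, d, e) \<Rightarrow> 0 < a \<and> a \<le> 2 \<and> 0 < e \<and>
     d = (if q = 1 then 1 else e powr (1 / p_of q)) \<and>
     (\<exists>d'. adeta q (Suc j) = (2 - gap_root q a powr (1 / q) * (2 + a), d', e * gap_root q a))"
proof (induction j)
  case (Suc j)
  obtain a d e where ade: "adeta q j = (a, d, e)" by (cases "adeta q j") auto
  let ?s = "gap_root q a"
  have IH: "0 < a" "a \<le> 2" "0 < e" "d = (if q = 1 then 1 else e powr (1 / p_of q))"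
    using Suc ade by auto
  obtain d' where S: "adeta q (Suc j) = (2 - ?s powr (1 / q) * (2 + a), d', e * ?s)"
    using Suc ade by auto
  note s = gap_root_bounds[OF q IH(1,2)] gap_root_powr_less[OF q IH(1,2)]
  define a' where "a' = 2 - ?s powr (1 / q) * (2 + a)"
  have a': "0 < a'" "a' \<le> 2" using s(3) IH mult_nonneg_nonneg[of "?s powr (1 / q)" "2 + a"]
    by (auto simp: a'_def)
  have d': "d' = (if q = 1 then 1 else (e * ?s) powr (1 / p_of q))"
  proof (cases "q = 1")
    case True
    then show ?thesis using S ade by (simp add: Let_def)
  next
    case False
    then show ?thesis using S ade step_ratio_eq[OF q IH(1,2)] IH s
      by (simp add: Let_def powr_mult)
  qed
  define e' where "e' = e * ?s"
  have e': "0 < e'" using IH s by (simp add: e'_def)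
  have S': "adeta q (Suc j) = (a', d', e')" using S by (simp add: a'_def e'_def)
  let ?s' = "gap_root q a'"
  note s' = gap_root_bounds[OF q a']
  have "\<exists>d''. adeta q (Suc (Suc j)) = (2 - ?s' powr (1 / q) * (2 + a'), d'', e' * ?s')"
  proof (cases "q = 1")
    case True
    then show ?thesis using S' step_ratio_eq[OF q a'] s' by (subst adeta.simps) (simp add: Let_def)
  next
    case False
    then have q1: "1 < q" using q by auto
    note p = p_of_bounds[OF q1 q(2)]
    have "1 / p_of q * (p_of q - 1) = 1 - 1 / p_of q"
      using p(1) by (simp add: field_simps)
    then have "1 / p_of q * (p_of q - 1) = 1 / q" using p(2) by simp
    then show ?thesis using S' step_ratio_eq[OF q a'] s' d' False e' p(1)
      by (subst adeta.simps) (simp add: Let_def powr_powr powr_mult e'_def[symmetric])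
  qed
  then show ?case using S' a' d' e' by (simp add: e'_def del: adeta.simps)
next
  case 0
  note s = gap_root_bounds[OF q, of 2]
  have "\<exists>d'. adeta q (Suc 0) = (2 - gap_root q 2 powr (1 / q) * 4, d', gap_root q 2)"
  proof (cases "q = 1")
    case True
    then show ?thesis using step_ratio_eq[OF q, of 2] s by (simp add: Let_def)
  next
    case False
    then have q1: "1 < q" using q by auto
    note p = p_of_bounds[OF q1 q(2)]
    have "1 / p_of q * (p_of q - 1) = 1 - 1 / p_of q"
      using p(1) by (simp add: field_simps)
    then have "1 / p_of q * (p_of q - 1) = 1 / q" using p(2) by simp
    then show ?thesis using step_ratio_eq[OF q, of 2] s False p(1)
      by (simp add: Let_def powr_powr)
  qed
  then show ?case by (simp add: del: adeta.simps(2))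
qed

lemma seq_properties:
  assumes "k \<ge> 1"
  shows a_seq_bounds: "0 < a_seq q k" "a_seq q k \<le> 2"
    and eta_seq_pos: "0 < eta_seq q k"
    and delta_seq_eq: "delta_seq q k = (if q = 1 then 1 else eta_seq q k powr (1 / p_of q))"
    and a_seq_Suc: "a_seq q (Suc k) = 2 - gap_root q (a_seq q k) powr (1 / q) * (2 + a_seq q k)"
    and eta_seq_Suc: "eta_seq q (Suc k) = eta_seq q k * gap_root q (a_seq q k)"
proof -
  obtain j where k: "k = Suc j" using assms by (cases k) auto
  obtain a d e where ade: "adeta q j = (a, d, e)" by (cases "adeta q j") auto
  show "0 < a_seq q k" "a_seq q k \<le> 2" "0 < eta_seq q k"
    "delta_seq q k = (if q = 1 then 1 else eta_seq q k powr (1 / p_of q))"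
    "a_seq q (Suc k) = 2 - gap_root q (a_seq q k) powr (1 / q) * (2 + a_seq q k)"
    "eta_seq q (Suc k) = eta_seq q k * gap_root q (a_seq q k)"
    using adeta_invariant[of j] ade
    by (auto simp: a_seq_def delta_seq_def eta_seq_def k simp del: adeta.simps)
qed

end

section \<open>Growth of the nonlinearity\<close>

lemma tendsto_zero_of_linear_bound:
  fixes X :: "'b \<Rightarrow> real"
  assumes "\<And>e. e > 0 \<Longrightarrow> eventually (\<lambda>n. \<bar>X n\<bar> \<le> e * C) F"
  shows "(X \<longlongrightarrow> 0) F"
proof (rule tendstoI)
  fix e :: real assume e: "e > 0"
  have "e / (2 * (\<bar>C\<bar> + 1)) * C \<le> e / (2 * (\<bar>C\<bar> + 1)) * (\<bar>C\<bar> + 1)"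
    using e by (intro mult_left_mono) auto
  also have "\<dots> < e" using e by (simp add: field_simps add_pos_nonneg)
  finally have "e / (2 * (\<bar>C\<bar> + 1)) * C < e" .
  with assms[of "e / (2 * (\<bar>C\<bar> + 1))"] e show "eventually (\<lambda>n. dist (X n) 0 < e) F"
    by (auto elim!: eventually_mono simp: dist_real_def)
qed

section \<open>Convexity and logarithmic derivatives of g\<close>

locale growth =
  fixes g g1 g2 :: "real \<Rightarrow> real" and t0 q :: real
  assumes g_deriv: "\<And>t. t \<ge> t0 \<Longrightarrow> (g has_real_derivative g1 t) (at t within {t0..})"
    and g1_deriv: "\<And>t. t \<ge> t0 \<Longrightarrow> (g1 has_real_derivative g2 t) (at t within {t0..})"
    and g1_pos: "\<And>t. t \<ge> t0 \<Longrightarrow> g1 t > 0"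
    and g2_pos: "\<And>t. t \<ge> t0 \<Longrightarrow> g2 t > 0"
    and lim_q: "((\<lambda>t. (g1 t)\<^sup>2 / (g t * g2 t)) \<longlongrightarrow> q) at_top"
    and q_ge_1: "1 \<le> q"
begin

lemma at_within_t0: "t > t0 \<Longrightarrow> at t within {t0..} = at t"
  by (rule at_within_interior) auto

lemma g_DERIV: "t > t0 \<Longrightarrow> (g has_real_derivative g1 t) (at t)"
  using g_deriv[of t] at_within_t0[of t] by simp

lemma g1_DERIV: "t > t0 \<Longrightarrow> (g1 has_real_derivative g2 t) (at t)"
  using g1_deriv[of t] at_within_t0[of t] by simp

lemma continuous_on_g: "continuous_on {t0..} g"
  by (rule DERIV_continuous_on) (use g_deriv in auto)

lemma continuous_on_g1: "continuous_on {t0..} g1"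
  by (rule DERIV_continuous_on) (use g1_deriv in auto)

lemma g_strict_mono:
  assumes "t0 \<le> x" "x < y"
  shows "g x < g y"
proof (rule DERIV_pos_imp_increasing_open[OF assms(2)])
  show "\<exists>d. (g has_real_derivative d) (at z) \<and> 0 < d" if "x < z" "z < y" for z
    using g_DERIV[of z] g1_pos[of z] that assms by force
  show "continuous_on {x..y} g"
    using assms by (intro continuous_on_subset[OF continuous_on_g]) auto
qed

lemma g_mono: "t0 \<le> x \<Longrightarrow> x \<le> y \<Longrightarrow> g x \<le> g y"
  using g_strict_mono[of x y] by (cases "x = y") auto

lemma g_le_iff: "t0 \<le> x \<Longrightarrow> t0 \<le> y \<Longrightarrow> g x \<le> g y \<longleftrightarrow> x \<le> y"
  using g_strict_mono[of y x] g_mono[of x y] by force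

lemma g1_mono:
  assumes "t0 \<le> x" "x \<le> y"
  shows "g1 x \<le> g1 y"
proof (cases "x = y")
  case False
  then have "x < y" using assms by simp
  then have "g1 x < g1 y"
  proof (rule DERIV_pos_imp_increasing_open)
    show "\<exists>d. (g1 has_real_derivative d) (at z) \<and> 0 < d" if "x < z" "z < y" for z
      using g1_DERIV[of z] g2_pos[of z] that assms by force
    show "continuous_on {x..y} g1"
      using assms by (intro continuous_on_subset[OF continuous_on_g1]) auto
  qed
  then show ?thesis by simp
qed simp

lemma g_mean_value:
  assumes "t0 \<le> x" "x < y"
  obtains z where "x < z" "z < y" "g y - g x = g1 z * (y - x)"
proof -
  have "continuous_on {x..y} g"
    using assms by (intro continuous_on_subset[OF continuous_on_g]) auto
  moreover have "g differentiable (at z)" if "x < z" "z < y" for z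
    using g_DERIV[of z] that assms by (auto simp: real_differentiable_def)
  ultimately obtain l z where "x < z" "z < y" "DERIV g z :> l" "g y - g x = (y - x) * l"
    using MVT[OF assms(2), of g] by blast
  moreover from this have "l = g1 z"
    using DERIV_unique[OF _ g_DERIV[of z]] assms by auto
  ultimately show ?thesis using that[of z] by (simp add: mult.commute)
qed

lemma g_tangent:
  assumes "t0 \<le> x" "t0 \<le> y"
  shows "g x + g1 x * (y - x) \<le> g y"
proof (cases x y rule: linorder_cases)
  case less
  then obtain z where z: "x < z" "z < y" "g y - g x = g1 z * (y - x)"
    using g_mean_value assms by blast
  then have "g1 x * (y - x) \<le> g1 z * (y - x)"
    using g1_mono[of x z] assms by (intro mult_right_mono) auto
  then show ?thesis using z(3) by linarith
next
  case greater
  then obtain z where z: "y < z" "z < x" "g x - g y = g1 z * (x - y)"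
    using g_mean_value assms by blast
  then have "g1 z * (x - y) \<le> g1 x * (x - y)"
    using g1_mono[of z x] assms by (intro mult_right_mono) auto
  moreover have "g1 x * (y - x) = - (g1 x * (x - y))" by (simp add: algebra_simps)
  ultimately show ?thesis using z(3) by linarith
qed simp

lemma g_at_top: "filterlim g at_top at_top"
proof (rule filterlim_at_top_mono)
  show "filterlim (\<lambda>t. g t0 + g1 t0 * (t - t0)) at_top at_top"
    by (rule filterlim_tendsto_add_at_top[OF tendsto_const])
      (intro filterlim_tendsto_pos_mult_at_top[OF tendsto_const] g1_pos order_refl
        filterlim_tendsto_add_at_top[of "\<lambda>_. - t0" "- t0" at_top "\<lambda>t. t", simplified] filterlim_ident)
  show "\<forall>\<^sub>F t in at_top. g t0 + g1 t0 * (t - t0) \<le> g t"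
    using eventually_ge_at_top[of t0] by eventually_elim (use g_tangent[of t0] in auto)
qed

lemma eventually_g_pos: "eventually (\<lambda>t. g t > 0) at_top"
  using g_at_top by (auto simp: filterlim_at_top_dense)

lemma tendsto_eps_g: "((\<lambda>t. g t * g2 t / (g1 t)\<^sup>2) \<longlongrightarrow> 1 / q) at_top"
proof -
  have "((\<lambda>t. 1 / ((g1 t)\<^sup>2 / (g t * g2 t))) \<longlongrightarrow> 1 / q) at_top"
    using q_ge_1 by (intro tendsto_intros lim_q) auto
  then show ?thesis by simp
qed

lemma ex_threshold:
  assumes "e > 0"
  obtains T where "T > t0" "\<And>t. t \<ge> T \<Longrightarrow> g t > 0"
    "\<And>t. t \<ge> T \<Longrightarrow> \<bar>g t * g2 t / (g1 t)\<^sup>2 - 1 / q\<bar> \<le> e"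
proof -
  have "eventually (\<lambda>t. \<bar>g t * g2 t / (g1 t)\<^sup>2 - 1 / q\<bar> < e) at_top"
    using tendstoD[OF tendsto_eps_g assms] by (simp add: dist_real_def)
  then have "eventually (\<lambda>t. t > t0 \<and> g t > 0 \<and> \<bar>g t * g2 t / (g1 t)\<^sup>2 - 1 / q\<bar> < e) at_top"
    using eventually_g_pos eventually_gt_at_top[of t0] by eventually_elim auto
  then obtain T where T: "\<And>t. t \<ge> T \<Longrightarrow>
      t > t0 \<and> g t > 0 \<and> \<bar>g t * g2 t / (g1 t)\<^sup>2 - 1 / q\<bar> < e"
    unfolding eventually_at_top_linorder by blast
  show ?thesis by (rule that[of T]) (use T in \<open>auto intro: less_imp_le\<close>)
qed

text \<open>With log g as variable, the derivative of log g' is g g''/g'^2, which tends to 1/q.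
  Hence beyond a threshold log g' - (1/q + e) log g is nonincreasing and log g' - (1/q - e) log g is
  nondecreasing. The threshold depends on e alone, so the bound is uniform in both points.\<close>

lemma ln_g1_vs_ln_g:
  assumes "e > 0"
  obtains T where "T > t0" "\<And>t. t \<ge> T \<Longrightarrow> g t > 0"
    "\<And>t. t \<ge> T \<Longrightarrow> \<bar>g t * g2 t / (g1 t)\<^sup>2 - 1 / q\<bar> \<le> e"
    "\<And>x y. T \<le> x \<Longrightarrow> T \<le> y \<Longrightarrow>
       \<bar>(ln (g1 y) - ln (g1 x)) - (ln (g y) - ln (g x)) / q\<bar> \<le> e * \<bar>ln (g y) - ln (g x)\<bar>"
proof -
  obtain T where T: "T > t0" "\<And>t. t \<ge> T \<Longrightarrow> g t > 0"
    "\<And>t. t \<ge> T \<Longrightarrow> \<bar>g t * g2 t / (g1 t)\<^sup>2 - 1 / q\<bar> \<le> e"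
    using ex_threshold[OF assms] by blast
  have der: "((\<lambda>t. ln (g1 t) - c * ln (g t)) has_real_derivative
      g1 t / g t * (g t * g2 t / (g1 t)\<^sup>2 - c)) (at t)" if "t \<ge> T" for t c
    using T(1) T(2)[OF that] g1_pos[of t] that
    by (auto intro!: derivative_eq_intros g_DERIV g1_DERIV simp: field_simps power2_eq_square)
  have le: "\<bar>(ln (g1 y) - ln (g1 x)) - (ln (g y) - ln (g x)) / q\<bar> \<le> e * \<bar>ln (g y) - ln (g x)\<bar>"
    if "T \<le> x" "x \<le> y" for x y
  proof -
    have "ln (g x) \<le> ln (g y)"
      using g_mono[of x y] T(1) T(2)[of x] that by simp
    moreover have "ln (g1 y) - (1 / q + e) * ln (g y) \<le> ln (g1 x) - (1 / q + e) * ln (g x)"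
    proof (rule DERIV_nonpos_imp_nonincreasing[OF that(2)])
      fix z assume z: "x \<le> z" "z \<le> y"
      have "g1 z / g z * (g z * g2 z / (g1 z)\<^sup>2 - (1 / q + e)) \<le> 0"
        using T(2)[of z] T(3)[of z] g1_pos[of z] T(1) z that by (intro mult_nonneg_nonpos) auto
      then show "\<exists>d. ((\<lambda>t. ln (g1 t) - (1 / q + e) * ln (g t)) has_real_derivative d) (at z) \<and> d \<le> 0"
        using der[of z] z that by auto
    qed
    moreover have "ln (g1 x) - (1 / q - e) * ln (g x) \<le> ln (g1 y) - (1 / q - e) * ln (g y)"
    proof (rule DERIV_nonneg_imp_nondecreasing[OF that(2)])
      fix z assume z: "x \<le> z" "z \<le> y"
      have "0 \<le> g1 z / g z * (g z * g2 z / (g1 z)\<^sup>2 - (1 / q - e))"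
        using T(2)[of z] T(3)[of z] g1_pos[of z] T(1) z that by (intro mult_nonneg_nonneg) auto
      then show "\<exists>d. ((\<lambda>t. ln (g1 t) - (1 / q - e) * ln (g t)) has_real_derivative d) (at z) \<and> 0 \<le> d"
        using der[of z] z that by auto
    qed
    ultimately show ?thesis by (simp add: abs_le_iff algebra_simps diff_divide_distrib)
  qed
  show ?thesis
  proof (rule that[OF T])
    fix x y assume xy: "T \<le> x" "T \<le> y"
    have sw: "\<bar>(ln (g1 y) - ln (g1 x)) - (ln (g y) - ln (g x)) / q\<bar> =
        \<bar>(ln (g1 x) - ln (g1 y)) - (ln (g x) - ln (g y)) / q\<bar>"
      by (simp add: abs_if diff_divide_distrib)
    show "\<bar>(ln (g1 y) - ln (g1 x)) - (ln (g y) - ln (g x)) / q\<bar> \<le> e * \<bar>ln (g y) - ln (g x)\<bar>"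
    proof (cases "x \<le> y")
      case False
      then show ?thesis using le[of y x] xy sw by (simp add: abs_minus_commute)
    qed (use le xy in auto)
  qed
qed

lemma g_large_imp:
  assumes "g t \<ge> g (max T t0)" "t \<ge> t0"
  shows "t \<ge> T"
  using assms g_le_iff[of "max T t0" t] by auto

text \<open>The comparison with e = 1, where the exponent 1/q + 1 is at most 2. It serves before any
  limit along the solutions is known: as long as g(u) >= d g(mu), g'(u) differs from g'(mu) by a
  bounded factor.\<close>

lemma g1_ratio_bound:
  assumes "0 < d"
  obtains T where "T > t0" "\<And>t. t \<ge> T \<Longrightarrow> g t > 0"
    "\<And>x y. T \<le> x \<Longrightarrow> x \<le> y \<Longrightarrow> d * g y \<le> g x \<Longrightarrow> ln (g1 y) - ln (g1 x) \<le> 2 * ln (1 / d)"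
    "\<And>t. t \<ge> T \<Longrightarrow> g2 t / (g1 t)\<^sup>2 \<le> 2 / g t"
proof -
  obtain T where T: "T > t0" "\<And>t. t \<ge> T \<Longrightarrow> g t > 0"
    "\<And>t. t \<ge> T \<Longrightarrow> \<bar>g t * g2 t / (g1 t)\<^sup>2 - 1 / q\<bar> \<le> 1"
    "\<And>x y. T \<le> x \<Longrightarrow> T \<le> y \<Longrightarrow>
       \<bar>(ln (g1 y) - ln (g1 x)) - (ln (g y) - ln (g x)) / q\<bar> \<le> 1 * \<bar>ln (g y) - ln (g x)\<bar>"
    using ln_g1_vs_ln_g[of 1] by auto
  have q1: "1 / q \<le> 1" using q_ge_1 by simp
  show ?thesis
  proof (rule that[OF T(1,2)])
    fix x y assume xy: "T \<le> x" "x \<le> y" "d * g y \<le> g x"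
    have pos: "g x > 0" "g y > 0" using T(2) xy by auto
    define l where "l = ln (g y) - ln (g x)"
    have "l \<ge> 0" using g_mono[of x y] T(1) xy pos by (simp add: l_def)
    have "ln (d * g y) \<le> ln (g x)" using xy pos assms by simp
    then have "l \<le> ln (1 / d)" using pos assms by (simp add: l_def ln_mult ln_div)
    have "(ln (g1 y) - ln (g1 x)) - l / q \<le> l"
      using T(4)[of x y] xy \<open>l \<ge> 0\<close> by (simp add: l_def[symmetric])
    moreover have "l / q \<le> l" using \<open>l \<ge> 0\<close> q_ge_1 mult_left_mono[OF q1 \<open>l \<ge> 0\<close>] by simp
    ultimately show "ln (g1 y) - ln (g1 x) \<le> 2 * ln (1 / d)" using \<open>l \<le> ln (1 / d)\<close> by linarith
  next
    fix t assume t: "t \<ge> T"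
    have "g t * (g2 t / (g1 t)\<^sup>2) \<le> 2" using T(3)[OF t] q1 by simp
    then show "g2 t / (g1 t)\<^sup>2 \<le> 2 / g t" using T(2)[OF t] by (simp add: field_simps)
  qed
qed

section \<open>Two points at comparable levels of g\<close>

context
  fixes F :: "'b filter" and X Y :: "'b \<Rightarrow> real" and \<eta> :: real
  assumes X_ge: "eventually (\<lambda>n. X n \<ge> t0) F" and Y_top: "filterlim Y at_top F"
    and ratio: "((\<lambda>n. g (X n) / g (Y n)) \<longlongrightarrow> \<eta>) F" and \<eta>: "\<eta> > 0"
begin

lemma X_at_top: "filterlim X at_top F"
  unfolding filterlim_at_top
proof
  fix Z
  have "filterlim (\<lambda>n. (g (X n) / g (Y n)) * g (Y n)) at_top F"
    by (rule filterlim_tendsto_pos_mult_at_top[OF ratio \<eta> filterlim_compose[OF g_at_top Y_top]])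
  then have "eventually (\<lambda>n. (g (X n) / g (Y n)) * g (Y n) \<ge> g (max Z t0)) F"
    by (simp add: filterlim_at_top)
  moreover have "eventually (\<lambda>n. g (Y n) > 0) F"
    using filterlim_compose[OF g_at_top Y_top] by (auto simp: filterlim_at_top_dense)
  ultimately show "eventually (\<lambda>n. Z \<le> X n) F"
    using X_ge by eventually_elim (auto intro: g_large_imp)
qed

lemma eventually_XY: "eventually (\<lambda>n. X n \<ge> T \<and> Y n \<ge> T) F"
  using X_at_top Y_top by (auto simp: filterlim_at_top eventually_conj_iff)

lemma eventually_pos_XY:
  "eventually (\<lambda>n. g (X n) > 0 \<and> g (Y n) > 0 \<and> g1 (X n) > 0 \<and> g1 (Y n) > 0) F"
  using eventually_compose_filterlim[OF eventually_g_pos X_at_top]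
    eventually_compose_filterlim[OF eventually_g_pos Y_top] eventually_XY[of t0]
  by eventually_elim (auto intro: g1_pos)

lemma tendsto_ln_ratio: "((\<lambda>n. ln (g (X n)) - ln (g (Y n))) \<longlongrightarrow> ln \<eta>) F"
proof -
  have "((\<lambda>n. ln (g (X n) / g (Y n))) \<longlongrightarrow> ln \<eta>) F"
    using \<eta> by (intro tendsto_ln ratio) auto
  moreover have "eventually (\<lambda>n. ln (g (X n) / g (Y n)) = ln (g (X n)) - ln (g (Y n))) F"
    using eventually_pos_XY by eventually_elim (simp add: ln_div)
  ultimately show ?thesis by (rule Lim_transform_eventually)
qed

lemma eventually_ln_ratio_bounded:
  "eventually (\<lambda>n. \<bar>ln (g (X n)) - ln (g (Y n))\<bar> \<le> \<bar>ln \<eta>\<bar> + 1) F"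
  using tendstoD[OF tendsto_ln_ratio, of 1]
  by (auto elim!: eventually_mono simp: dist_real_def)

lemma g1_ratio_tendsto: "((\<lambda>n. g1 (X n) / g1 (Y n)) \<longlongrightarrow> \<eta> powr (1 / q)) F"
proof -
  let ?d = "\<lambda>n. ln (g (X n)) - ln (g (Y n))"
  let ?L = "\<lambda>n. (ln (g1 (X n)) - ln (g1 (Y n))) - ?d n / q"
  have "(?L \<longlongrightarrow> 0) F"
  proof (rule tendsto_zero_of_linear_bound)
    fix e :: real assume e: "e > 0"
    obtain T where T: "T > t0" "\<And>t. t \<ge> T \<Longrightarrow> g t > 0"
    "\<And>t. t \<ge> T \<Longrightarrow> \<bar>g t * g2 t / (g1 t)\<^sup>2 - 1 / q\<bar> \<le> e"
    "\<And>x y. T \<le> x \<Longrightarrow> T \<le> y \<Longrightarrow>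
       \<bar>(ln (g1 y) - ln (g1 x)) - (ln (g y) - ln (g x)) / q\<bar> \<le> e * \<bar>ln (g y) - ln (g x)\<bar>"
      by (rule ln_g1_vs_ln_g[OF e], rule that) blast+
    show "eventually (\<lambda>n. \<bar>?L n\<bar> \<le> e * (\<bar>ln \<eta>\<bar> + 1)) F"
      using eventually_XY[of T] eventually_ln_ratio_bounded
    proof eventually_elim
      case (elim n)
      have "\<bar>?L n\<bar> \<le> e * \<bar>?d n\<bar>" using T(4)[of "Y n" "X n"] elim by simp
      also have "\<dots> \<le> e * (\<bar>ln \<eta>\<bar> + 1)" using elim e by (intro mult_left_mono) auto
      finally show ?case .
    qed
  qed
  then have "((\<lambda>n. exp (?L n + ?d n / q)) \<longlongrightarrow> exp (0 + ln \<eta> / q)) F"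
    by (intro tendsto_intros tendsto_ln_ratio) (use q_ge_1 in auto)
  moreover have "exp (0 + ln \<eta> / q) = \<eta> powr (1 / q)" using \<eta> by (simp add: powr_def)
  moreover have "eventually (\<lambda>n. exp (?L n + ?d n / q) = g1 (X n) / g1 (Y n)) F"
    using eventually_pos_XY by eventually_elim (simp add: exp_diff)
  ultimately show ?thesis by (auto intro: Lim_transform_eventually)
qed

text \<open>log g(Y) - log g(X) equals (Y - X) g'(z)/g(z) at an intermediate z. For q = 1 the
  logarithm of g'/g changes by o(1) between comparable levels, so z may be replaced by Y.\<close>

lemma log_q_tendsto_1:
  assumes "q = 1"
  shows "((\<lambda>n. (Y n - X n) * g1 (Y n) / g (Y n)) \<longlongrightarrow> log_q q \<eta>) F"
proof -
  let ?d = "\<lambda>n. ln (g (X n)) - ln (g (Y n))"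
  define D where "D = \<bar>ln \<eta>\<bar> + 1"
  have D: "D > 0" by (simp add: D_def)
  have "((\<lambda>n. (Y n - X n) * g1 (Y n) / g (Y n) + ?d n) \<longlongrightarrow> 0) F"
  proof (rule tendsto_zero_of_linear_bound[where C = 1])
    fix e' :: real assume e': "e' > 0"
    \<comment> \<open>With this e the logarithmic error over a range of length D is at most log (1 +
      e'/D). The factor \<open>exp r\<close> then differs from 1 by at most e'/D, and d times the
      difference is at most e'.\<close>
    define e where "e = ln (1 + e' / D) / D"
    have e: "e > 0" using e' D ln_gt_zero[of "1 + e' / D"] by (simp add: e_def)
    obtain T where T: "T > t0" "\<And>t. t \<ge> T \<Longrightarrow> g t > 0"
    "\<And>t. t \<ge> T \<Longrightarrow> \<bar>g t * g2 t / (g1 t)\<^sup>2 - 1 / q\<bar> \<le> e"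
    "\<And>x y. T \<le> x \<Longrightarrow> T \<le> y \<Longrightarrow>
       \<bar>(ln (g1 y) - ln (g1 x)) - (ln (g y) - ln (g x)) / q\<bar> \<le> e * \<bar>ln (g y) - ln (g x)\<bar>"
      by (rule ln_g1_vs_ln_g[OF e], rule that) blast+
    have mv: "\<exists>z. min x y \<le> z \<and> z \<le> max x y \<and> ln (g y) - ln (g x) = (y - x) * (g1 z / g z)"
      if "T \<le> x" "T \<le> y" for x y
    proof -
      have *: "\<exists>z. x \<le> z \<and> z \<le> y \<and> ln (g y) - ln (g x) = (y - x) * (g1 z / g z)"
        if "T \<le> x" "x < y" for x y
      proof -
        have "((\<lambda>t. ln (g t)) has_real_derivative g1 t / g t) (at t)" if "x \<le> t" "t \<le> y" for t
          using that \<open>T \<le> x\<close> T(1) T(2)[of t] by (auto intro!: derivative_eq_intros g_DERIV)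
        then have "\<exists>z>x. z < y \<and> ln (g y) - ln (g x) = (y - x) * (g1 z / g z)"
          by (intro MVT2[OF \<open>x < y\<close>])
        then show ?thesis by (metis less_imp_le)
      qed
      show ?thesis
      proof (cases x y rule: linorder_cases)
        case less
        then show ?thesis using *[of x y] that by auto
      next
        case greater
        then obtain z where "y \<le> z" "z \<le> x" "ln (g x) - ln (g y) = (x - y) * (g1 z / g z)"
          using *[OF \<open>T \<le> y\<close> greater] by blast
        then have "ln (g y) - ln (g x) = (y - x) * (g1 z / g z)"
          by (metis minus_diff_eq minus_mult_left)
        then show ?thesis using \<open>y \<le> z\<close> \<open>z \<le> x\<close> by (intro exI[of _ z]) auto
      qed auto
    qed
    show "eventually (\<lambda>n. \<bar>(Y n - X n) * g1 (Y n) / g (Y n) + ?d n\<bar> \<le> e' * 1) F"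
      using eventually_XY[of T] eventually_ln_ratio_bounded
    proof eventually_elim
      case (elim n)
      define x y where "x = X n" and "y = Y n"
      have xy: "T \<le> x" "T \<le> y" using elim by (auto simp: x_def y_def)
      define d where "d = ln (g y) - ln (g x)"
      have d: "\<bar>d\<bar> \<le> D" using elim by (auto simp: d_def x_def y_def D_def)
      obtain z where z: "min x y \<le> z" "z \<le> max x y" "d = (y - x) * (g1 z / g z)"
        using mv[OF xy] by (auto simp: d_def)
      have zT: "T \<le> z" using z xy by auto
      have "ln (g (min x y)) \<le> ln (g z)" "ln (g z) \<le> ln (g (max x y))"
        using g_mono[of "min x y" z] g_mono[of z "max x y"] z T(1) xy T(2)[of "min x y"] T(2)[OF zT] zT
        by auto
      then have "\<bar>ln (g z) - ln (g y)\<bar> \<le> \<bar>d\<bar>"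
        by (auto simp: d_def min_def max_def split: if_splits)
      then have zd: "\<bar>ln (g z) - ln (g y)\<bar> \<le> D" using d by simp
      define r where "r = (ln (g1 y) - ln (g1 z)) - (ln (g y) - ln (g z))"
      have "\<bar>r\<bar> \<le> e * \<bar>ln (g y) - ln (g z)\<bar>"
        using T(4)[OF zT xy(2)] assms by (simp add: r_def)
      also have "\<dots> \<le> e * D" using zd e by (intro mult_left_mono) auto
      finally have r: "\<bar>r\<bar> \<le> ln (1 + e' / D)" using D by (simp add: e_def)
      have pos: "g y > 0" "g z > 0" "g1 y > 0" "g1 z > 0"
        using T xy zT g1_pos by auto
      have "exp r = (g1 y / g1 z) / (g y / g z)"
        using pos by (simp add: r_def exp_diff)
      then have "(y - x) * g1 y / g y = d * exp r"
        using pos by (simp add: z(3))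
      then have "\<bar>(y - x) * g1 y / g y - d\<bar> = \<bar>d\<bar> * \<bar>exp r - 1\<bar>"
        by (simp add: abs_mult[symmetric] algebra_simps)
      also have "\<bar>exp r - 1\<bar> \<le> e' / D"
      proof -
        have "exp r \<le> exp (ln (1 + e' / D))" using r by simp
        then have up: "exp r \<le> 1 + e' / D" using e' D by (simp add: add_pos_pos)
        have "exp (- r) \<le> exp (ln (1 + e' / D))" using r by simp
        then have "exp (- r) \<le> 1 + e' / D" using e' D by (simp add: add_pos_pos)
        moreover have "1 + r \<le> exp r" "1 + (- r) \<le> exp (- r)"
          by (rule exp_ge_add_one_self)+
        ultimately show ?thesis using up by linarith
      qed
      then have "\<bar>d\<bar> * \<bar>exp r - 1\<bar> \<le> D * (e' / D)" using d D by (intro mult_mono) auto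
      finally show ?case using D by (simp add: d_def x_def y_def algebra_simps)
    qed
  qed
  from tendsto_diff[OF this tendsto_ln_ratio] show ?thesis
    using assms by (simp add: log_q_def)
qed

text \<open>g/g' has derivative 1 - g g''/g'^2, which tends to beta = 1 - 1/q. So the increment of
  g/g' from X to Y is nearly beta (Y - X), while relative to the value at Y it tends to 1 - eta /
  eta^(1/q) = 1 - eta^beta. Dividing by beta confines the argument to q > 1.\<close>

lemma log_q_tendsto_gt_1:
  assumes "1 < q"
  shows "((\<lambda>n. (Y n - X n) * g1 (Y n) / g (Y n)) \<longlongrightarrow> log_q q \<eta>) F"
proof -
  define \<beta> where "\<beta> = 1 - 1 / q"
  have \<beta>: "\<beta> > 0" using assms by (simp add: \<beta>_def)
  define A where "A = (\<lambda>n. (Y n - X n) * g1 (Y n) / g (Y n))"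
  define w where "w = (\<lambda>n. 1 - (g (X n) / g (Y n)) / (g1 (X n) / g1 (Y n)))"
  define \<omega> where "\<omega> = \<eta> / \<eta> powr (1 / q)"
  have w: "(w \<longlongrightarrow> 1 - \<omega>) F"
    unfolding w_def \<omega>_def using \<eta> by (intro tendsto_intros ratio g1_ratio_tendsto) auto
  have "((\<lambda>n. w n - \<beta> * A n) \<longlongrightarrow> 0) F"
  proof (rule tendsto_zero_of_linear_bound)
    fix e' :: real assume e': "e' > 0"
    \<comment> \<open>The bound e <= beta/2 lets the term e |A| be absorbed, which bounds A before
      its limit is known.\<close>
    define e where "e = min e' (\<beta> / 2)"
    have e: "e > 0" "e \<le> e'" "e \<le> \<beta> / 2" using e' \<beta> by (auto simp: e_def)
    obtain T where T: "T > t0" "\<And>t. t \<ge> T \<Longrightarrow> g t > 0"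
      "\<And>t. t \<ge> T \<Longrightarrow> \<bar>g t * g2 t / (g1 t)\<^sup>2 - 1 / q\<bar> \<le> e"
      using ex_threshold[OF e(1)] by blast
    let ?V = "\<lambda>t. g t / g1 t"
    have V: "(?V has_real_derivative 1 - g t * g2 t / (g1 t)\<^sup>2) (at t)" if "t \<ge> T" for t
      using T(1) g1_pos[of t] that
      by (auto intro!: derivative_eq_intros g_DERIV g1_DERIV simp: field_simps power2_eq_square)
    have mv: "\<bar>(?V y - ?V x) - \<beta> * (y - x)\<bar> \<le> e * \<bar>y - x\<bar>" if "T \<le> x" "x < y" for x y
    proof -
      have "\<exists>z>x. z < y \<and> ?V y - ?V x = (y - x) * (1 - g z * g2 z / (g1 z)\<^sup>2)"
        by (rule MVT2[OF \<open>x < y\<close>]) (use V that in auto)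
      then obtain z where z: "x < z" "z < y"
          "?V y - ?V x = (y - x) * (1 - g z * g2 z / (g1 z)\<^sup>2)"
        by blast
      have "(?V y - ?V x) - \<beta> * (y - x) = (y - x) * (1 / q - g z * g2 z / (g1 z)\<^sup>2)"
        by (simp add: z(3) \<beta>_def algebra_simps)
      also have "\<bar>\<dots>\<bar> \<le> \<bar>y - x\<bar> * e"
        using T(3)[of z] z that by (simp add: abs_mult abs_minus_commute mult_left_mono)
      finally show ?thesis by (simp add: mult.commute)
    qed
    have mv': "\<bar>(?V y - ?V x) - \<beta> * (y - x)\<bar> \<le> e * \<bar>y - x\<bar>" if "T \<le> x" "T \<le> y" for x y
      using mv[of x y] mv[of y x] that
      by (cases x y rule: linorder_cases) (auto simp: abs_le_iff algebra_simps)
    have bd: "eventually (\<lambda>n. \<bar>w n\<bar> \<le> \<bar>1 - \<omega>\<bar> + 1) F"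
      using tendstoD[OF w, of 1] by (auto elim!: eventually_mono simp: dist_real_def)
    show "eventually (\<lambda>n. \<bar>w n - \<beta> * A n\<bar> \<le> e' * (2 * (\<bar>1 - \<omega>\<bar> + 1) / \<beta>)) F"
      using eventually_XY[of T] bd
    proof eventually_elim
      case (elim n)
      define x y where "x = X n" and "y = Y n"
      have xy: "T \<le> x" "T \<le> y" using elim by (auto simp: x_def y_def)
      have pos: "g x > 0" "g y > 0" "g1 y > 0" "g1 x > 0"
        using T xy g1_pos by auto
      have "(?V y - ?V x) / ?V y = 1 - ?V x / ?V y"
        using pos by (simp only: diff_divide_distrib) simp
      moreover have "?V x / ?V y = (g x / g y) / (g1 x / g1 y)" by simp
      ultimately have wn: "w n = (?V y - ?V x) / ?V y"
        by (simp only: w_def x_def y_def)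
      have An: "A n = (y - x) / ?V y"
        by (simp add: A_def x_def y_def)
      have "w n - \<beta> * A n = ((?V y - ?V x) - \<beta> * (y - x)) / ?V y"
        unfolding wn An diff_divide_distrib[of "?V y - ?V x" "\<beta> * (y - x)"] by simp
      also have "\<bar>\<dots>\<bar> \<le> e * \<bar>y - x\<bar> / ?V y"
        using mv'[OF xy] pos by (simp add: abs_divide divide_right_mono del: divide_divide_eq_right)
      also have "\<dots> = e * \<bar>A n\<bar>" using pos by (simp add: An abs_divide abs_mult)
      finally have *: "\<bar>w n - \<beta> * A n\<bar> \<le> e * \<bar>A n\<bar>" .
      have "\<beta> * \<bar>A n\<bar> = \<bar>\<beta> * A n\<bar>" using \<beta> by (simp add: abs_mult)
      then have "\<beta> * \<bar>A n\<bar> \<le> \<bar>w n\<bar> + e * \<bar>A n\<bar>" using * by linarith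
      moreover have "e * \<bar>A n\<bar> \<le> \<beta> / 2 * \<bar>A n\<bar>" using e by (intro mult_right_mono) auto
      ultimately have "\<beta> * \<bar>A n\<bar> \<le> 2 * (\<bar>1 - \<omega>\<bar> + 1)" using elim by simp
      then have "\<bar>A n\<bar> \<le> 2 * (\<bar>1 - \<omega>\<bar> + 1) / \<beta>" using \<beta> by (simp add: field_simps)
      then have "e * \<bar>A n\<bar> \<le> e' * (2 * (\<bar>1 - \<omega>\<bar> + 1) / \<beta>)"
        using e by (intro mult_mono) auto
      with * show ?case by simp
    qed
  qed
  from tendsto_diff[OF w this] have "((\<lambda>n. \<beta> * A n / \<beta>) \<longlongrightarrow> (1 - \<omega> - 0) / \<beta>) F"
    using \<beta> by (intro tendsto_divide) auto
  moreover have "(1 - \<omega> - 0) / \<beta> = log_q q \<eta>"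
  proof -
    have "\<omega> = \<eta> powr \<beta>" using \<eta> by (simp add: \<omega>_def \<beta>_def powr_diff)
    moreover have "p_of q = 1 / \<beta>" using assms by (simp add: p_of_def \<beta>_def field_simps)
    ultimately show ?thesis using assms by (simp add: log_q_def)
  qed
  ultimately show ?thesis using \<beta> by (simp add: A_def)
qed

lemma log_q_tendsto: "((\<lambda>n. (Y n - X n) * g1 (Y n) / g (Y n)) \<longlongrightarrow> log_q q \<eta>) F"
  using log_q_tendsto_1 log_q_tendsto_gt_1 q_ge_1 by force

end

lemma V_over_t_tendsto: "((\<lambda>t. (g t / g1 t) / t) \<longlongrightarrow> 1 - 1 / q) at_top"
proof (rule lhospital_at_top_at_top[where g' = "\<lambda>_. 1"
      and f' = "\<lambda>t. 1 - g t * g2 t / (g1 t)\<^sup>2"])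
  show "\<forall>\<^sub>F t in at_top. ((\<lambda>t. g t / g1 t) has_real_derivative 1 - g t * g2 t / (g1 t)\<^sup>2) (at t)"
    using eventually_gt_at_top[of t0]
  proof eventually_elim
    case (elim t)
    then show ?case using g1_pos[of t]
      by (auto intro!: derivative_eq_intros g_DERIV g1_DERIV simp: field_simps power2_eq_square)
  qed
  show "((\<lambda>t. (1 - g t * g2 t / (g1 t)\<^sup>2) / 1) \<longlongrightarrow> 1 - 1 / q) at_top"
    by (simp, intro tendsto_intros tendsto_eps_g)
qed (auto simp: filterlim_ident)

text \<open>X/Y is 1 minus the product of (Y - X) g'(Y)/g(Y) and g(Y)/(g'(Y) Y). The second factor
  tends to 1 - 1/q by l'Hospital's rule; for q = 1 this is 0, so comparable levels of g have
  asymptotically equal arguments.\<close>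

lemma argument_ratio_tendsto:
  assumes "eventually (\<lambda>n. X n \<ge> t0) F" "filterlim Y at_top F"
    "((\<lambda>n. g (X n) / g (Y n)) \<longlongrightarrow> \<eta>) F" "\<eta> > 0" "q < 2"
  shows "((\<lambda>n. X n / Y n) \<longlongrightarrow> (if q = 1 then 1 else \<eta> powr (1 / p_of q))) F"
proof -
  have A: "((\<lambda>n. 1 - ((Y n - X n) * g1 (Y n) / g (Y n)) * ((g (Y n) / g1 (Y n)) / Y n)) \<longlongrightarrow>
      1 - log_q q \<eta> * (1 - 1 / q)) F"
    by (intro tendsto_intros log_q_tendsto assms filterlim_compose[OF V_over_t_tendsto assms(2)])
  have B: "1 - log_q q \<eta> * (1 - 1 / q) = (if q = 1 then 1 else \<eta> powr (1 / p_of q))"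
  proof (cases "q = 1")
    case False
    then have "1 < q" using q_ge_1 by simp
    then have "p_of q * (1 - 1 / q) = 1" by (simp add: p_of_def field_simps)
    then have "log_q q \<eta> * (1 - 1 / q) = 1 - \<eta> powr (1 / p_of q)"
      using False by (simp add: log_q_def mult.assoc mult.commute[of "1 - _ powr _"])
    then show ?thesis using False by simp
  qed simp
  have C: "eventually (\<lambda>n. 1 - ((Y n - X n) * g1 (Y n) / g (Y n)) * ((g (Y n) / g1 (Y n)) / Y n)
      = X n / Y n) F"
    using filterlim_at_top_dense[THEN iffD1, OF assms(2), rule_format, of "max 0 t0"]
      eventually_compose_filterlim[OF eventually_g_pos assms(2)]
  proof eventually_elim
    case (elim n)
    then show ?case using g1_pos[of "Y n"] by (simp add: field_simps)
  qed
  show ?thesis unfolding B[symmetric] by (rule Lim_transform_eventually[OF A C])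
qed

end

section \<open>The radial equation in logarithmic time\<close>

lemma increment_bound:
  fixes \<phi> :: "real \<Rightarrow> real"
  assumes "a \<le> b" "\<And>t. a \<le> t \<Longrightarrow> t \<le> b \<Longrightarrow> (\<phi> has_real_derivative \<phi>' t) (at t)"
    and "\<And>t. a \<le> t \<Longrightarrow> t \<le> b \<Longrightarrow> \<bar>\<phi>' t\<bar> \<le> B"
  shows "\<bar>\<phi> b - \<phi> a\<bar> \<le> B * (b - a)"
proof (cases "a = b")
  case False
  then have "a < b" using assms by simp
  then have "\<exists>z>a. z < b \<and> \<phi> b - \<phi> a = (b - a) * \<phi>' z"
    by (rule MVT2) (use assms in auto)
  then obtain z where z: "a < z" "z < b" "\<phi> b - \<phi> a = (b - a) * \<phi>' z" by blast
  have "\<bar>(b - a) * \<phi>' z\<bar> \<le> (b - a) * B"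
    using assms(3)[of z] z by (simp add: abs_mult mult_left_mono)
  then show ?thesis by (simp add: z(3) mult.commute)
qed simp

lemma log_time_mono:
  fixes \<phi> :: "real \<Rightarrow> real"
  assumes "a \<le> b" "\<And>s. a \<le> s \<Longrightarrow> s \<le> b \<Longrightarrow> (\<phi> has_real_derivative \<phi>' s) (at s)"
    and "\<And>s. a \<le> s \<Longrightarrow> s \<le> b \<Longrightarrow> \<phi>' s \<ge> 0"
  shows "\<phi> a \<le> \<phi> b"
  by (rule DERIV_nonneg_imp_nondecreasing[OF assms(1)]) (use assms in blast)

text \<open>The centre r = 0 is s = -infinity. Monotonicity in s is combined with continuity in r at
  0, so that a comparison can start from the known value at the centre.\<close>

lemma mono_from_zero:
  fixes \<phi> :: "real \<Rightarrow> real"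
  assumes cont: "continuous_on {0..exp s} \<phi>"
    and der: "\<And>t. t \<le> s \<Longrightarrow> ((\<lambda>t. \<phi> (exp t)) has_real_derivative \<phi>' t) (at t)"
    and nn: "\<And>t. t \<le> s \<Longrightarrow> \<phi>' t \<ge> 0"
  shows "\<phi> 0 \<le> \<phi> (exp s)"
proof -
  have "((\<lambda>r. \<phi> r) \<longlongrightarrow> \<phi> 0) (at 0 within {0..exp s})"
    using cont by (simp add: continuous_on)
  moreover have "filterlim exp (at 0 within {0..exp s}) at_bot"
    unfolding filterlim_at
    using exp_at_bot eventually_le_at_bot[of s] by (auto elim!: eventually_mono)
  ultimately have "((\<lambda>t. \<phi> (exp t)) \<longlongrightarrow> \<phi> 0) at_bot"
    by (rule filterlim_compose)
  moreover have "eventually (\<lambda>t. \<phi> (exp t) \<le> \<phi> (exp s)) at_bot"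
    using eventually_le_at_bot[of s]
  proof eventually_elim
    case (elim t)
    show ?case
    proof (rule log_time_mono[where \<phi> = "\<lambda>t. \<phi> (exp t)" and \<phi>' = \<phi>', OF elim])
      fix t assume "t \<le> s"
      then show "((\<lambda>t. \<phi> (exp t)) has_real_derivative \<phi>' t) (at t)" "\<phi>' t \<ge> 0"
        by (rule der, rule nn)
    qed
  qed
  ultimately show ?thesis
    by (intro tendsto_upperbound[where F = "at_bot :: real filter"]) auto
qed

lemma ln_le_of_le_exp: "0 < r \<Longrightarrow> r \<le> exp s \<Longrightarrow> ln r \<le> s" for r s :: real
  using exp_ln[of r] exp_le_cancel_iff[of "ln r" s] by simp

locale radial_family = growth g g1 g2 t0 q for g g1 g2 :: "real \<Rightarrow> real" and t0 q :: real +
  fixes h h1 f f1 :: "real \<Rightarrow> real" and lam mu :: "nat \<Rightarrow> real" and u u1 u2 :: "nat \<Rightarrow> real \<Rightarrow> real"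
  assumes q_less_2: "q < 2"
    and t0_nonneg: "0 \<le> t0"
    and h_pos: "\<And>r. 0 \<le> r \<Longrightarrow> r \<le> 1 \<Longrightarrow> h r > 0"
    and h_deriv: "\<And>r. 0 \<le> r \<Longrightarrow> r \<le> 1 \<Longrightarrow> (h has_real_derivative h1 r) (at r within {0..1})"
    and h1_cont: "continuous_on {0..1} h1"
    and f_nonneg: "\<And>t. 0 \<le> t \<Longrightarrow> f t \<ge> 0"
    and f_deriv: "\<And>t. 0 \<le> t \<Longrightarrow> (f has_real_derivative f1 t) (at t within {0..})"
    and f1_cont: "continuous_on {0..} f1"
    and f_exp: "\<And>t. t0 \<le> t \<Longrightarrow> f t = exp (g t)"
    and lam_pos: "\<And>n. lam n > 0"
    and u_deriv: "\<And>n r. 0 \<le> r \<Longrightarrow> r \<le> 1 \<Longrightarrow> (u n has_real_derivative u1 n r) (at r within {0..1})"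
    and u1_deriv: "\<And>n r. 0 \<le> r \<Longrightarrow> r \<le> 1 \<Longrightarrow> (u1 n has_real_derivative u2 n r) (at r within {0..1})"
    and u2_cont: "\<And>n. continuous_on {0..1} (u2 n)"
    and ode: "\<And>n r. 0 < r \<Longrightarrow> r < 1 \<Longrightarrow> - u2 n r - u1 n r / r = lam n * h r * f (u n r)"
    and u_pos: "\<And>n r. 0 < r \<Longrightarrow> r < 1 \<Longrightarrow> u n r > 0"
    and u_0: "\<And>n. u n 0 = mu n" and u1_0: "\<And>n. u1 n 0 = 0" and u_1: "\<And>n. u n 1 = 0"
    and mu_top: "filterlim mu at_top sequentially"
begin

text \<open>With $s = \log r$: \<open>MM\<close> is minus the derivative of \<open>UU\<close>, \<open>PP\<close> is the derivative of \<open>MM\<close>, and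
  \<open>yy\<close>, \<open>FF\<close> are their products with $g'(u)$, for which the equation is a slow perturbation of the
  autonomous system $y' = F$, $F' = F (2 - y)$ with first integral $F + (y - 2)^2 / 2$.\<close>

definition UU :: "nat \<Rightarrow> real \<Rightarrow> real" where "UU n s = u n (exp s)"
definition MM :: "nat \<Rightarrow> real \<Rightarrow> real" where "MM n s = - exp s * u1 n (exp s)"
definition PP :: "nat \<Rightarrow> real \<Rightarrow> real" where
  "PP n s = lam n * (exp s)\<^sup>2 * h (exp s) * f (UU n s)"
definition yy :: "nat \<Rightarrow> real \<Rightarrow> real" where "yy n s = MM n s * g1 (UU n s)"
definition FF :: "nat \<Rightarrow> real \<Rightarrow> real" where "FF n s = PP n s * g1 (UU n s)"
definition GG :: "nat \<Rightarrow> real \<Rightarrow> real" where "GG n s = g (UU n s)"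
definition NN :: "nat \<Rightarrow> real" where "NN n = g (mu n)"
definition kap :: "real \<Rightarrow> real" where "kap s = exp s * h1 (exp s) / h (exp s)"
definition eps :: "nat \<Rightarrow> real \<Rightarrow> real" where "eps n s = g2 (UU n s) / (g1 (UU n s))\<^sup>2"
definition EE :: "nat \<Rightarrow> real \<Rightarrow> real" where "EE n s = FF n s + (yy n s - 2)\<^sup>2 / 2"

text \<open>The part of the orbit where g(u) has kept the fraction d of its maximum; all errors are
  of order 1/g(mu) there. It is an initial ray in s because u decreases. The strict inequalities
  provide two-sided derivatives of u and of g.\<close>

definition dom :: "real \<Rightarrow> nat \<Rightarrow> real \<Rightarrow> bool" where
  "dom d n s \<longleftrightarrow> s < 0 \<and> t0 < UU n s \<and> d * NN n \<le> GG n s"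

abbreviation slow_bounds :: "real \<Rightarrow> real \<Rightarrow> nat \<Rightarrow> bool" where
  "slow_bounds d C n \<equiv> NN n > 0 \<and> (\<forall>s. dom d n s \<longrightarrow>
    0 \<le> yy n s \<and> yy n s \<le> C \<and> 0 < FF n s \<and> FF n s \<le> C \<and>
    exp s \<le> 1 / NN n \<and> \<bar>kap s\<bar> \<le> 1 / NN n \<and> 0 < eps n s \<and> eps n s \<le> C / NN n)"

section \<open>The first-order system in logarithmic time\<close>

lemma at_within_01: "0 < r \<Longrightarrow> r < 1 \<Longrightarrow> at r within {0..1::real} = at r"
  by (rule at_within_interior) auto

lemma UU_deriv:
  assumes "s < 0"
  shows "(UU n has_real_derivative - MM n s) (at s)"
proof -
  have "(u n has_real_derivative u1 n (exp s)) (at (exp s))"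
    using u_deriv[of "exp s" n] at_within_01[of "exp s"] assms by auto
  from DERIV_chain2[where f = "u n" and g = exp, OF this DERIV_exp]
  show ?thesis unfolding UU_def[abs_def] MM_def by (simp add: mult.commute)
qed

lemma continuous_on_u: "continuous_on {0..1} (u n)"
  by (rule DERIV_continuous_on) (use u_deriv in auto)

lemma continuous_on_u1: "continuous_on {0..1} (u1 n)"
  by (rule DERIV_continuous_on) (use u1_deriv in auto)

lemma continuous_on_h: "continuous_on {0..1} h"
  by (rule DERIV_continuous_on) (use h_deriv in auto)

lemma continuous_on_f: "continuous_on {0..} f"
  by (rule DERIV_continuous_on) (use f_deriv in auto)

lemma UU_pos: "s < 0 \<Longrightarrow> UU n s > 0"
  unfolding UU_def by (rule u_pos) auto

lemma h_exp_pos: "s < 0 \<Longrightarrow> h (exp s) > 0"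
  by (rule h_pos) auto

lemma MM_deriv:
  assumes "s < 0"
  shows "(MM n has_real_derivative PP n s) (at s)"
proof -
  have "(u1 n has_real_derivative u2 n (exp s)) (at (exp s))"
    using u1_deriv[of "exp s" n] at_within_01[of "exp s"] assms by auto
  note c = DERIV_chain2[where f = "u1 n" and g = exp, OF this DERIV_exp]
  have "(MM n has_real_derivative
      - exp s * u1 n (exp s) + - exp s * (u2 n (exp s) * exp s)) (at s)"
    unfolding MM_def[abs_def] by (rule derivative_eq_intros c refl)+ simp
  moreover have "- u2 n (exp s) - u1 n (exp s) / exp s = lam n * h (exp s) * f (u n (exp s))"
    using ode[of "exp s" n] assms by simp
  then have "u2 n (exp s) = - u1 n (exp s) / exp s - lam n * h (exp s) * f (u n (exp s))"
    by simp
  ultimately show ?thesis by (simp add: PP_def UU_def algebra_simps power2_eq_square)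
qed

lemma PP_nonneg: "s < 0 \<Longrightarrow> PP n s \<ge> 0"
  unfolding PP_def using lam_pos[of n] h_exp_pos[of s] f_nonneg[of "UU n s"] UU_pos[of s n] by simp

lemma PP_pos: "s < 0 \<Longrightarrow> t0 < UU n s \<Longrightarrow> PP n s > 0"
  unfolding PP_def using lam_pos[of n] h_exp_pos[of s] f_exp[of "UU n s"] by simp

lemma MM_nonneg:
  assumes "s < 0"
  shows "MM n s \<ge> 0"
proof -
  have "(\<lambda>r. - r * u1 n r) 0 \<le> (\<lambda>r. - r * u1 n r) (exp s)"
  proof (rule mono_from_zero)
    have "continuous_on {0..exp s} (u1 n)"
      using assms by (intro continuous_on_subset[OF continuous_on_u1]) auto
    then show "continuous_on {0..exp s} (\<lambda>r. - r * u1 n r)"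
      by (intro continuous_intros)
    show "((\<lambda>t. - exp t * u1 n (exp t)) has_real_derivative PP n t) (at t)" "PP n t \<ge> 0"
      if "t \<le> s" for t
      using MM_deriv[of t n] PP_nonneg[of t n] that assms by (auto simp: MM_def[abs_def])
  qed
  then show ?thesis by (simp add: MM_def)
qed

lemma MM_mono: "s \<le> t \<Longrightarrow> t < 0 \<Longrightarrow> MM n s \<le> MM n t"
  using log_time_mono[of s t "MM n" "PP n"] MM_deriv PP_nonneg by auto

lemma UU_antimono: "s \<le> t \<Longrightarrow> t < 0 \<Longrightarrow> UU n t \<le> UU n s"
  using log_time_mono[of s t "\<lambda>s. - UU n s" "MM n"] MM_nonneg DERIV_minus[OF UU_deriv] by auto

lemma UU_le_mu:
  assumes "s < 0"
  shows "UU n s \<le> mu n"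
proof -
  have "(\<lambda>r. - u n r) 0 \<le> (\<lambda>r. - u n r) (exp s)"
  proof (rule mono_from_zero)
    have "continuous_on {0..exp s} (u n)"
      using assms by (intro continuous_on_subset[OF continuous_on_u]) auto
    then show "continuous_on {0..exp s} (\<lambda>r. - u n r)"
      by (intro continuous_intros)
    show "((\<lambda>t. - u n (exp t)) has_real_derivative MM n t) (at t)" "MM n t \<ge> 0"
      if "t \<le> s" for t
      using DERIV_minus[OF UU_deriv[of t n]] MM_nonneg[of t n] that assms by (auto simp: UU_def[abs_def])
  qed
  then show ?thesis by (simp add: UU_def u_0)
qed

lemma kap_bound:
  obtains K where "K \<ge> 0" "\<And>s. s \<le> 0 \<Longrightarrow> \<bar>kap s\<bar> \<le> K * exp s"
proof -
  have "continuous_on {0..1} (\<lambda>r. h1 r / h r)"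
    using h_pos by (intro continuous_intros h1_cont continuous_on_h) force
  then have "bounded ((\<lambda>r. h1 r / h r) ` {0..1})"
    by (intro compact_imp_bounded compact_continuous_image) auto
  then obtain K where "\<forall>r\<in>{0..1}. norm (h1 r / h r) \<le> K"
    by (auto simp: bounded_iff)
  then have K: "\<bar>h1 r / h r\<bar> \<le> K" if "r \<in> {0..1}" for r using that by simp
  have "\<bar>kap s\<bar> \<le> max K 0 * exp s" if "s \<le> 0" for s
  proof -
    have "\<bar>kap s\<bar> = exp s * \<bar>h1 (exp s) / h (exp s)\<bar>"
      by (simp add: kap_def abs_mult)
    also have "\<dots> \<le> exp s * max K 0"
      using K[of "exp s"] that by (intro mult_left_mono) auto
    finally show ?thesis by (simp add: mult.commute)
  qed
  then show ?thesis using that[of "max K 0"] by auto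
qed

lemma NN_at_top: "filterlim NN at_top sequentially"
  unfolding NN_def[abs_def] by (rule filterlim_compose[OF g_at_top mu_top])

lemma eventually_NN: "eventually (\<lambda>n. NN n > B) sequentially"
  using NN_at_top by (simp add: filterlim_at_top_dense)

context
  fixes n s
  assumes s: "s < 0" "t0 < UU n s"
begin

lemma g1_UU_pos: "g1 (UU n s) > 0"
  using s by (intro g1_pos) auto

lemma eps_pos: "eps n s > 0"
  unfolding eps_def using g1_UU_pos g2_pos[of "UU n s"] s by simp

lemma FF_pos: "FF n s > 0"
  unfolding FF_def using g1_UU_pos PP_pos s by simp

lemma yy_nonneg: "yy n s \<ge> 0"
  unfolding yy_def using g1_UU_pos MM_nonneg s by simp

lemma GG_deriv: "(GG n has_real_derivative - yy n s) (at s)"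
  unfolding GG_def[abs_def] yy_def
  using DERIV_chain2[where f = g and g = "UU n", OF g_DERIV[OF s(2)] UU_deriv[OF s(1)]]
  by (simp add: mult.commute)

lemma g1_UU_deriv:
  "((\<lambda>s. g1 (UU n s)) has_real_derivative - (eps n s * yy n s * g1 (UU n s))) (at s)"
  using DERIV_chain2[where f = g1 and g = "UU n", OF g1_DERIV[OF s(2)] UU_deriv[OF s(1)]] g1_UU_pos
  by (simp add: eps_def yy_def power2_eq_square mult.commute)

lemma ln_g1_UU_deriv:
  "((\<lambda>s. ln (g1 (UU n s))) has_real_derivative - (eps n s * yy n s)) (at s)"
  by (rule derivative_eq_intros g1_UU_deriv g1_UU_pos)+ (use g1_UU_pos in simp)

lemma PP_deriv: "(PP n has_real_derivative PP n s * (2 + kap s - yy n s)) (at s)"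
proof -
  have fd: "(f has_real_derivative f (UU n s) * g1 (UU n s)) (at (UU n s))"
  proof (rule DERIV_cong[OF has_field_derivative_transform_within_open[where f = "\<lambda>t. exp (g t)"]])
    show "((\<lambda>t. exp (g t)) has_real_derivative exp (g (UU n s)) * g1 (UU n s)) (at (UU n s))"
      by (auto intro!: derivative_eq_intros g_DERIV s)
    show "open {t0<..}" by simp
  qed (use s f_exp in auto)
  have hd: "(h has_real_derivative h1 (exp s)) (at (exp s))"
    using h_deriv[of "exp s"] at_within_01[of "exp s"] s by auto
  note fc = DERIV_chain2[where f = f and g = "UU n", OF fd UU_deriv[OF s(1)]]
  note hc = DERIV_chain2[where f = h and g = exp, OF hd DERIV_exp]
  have "h (exp s) \<noteq> 0" using h_exp_pos[of s] s by simp
  then show ?thesis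
    unfolding PP_def[abs_def]
    by (auto intro!: derivative_eq_intros fc hc simp: kap_def yy_def field_simps power2_eq_square)
qed

lemma yy_deriv: "(yy n has_real_derivative FF n s - eps n s * (yy n s)\<^sup>2) (at s)"
  unfolding yy_def[abs_def]
  by (rule derivative_eq_intros MM_deriv g1_UU_deriv s)+
    (simp add: FF_def yy_def power2_eq_square algebra_simps)

lemma FF_deriv: "(FF n has_real_derivative FF n s * (2 + kap s - yy n s - eps n s * yy n s)) (at s)"
  unfolding FF_def[abs_def]
  by (rule derivative_eq_intros PP_deriv g1_UU_deriv s)+ (simp add: algebra_simps)

text \<open>The leading terms F (2 - y) and (y - 2) F cancel; every remaining term carries one of
  the small coefficients \<open>kap\<close> and \<open>eps\<close>.\<close>

lemma EE_deriv: "(EE n has_real_derivative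
    FF n s * (kap s - eps n s * yy n s) - (yy n s - 2) * (eps n s * (yy n s)\<^sup>2)) (at s)"
  unfolding EE_def[abs_def]
  by (auto intro!: derivative_eq_intros FF_deriv yy_deriv simp: field_simps power2_eq_square)

end

section \<open>Bounds where g(u) is comparable to g(mu)\<close>

lemma domD: "dom d n s \<Longrightarrow> s < 0" "dom d n s \<Longrightarrow> t0 < UU n s" "dom d n s \<Longrightarrow> d * NN n \<le> GG n s"
  by (auto simp: dom_def)

lemma dom_down:
  assumes "dom d n t" "s \<le> t"
  shows "dom d n s"
  using assms UU_antimono[of s t n] g_mono[of "UU n t" "UU n s"] by (auto simp: dom_def GG_def)

lemma dom_weaken: "dom d n s \<Longrightarrow> d' \<le> d \<Longrightarrow> NN n \<ge> 0 \<Longrightarrow> dom d' n s"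
  using mult_right_mono[of d' d "NN n"] by (auto simp: dom_def)

lemma GG_le_NN: "s < 0 \<Longrightarrow> t0 < UU n s \<Longrightarrow> GG n s \<le> NN n"
  unfolding GG_def NN_def using UU_le_mu by (intro g_mono) auto

lemma continuous_on_g1_u:
  assumes "dom d n s"
  shows "continuous_on {0..exp s} (\<lambda>r. g1 (u n r))" "continuous_on {0..exp s} (\<lambda>r. g (u n r))"
    "continuous_on {0..exp s} (\<lambda>r. f (u n r))"
proof -
  have "t0 < u n r" if "r \<in> {0..exp s}" for r
  proof (cases "r = 0")
    case True
    then show ?thesis using domD[OF assms] UU_le_mu[of s n] by (simp add: u_0)
  next
    case False
    then have "dom d n (ln r)"
      using that by (intro dom_down[OF assms]) (simp add: ln_le_of_le_exp)
    then show ?thesis using domD(2)[of d n "ln r"] that False by (simp add: UU_def)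
  qed
  then have im: "u n ` {0..exp s} \<subseteq> {t0..}" "u n ` {0..exp s} \<subseteq> {0..}"
    using t0_nonneg by fastforce+
  have c: "continuous_on {0..exp s} (u n)"
    using domD[OF assms] by (intro continuous_on_subset[OF continuous_on_u]) auto
  show "continuous_on {0..exp s} (\<lambda>r. g1 (u n r))"
    by (rule continuous_on_compose2[OF continuous_on_g1 c im(1)])
  show "continuous_on {0..exp s} (\<lambda>r. g (u n r))"
    by (rule continuous_on_compose2[OF continuous_on_g c im(1)])
  show "continuous_on {0..exp s} (\<lambda>r. f (u n r))"
    by (rule continuous_on_compose2[OF continuous_on_f c im(2)])
qed

lemma dom_continuous_parts:
  assumes "dom d n s"
  shows "continuous_on {0..exp s} (\<lambda>r. - r * u1 n r * g1 (u n r))"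
    "continuous_on {0..exp s} (\<lambda>r. lam n * r\<^sup>2 * h r * f (u n r) * g1 (u n r))"
proof -
  have "exp s \<le> 1" using domD[OF assms] by simp
  then have "{0..exp s} \<subseteq> {0..1}" using order_trans[OF _ \<open>exp s \<le> 1\<close>] by auto
  then have "continuous_on {0..exp s} (u1 n)" "continuous_on {0..exp s} h"
    using continuous_on_subset[OF continuous_on_u1] continuous_on_subset[OF continuous_on_h]
    by blast+
  then show "continuous_on {0..exp s} (\<lambda>r. - r * u1 n r * g1 (u n r))"
    "continuous_on {0..exp s} (\<lambda>r. lam n * r\<^sup>2 * h r * f (u n r) * g1 (u n r))"
    by (auto intro!: continuous_intros continuous_on_g1_u[OF assms])
qed

lemma eventually_dom_large:
  assumes "0 < d"
  shows "eventually (\<lambda>n. NN n > 0 \<and> (\<forall>s. dom d n s \<longrightarrow> T \<le> UU n s)) sequentially"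
  using eventually_NN[of "max 0 (g (max T t0) / d)"]
proof eventually_elim
  case (elim n)
  have "g (max T t0) \<le> d * NN n" using elim assms by (simp add: pos_divide_less_eq mult.commute)
  then have "T \<le> UU n s" if "dom d n s" for s
    using domD[OF that] by (intro g_large_imp[of T "UU n s"]) (auto simp: GG_def)
  then show ?case using elim by simp
qed

text \<open>The quantity $F + (y - L)^2/2 + (L^2/4) \log g'(u)$ with $L = 2 + K$ is nonincreasing, because
  $L y^2 - y^3 \le L^2 y / 4$.\<close>

lemma dom_bounded:
  assumes d: "0 < d" "d < 1"
  obtains C where "C > 0"
    "eventually (\<lambda>n. \<forall>s. dom d n s \<longrightarrow> yy n s \<le> C \<and> FF n s \<le> C) sequentially"
proof -
  obtain K where K: "K \<ge> 0" "\<And>s. s \<le> 0 \<Longrightarrow> \<bar>kap s\<bar> \<le> K * exp s" using kap_bound by blast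
  obtain T where T: "T > t0" "\<And>t. t \<ge> T \<Longrightarrow> g t > 0"
    "\<And>x y. T \<le> x \<Longrightarrow> x \<le> y \<Longrightarrow> d * g y \<le> g x \<Longrightarrow> ln (g1 y) - ln (g1 x) \<le> 2 * ln (1 / d)"
    "\<And>t. t \<ge> T \<Longrightarrow> g2 t / (g1 t)\<^sup>2 \<le> 2 / g t"
    by (rule g1_ratio_bound[OF d(1)], rule that) blast+
  define L where "L = 2 + K"
  \<comment> \<open>The value L^2/2 at the centre, where F = y = 0, plus the largest possible change
    of (L^2/4) log g' from u up to mu, which is controlled by g(u) >= d g(mu).\<close>
  define B where "B = L\<^sup>2 / 2 + L\<^sup>2 / 4 * (2 * ln (1 / d))"
  have "ln (1 / d) \<ge> 0" using d by simp
  then have B: "B \<ge> 0" by (simp add: B_def)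
  have L: "L \<ge> 2" using K by (simp add: L_def)
  define C where "C = B + L + 2 * B + 1"
  show ?thesis
  proof (rule that[of C])
    show "C > 0" using B L by (simp add: C_def)
    show "eventually (\<lambda>n. \<forall>s. dom d n s \<longrightarrow> yy n s \<le> C \<and> FF n s \<le> C) sequentially"
      using eventually_dom_large[OF d(1), of T]
    proof eventually_elim
      case (elim n)
      show ?case
      proof (intro allI impI)
        fix s assume D: "dom d n s"
        note s = domD[OF D]
        \<comment> \<open>Written as a function of r, because the comparison starts at r =
          0.\<close>
        define \<phi> where "\<phi> r = lam n * r\<^sup>2 * h r * f (u n r) * g1 (u n r) +
          (- r * u1 n r * g1 (u n r) - L)\<^sup>2 / 2 + L\<^sup>2 / 4 * ln (g1 (u n r))" for r
        have eq: "\<phi> (exp t) = FF n t + (yy n t - L)\<^sup>2 / 2 + L\<^sup>2 / 4 * ln (g1 (UU n t))" for t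
          by (simp add: \<phi>_def FF_def PP_def yy_def MM_def UU_def)
        have "(\<lambda>r. - \<phi> r) 0 \<le> (\<lambda>r. - \<phi> r) (exp s)"
        proof (rule mono_from_zero)
          have "g1 (u n r) \<noteq> 0" if "r \<in> {0..exp s}" for r
          proof (cases "r = 0")
            case True
            then show ?thesis using s UU_le_mu[of s n] g1_pos[of "mu n"] by (simp add: u_0)
          next
            case False
            then have "dom d n (ln r)"
              using that by (intro dom_down[OF D]) (simp add: ln_le_of_le_exp)
            then show ?thesis using g1_UU_pos[of "ln r" n] domD[of d n "ln r"] that False
              by (simp add: UU_def)
          qed
          then show "continuous_on {0..exp s} (\<lambda>r. - \<phi> r)"
            unfolding \<phi>_def
            by (intro continuous_intros dom_continuous_parts[OF D] continuous_on_g1_u[OF D]) auto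
        next
          fix t assume t: "t \<le> s"
          note Dt = domD[OF dom_down[OF D t]]
          show "((\<lambda>t. - \<phi> (exp t)) has_real_derivative
              - (FF n t * (2 + kap t - yy n t - eps n t * yy n t) +
                 (yy n t - L) * (FF n t - eps n t * (yy n t)\<^sup>2) - L\<^sup>2 / 4 * (eps n t * yy n t))) (at t)"
          proof -
            have "((\<lambda>t. (yy n t - L)\<^sup>2 / 2) has_real_derivative
                (yy n t - L) * (FF n t - eps n t * (yy n t)\<^sup>2)) (at t)"
              by (auto intro!: derivative_eq_intros yy_deriv Dt simp: field_simps power2_eq_square)
            then show ?thesis
              unfolding eq
              by (rule DERIV_cong[OF DERIV_minus[OF DERIV_add[OF DERIV_add[OF FF_deriv[OF Dt(1,2)]]
                  DERIV_cmult[OF ln_g1_UU_deriv[OF Dt(1,2)]]]]]) simp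
          qed
          have "kap t - K \<le> 0"
          proof -
            have "K * exp t \<le> K * 1" using K(1) Dt by (intro mult_left_mono) auto
            then show ?thesis using K(2)[of t] Dt by auto
          qed
          have pos: "eps n t > 0" "yy n t \<ge> 0" "FF n t > 0"
            using eps_pos yy_nonneg FF_pos Dt by auto
          have 1: "FF n t * (kap t - K - eps n t * yy n t) \<le> 0"
            using pos \<open>kap t - K \<le> 0\<close> mult_nonneg_nonneg[of "eps n t" "yy n t"]
            by (intro mult_nonneg_nonpos) linarith+
          have 2: "0 \<le> eps n t * yy n t * (yy n t - L / 2)\<^sup>2"
            using pos by auto
          have "FF n t * (2 + kap t - yy n t - eps n t * yy n t) +
                 (yy n t - L) * (FF n t - eps n t * (yy n t)\<^sup>2) - L\<^sup>2 / 4 * (eps n t * yy n t) =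
              FF n t * (kap t - K - eps n t * yy n t) - eps n t * yy n t * (yy n t - L / 2)\<^sup>2"
            by (simp add: L_def algebra_simps power2_eq_square)
          then show "- (FF n t * (2 + kap t - yy n t - eps n t * yy n t) +
                 (yy n t - L) * (FF n t - eps n t * (yy n t)\<^sup>2) - L\<^sup>2 / 4 * (eps n t * yy n t)) \<ge> 0"
            using 1 2 by linarith
        qed
        then have "FF n s + (yy n s - L)\<^sup>2 / 2 + L\<^sup>2 / 4 * ln (g1 (UU n s))
            \<le> L\<^sup>2 / 2 + L\<^sup>2 / 4 * ln (g1 (mu n))"
          unfolding eq by (simp add: \<phi>_def u_0 power2_eq_square)
        moreover have "ln (g1 (mu n)) - ln (g1 (UU n s)) \<le> 2 * ln (1 / d)"
          using T(3)[of "UU n s" "mu n"] elim D UU_le_mu[of s n] s by (simp add: NN_def GG_def)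
        then have "L\<^sup>2 / 4 * (ln (g1 (mu n)) - ln (g1 (UU n s))) \<le> L\<^sup>2 / 4 * (2 * ln (1 / d))"
          by (intro mult_left_mono) auto
        ultimately have *: "FF n s + (yy n s - L)\<^sup>2 / 2 \<le> B"
          by (simp add: B_def algebra_simps)
        have "0 \<le> (yy n s - L)\<^sup>2" "FF n s > 0" using FF_pos s by auto
        moreover have "2 * (yy n s - L) \<le> (yy n s - L)\<^sup>2 + 1"
          using zero_le_power2[of "yy n s - L - 1"] by (simp add: power2_diff)
        ultimately show "yy n s \<le> C \<and> FF n s \<le> C"
          using * B L unfolding C_def by argo
      qed
    qed
  qed
qed

text \<open>The boundary value u(1) = 0 is at most t0, and for large n the level d' g(mu) exceeds
  g(t0); so the orbit has to cross this level before r = 1.\<close>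

lemma level_hit:
  assumes "0 < d'" "d' \<le> d"
  shows "eventually (\<lambda>n. \<forall>a. dom d n a \<longrightarrow>
    (\<exists>s. a \<le> s \<and> GG n s = d' * NN n \<and> dom d' n s)) sequentially"
  using eventually_NN[of "max 0 (g t0 / d')"]
proof eventually_elim
  case (elim n)
  then have N: "NN n > 0" "g t0 < d' * NN n"
    using assms by (simp_all add: pos_divide_less_eq mult.commute)
  show ?case
  proof (intro allI impI)
    fix a assume D: "dom d n a"
    note a = domD[OF D]
    have "d' * NN n \<le> d * NN n" using N assms by (intro mult_right_mono) auto
    then have "d' * NN n \<le> g (UU n a)" using a by (simp add: GG_def)
    then obtain v where v: "t0 \<le> v" "v \<le> UU n a" "g v = d' * NN n"
      using IVT'[of g t0 "d' * NN n" "UU n a"] a N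
        continuous_on_subset[OF continuous_on_g, of "{t0..UU n a}"] by auto
    have "v \<noteq> t0" using v N by auto
    then have "t0 < v" using v by simp
    have "continuous_on {a..0} (UU n)"
      unfolding UU_def by (intro continuous_intros continuous_on_compose2[OF continuous_on_u[of n]]) auto
    then obtain s where s: "a \<le> s" "s \<le> 0" "UU n s = v"
      using IVT2'[of "UU n" 0 v a] a v t0_nonneg u_1[of n] by (auto simp: UU_def)
    have "s \<noteq> 0" using s u_1[of n] \<open>t0 < v\<close> t0_nonneg by (auto simp: UU_def)
    then show "\<exists>s. a \<le> s \<and> GG n s = d' * NN n \<and> dom d' n s"
      using s v \<open>t0 < v\<close> by (intro exI[of _ s]) (auto simp: dom_def GG_def)
  qed
qed

text \<open>g(u) decreases with speed y <= C, so the drop from d g(mu) to half of it takes at least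
  the time d g(mu) / (2 C), and the lower level is still reached before s = 0.\<close>

lemma dom_persist:
  assumes d: "0 < d" "d < 1"
  obtains c where "c > 0" "eventually (\<lambda>n. \<forall>a. dom d n a \<longrightarrow>
    a + c * NN n < 0 \<and> dom (d / 2) n (a + c * NN n)) sequentially"
proof -
  obtain C where C: "C > 0"
    "eventually (\<lambda>n. \<forall>s. dom (d / 2) n s \<longrightarrow> yy n s \<le> C \<and> FF n s \<le> C) sequentially"
    using dom_bounded[of "d / 2"] d by auto
  define c where "c = d / (2 * C)"
  show ?thesis
  proof (rule that[of c])
    show "c > 0" using d C by (simp add: c_def)
    have hit: "eventually (\<lambda>n. \<forall>a. dom d n a \<longrightarrow>
        (\<exists>s. a \<le> s \<and> GG n s = d / 2 * NN n \<and> dom (d / 2) n s)) sequentially"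
      using d by (intro level_hit) auto
    show "eventually (\<lambda>n. \<forall>a. dom d n a \<longrightarrow>
        a + c * NN n < 0 \<and> dom (d / 2) n (a + c * NN n)) sequentially"
      using hit C(2)
    proof eventually_elim
      case (elim n)
      show ?case
      proof (intro allI impI)
        fix a assume D: "dom d n a"
        then obtain s where s: "a \<le> s" "GG n s = d / 2 * NN n" "dom (d / 2) n s"
          using elim(1) by blast
        have "\<bar>GG n s - GG n a\<bar> \<le> C * (s - a)"
        proof (rule increment_bound[OF s(1)])
          fix t assume t: "a \<le> t" "t \<le> s"
          have Dt: "dom (d / 2) n t" using dom_down[OF s(3) t(2)] .
          show "(GG n has_real_derivative - yy n t) (at t)" by (rule GG_deriv) (rule domD[OF Dt])+
          show "\<bar>- yy n t\<bar> \<le> C" using yy_nonneg[of t n] domD[OF Dt] elim(2) Dt by auto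
        qed
        moreover have "GG n a \<ge> d * NN n" using domD[OF D] by auto
        ultimately have "d / 2 * NN n \<le> C * (s - a)" using s(2) by linarith
        then have "c * NN n \<le> s - a" using C(1) by (simp add: c_def field_simps)
        then show "a + c * NN n < 0 \<and> dom (d / 2) n (a + c * NN n)"
          using dom_down[OF s(3), of "a + c * NN n"] domD by force
      qed
    qed
  qed
qed

text \<open>A point of the region has by \<open>dom_persist\<close> a time c g(mu) left before s =
  0. Hence exp s <= exp (- c g(mu)), which is smaller than any power of 1/g(mu) and makes the
  variation of h negligible. The coefficient \<open>eps\<close> is about 1/(q g(u)), and g(u) >= d
  g(mu).\<close>

lemma dom_slow:
  assumes d: "0 < d" "d < 1"
  obtains C where "C > 0" "eventually (\<lambda>n. slow_bounds d C n) sequentially"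
proof -
  obtain K where K: "K \<ge> 0" "\<And>s. s \<le> 0 \<Longrightarrow> \<bar>kap s\<bar> \<le> K * exp s" using kap_bound by blast
  obtain T where T: "T > t0" "\<And>t. t \<ge> T \<Longrightarrow> g t > 0"
    "\<And>x y. T \<le> x \<Longrightarrow> x \<le> y \<Longrightarrow> d * g y \<le> g x \<Longrightarrow> ln (g1 y) - ln (g1 x) \<le> 2 * ln (1 / d)"
    "\<And>t. t \<ge> T \<Longrightarrow> g2 t / (g1 t)\<^sup>2 \<le> 2 / g t"
    by (rule g1_ratio_bound[OF d(1)], rule that) blast+
  obtain C where C: "C > 0"
    "eventually (\<lambda>n. \<forall>s. dom d n s \<longrightarrow> yy n s \<le> C \<and> FF n s \<le> C) sequentially"
    using dom_bounded[OF d] by blast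
  obtain c where c: "c > 0" "eventually (\<lambda>n. \<forall>a. dom d n a \<longrightarrow>
      a + c * NN n < 0 \<and> dom (d / 2) n (a + c * NN n)) sequentially"
    using dom_persist[OF d] by blast
  show ?thesis
  proof (rule that[of "max C (2 / d)"])
    show "max C (2 / d) > 0" using C by simp
    show "eventually (\<lambda>n. slow_bounds d (max C (2 / d)) n)
      sequentially"
      using C(2) c(2) eventually_dom_large[OF d(1), of T] eventually_NN[of "2 * (K + 1) / c\<^sup>2"]
    proof eventually_elim
      case (elim n)
      have N: "NN n > 0" using elim by auto
      show ?case
      proof (intro conjI allI impI N)
        fix s assume D: "dom d n s"
        note s = domD[OF D]
        show "0 \<le> yy n s" "0 < FF n s" "0 < eps n s"
          using yy_nonneg FF_pos eps_pos s by auto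
        show "yy n s \<le> max C (2 / d)" "FF n s \<le> max C (2 / d)" using elim(1) D by auto
        have x: "0 \<le> c * NN n" using c N by simp
        have "(c * NN n)\<^sup>2 / 2 \<le> exp (c * NN n)"
          using exp_lower_Taylor_quadratic[OF x] x by simp
        moreover have "0 < (c * NN n)\<^sup>2" using c N by simp
        ultimately have "exp (- (c * NN n)) \<le> 2 / (c * NN n)\<^sup>2"
          by (simp add: exp_minus field_simps)
        moreover have "exp s \<le> exp (- (c * NN n))" using elim(2) D by force
        ultimately have "exp s \<le> 2 / (c * NN n)\<^sup>2" by linarith
        then have "(K + 1) * exp s \<le> (K + 1) * (2 / (c * NN n)\<^sup>2)"
          using K by (intro mult_left_mono) auto
        also have "\<dots> = (2 * (K + 1) / c\<^sup>2) / NN n / NN n"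
          using c N by (simp add: field_simps power2_eq_square)
        also have "2 * (K + 1) / c\<^sup>2 / NN n \<le> 1" using elim(4) N by (subst pos_divide_le_eq) auto
        then have "2 * (K + 1) / c\<^sup>2 / NN n / NN n \<le> 1 / NN n"
          using N by (intro divide_right_mono) auto
        finally have e: "(K + 1) * exp s \<le> 1 / NN n" .
        have "0 \<le> K * exp s" using K by simp
        then show "exp s \<le> 1 / NN n" using e by (simp add: algebra_simps)
        show "\<bar>kap s\<bar> \<le> 1 / NN n"
          using K(2)[of s] s e exp_gt_zero[of s] unfolding distrib_right by linarith
        have TU: "T \<le> UU n s" using elim(3) D by auto
        have "eps n s \<le> 2 / GG n s" using T(4)[OF TU] by (simp add: eps_def GG_def)
        also have "\<dots> \<le> 2 / (d * NN n)"
          using s d N by (intro divide_left_mono) (auto simp: GG_def T(2)[OF TU])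
        also have "\<dots> = (2 / d) / NN n" by simp
        also have "\<dots> \<le> max C (2 / d) / NN n"
          using N by (intro divide_right_mono) auto
        finally show "eps n s \<le> max C (2 / d) / NN n" .
      qed
    qed
  qed
qed

text \<open>The derivative of g(u) is bounded and those of the first integral and of log g'(u) are
  of order 1/g(mu). Over a time o(g(mu)) the relative level, the first integral and g'(u) are
  therefore frozen in the limit.\<close>

lemma dom_drift:
  assumes d: "0 < d" "d < 1" and e: "e > 0"
    and a: "eventually (\<lambda>n. dom d n (a n)) sequentially"
    and \<Delta>: "\<And>n. \<Delta> n \<ge> 0" "(\<lambda>n. \<Delta> n / NN n) \<longlonglongrightarrow> 0"
  shows "eventually (\<lambda>n. \<forall>s. a n \<le> s \<and> s \<le> a n + \<Delta> n \<longrightarrow> dom (d / 2) n s \<and>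
    \<bar>GG n s - GG n (a n)\<bar> \<le> e * NN n \<and> \<bar>EE n s - EE n (a n)\<bar> \<le> e \<and>
    \<bar>ln (g1 (UU n s)) - ln (g1 (UU n (a n)))\<bar> \<le> e) sequentially"
proof -
  obtain c where c: "c > 0" "eventually (\<lambda>n. \<forall>a. dom d n a \<longrightarrow>
      a + c * NN n < 0 \<and> dom (d / 2) n (a + c * NN n)) sequentially"
    using dom_persist[OF d] by blast
  obtain C where C: "C > 0" "eventually (\<lambda>n. slow_bounds (d / 2) C n) sequentially"
    using dom_slow[of "d / 2"] d by auto
  \<comment> \<open>One constant for three derivatives: at most B for \<open>GG\<close>, at most
    B/NN for \<open>EE\<close> and for log g'. Over a time theta NN with theta B <= e the changes
    are at most e NN, e and e; the scale m in \<open>bnd\<close> below is NN in the first case and 1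
    in the others.\<close>
  define B where "B = C + C * (1 + C * C) + (C + 2) * (C * C\<^sup>2) + C * C"
  have B: "B \<ge> 0" using C by (simp add: B_def)
  define \<theta> where "\<theta> = min c (e / (B + 1))"
  have \<theta>: "\<theta> > 0" "\<theta> \<le> c" "\<theta> \<le> e / (B + 1)"
    using c e B by (auto simp: \<theta>_def)
  then have \<theta>B: "\<theta> * (B + 1) \<le> e" using B by (simp add: pos_le_divide_eq)
  have "eventually (\<lambda>n. \<Delta> n / NN n < \<theta>) sequentially"
    using order_tendstoD(2)[OF \<Delta>(2) \<theta>(1)] .
  then show ?thesis
    using c(2) C(2) a
  proof eventually_elim
    case (elim n)
    have N: "NN n > 0" using elim by auto
    have \<Delta>n: "\<Delta> n \<le> \<theta> * NN n" using elim(1) N by (simp add: field_simps)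
    have "\<Delta> n \<le> c * NN n" using \<Delta>n mult_right_mono[OF \<theta>(2), of "NN n"] N by linarith
    then have D: "dom (d / 2) n t" if "t \<le> a n + \<Delta> n" for t
      using elim(2,4) that by (intro dom_down[of "d / 2" n "a n + c * NN n" t]) auto
    show ?case
    proof (intro allI impI)
      fix s assume s: "a n \<le> s \<and> s \<le> a n + \<Delta> n"
      have bnd: "\<bar>\<phi> s - \<phi> (a n)\<bar> \<le> e * m"
        if der: "\<And>t. dom (d / 2) n t \<Longrightarrow> (\<phi> has_real_derivative \<phi>' t) (at t)"
          and b: "\<And>t. dom (d / 2) n t \<Longrightarrow> \<bar>\<phi>' t\<bar> \<le> B / NN n * m" and m: "m > 0" for \<phi> \<phi>' m
      proof -
        have "\<bar>\<phi> s - \<phi> (a n)\<bar> \<le> B / NN n * m * (s - a n)"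
          by (rule increment_bound[where \<phi>' = \<phi>']) (use s der b D in auto)
        also have "\<dots> \<le> B / NN n * m * (\<theta> * NN n)"
          using s \<Delta>n B N m by (intro mult_left_mono) auto
        also have "\<dots> = (\<theta> * B) * m" using N by simp
        also have "\<dots> \<le> e * m"
          using \<theta> \<theta>B m by (intro mult_right_mono) (auto simp: algebra_simps)
        finally show ?thesis .
      qed
      have bd: "0 \<le> yy n t" "yy n t \<le> C" "0 < FF n t" "FF n t \<le> C" "\<bar>kap t\<bar> \<le> 1 / NN n"
          "0 < eps n t" "eps n t \<le> C / NN n" if "dom (d / 2) n t" for t
        using elim(3) that by auto
      have B': "0 \<le> C * (1 + C * C)" "0 \<le> (C + 2) * (C * C\<^sup>2)" "0 \<le> C * C"
        using C by auto
      have "\<bar>GG n s - GG n (a n)\<bar> \<le> e * NN n"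
      proof (rule bnd)
        fix t assume t: "dom (d / 2) n t"
        show "(GG n has_real_derivative - yy n t) (at t)"
          by (rule GG_deriv) (rule domD[OF t])+
        have "yy n t \<le> B" using bd(2)[OF t] B' unfolding B_def by linarith
        then show "\<bar>- yy n t\<bar> \<le> B / NN n * NN n" using bd(1)[OF t] N by simp
      qed (rule N)
      moreover have "\<bar>ln (g1 (UU n s)) - ln (g1 (UU n (a n)))\<bar> \<le> e * 1"
      proof (rule bnd)
        fix t assume t: "dom (d / 2) n t"
        show "((\<lambda>s. ln (g1 (UU n s))) has_real_derivative - (eps n t * yy n t)) (at t)"
          by (rule ln_g1_UU_deriv) (rule domD[OF t])+
        have "eps n t * yy n t \<le> (C / NN n) * C"
          using bd[OF t] C N by (intro mult_mono) auto
        also have "\<dots> \<le> B / NN n * 1"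
          using B' C N by (simp add: B_def divide_right_mono)
        finally show "\<bar>- (eps n t * yy n t)\<bar> \<le> B / NN n * 1" using bd[OF t] by (simp add: abs_mult)
      qed simp
      moreover have "\<bar>EE n s - EE n (a n)\<bar> \<le> e * 1"
      proof (rule bnd)
        fix t assume t: "dom (d / 2) n t"
        show "(EE n has_real_derivative FF n t * (kap t - eps n t * yy n t) -
            (yy n t - 2) * (eps n t * (yy n t)\<^sup>2)) (at t)"
          by (rule EE_deriv) (rule domD[OF t])+
        have "\<bar>FF n t * (kap t - eps n t * yy n t)\<bar> \<le> C * (1 / NN n + (C / NN n) * C)"
          unfolding abs_mult
        proof (intro mult_mono)
          have "eps n t * yy n t \<le> (C / NN n) * C" "0 \<le> eps n t * yy n t"
            by (rule mult_mono, use bd[OF t] C(1) N in auto)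
          then show "\<bar>kap t - eps n t * yy n t\<bar> \<le> 1 / NN n + (C / NN n) * C"
            using bd(5)[OF t] by linarith
        qed (use bd[OF t] C in auto)
        moreover have "\<bar>(yy n t - 2) * (eps n t * (yy n t)\<^sup>2)\<bar> \<le> (C + 2) * ((C / NN n) * C\<^sup>2)"
          unfolding abs_mult using bd[OF t] C N
          by (intro mult_mono power_mono) (auto simp: abs_le_iff)
        ultimately have "\<bar>FF n t * (kap t - eps n t * yy n t) - (yy n t - 2) * (eps n t * (yy n t)\<^sup>2)\<bar>
            \<le> C * (1 / NN n + (C / NN n) * C) + (C + 2) * ((C / NN n) * C\<^sup>2)"
          by linarith
        also have "\<dots> = (C * (1 + C * C) + (C + 2) * (C * C\<^sup>2)) / NN n"
          using N by (simp add: field_simps)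
        also have "\<dots> \<le> B / NN n * 1"
          using B' C N by (simp add: B_def divide_right_mono)
        finally show "\<bar>FF n t * (kap t - eps n t * yy n t) - (yy n t - 2) * (eps n t * (yy n t)\<^sup>2)\<bar>
            \<le> B / NN n * 1" .
      qed simp
      ultimately show "dom (d / 2) n s \<and> \<bar>GG n s - GG n (a n)\<bar> \<le> e * NN n \<and>
          \<bar>EE n s - EE n (a n)\<bar> \<le> e \<and> \<bar>ln (g1 (UU n s)) - ln (g1 (UU n (a n)))\<bar> \<le> e"
        using D s by auto
    qed
  qed
qed

end

section \<open>Convergence to the profile near a bubble\<close>

lemma diagonal_sequence:
  fixes Q :: "nat \<Rightarrow> nat \<Rightarrow> bool"
  assumes "\<And>j. eventually (Q j) sequentially"
  obtains J where "filterlim J at_top sequentially" "eventually (\<lambda>n. Q (J n) n) sequentially"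
proof -
  obtain b where b: "\<And>j n. b j \<le> n \<Longrightarrow> Q j n"
    using assms unfolding eventually_sequentially by metis
  define A where "A n = {j. j \<le> n \<and> b j \<le> n}" for n
  define J where "J n = Max (insert 0 (A n))" for n
  have fin: "finite (A n)" for n by (rule finite_subset[of _ "{..n}"]) (auto simp: A_def)
  have ge: "j \<le> J n" if "j \<le> n" "b j \<le> n" for j n
    using that fin[of n] by (auto simp: J_def A_def intro!: Max_ge)
  show ?thesis
  proof (rule that[of J])
    show "filterlim J at_top sequentially"
      unfolding filterlim_at_top eventually_sequentially
    proof
      fix Z show "\<exists>N. \<forall>n\<ge>N. Z \<le> J n"
        by (rule exI[of _ "max Z (b Z)"]) (auto intro: ge)
    qed
    show "eventually (\<lambda>n. Q (J n) n) sequentially"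
      unfolding eventually_sequentially
    proof (rule exI[of _ "b 0"], intro allI impI)
      fix n assume n: "b 0 \<le> n"
      have "J n \<in> insert 0 (A n)" unfolding J_def by (rule Max_in) (use fin in auto)
      then have "b (J n) \<le> n" using n by (auto simp: A_def)
      then show "Q (J n) n" by (rule b)
    qed
  qed
qed

lemma eventually_choice:
  assumes "eventually (\<lambda>n. \<exists>x. P n x) F"
  obtains X where "eventually (\<lambda>n. P n (X n)) F"
proof -
  have "eventually (\<lambda>n. P n (SOME x. P n x)) F"
    using assms by eventually_elim (rule someI_ex)
  then show ?thesis by (rule that)
qed

text \<open>The square is used because the modulus of w need not be differentiable at its zeros. The
  inequality 2 |w| e <= w^2 + e^2 absorbs the inhomogeneous term and accounts for the 1 in the rate
  2 L + 1.\<close>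

lemma gronwall_square:
  fixes w :: "real \<Rightarrow> real"
  assumes e: "e \<ge> 0" and L: "L \<ge> 0"
    and der: "\<And>\<sigma>. 0 \<le> \<sigma> \<Longrightarrow> \<sigma> \<le> J \<Longrightarrow> (w has_real_derivative w' \<sigma>) (at \<sigma>)"
    and bd: "\<And>\<sigma>. 0 \<le> \<sigma> \<Longrightarrow> \<sigma> \<le> J \<Longrightarrow> \<bar>w' \<sigma>\<bar> \<le> e + L * \<bar>w \<sigma>\<bar>"
    and \<sigma>: "0 \<le> \<sigma>" "\<sigma> \<le> J"
  shows "(w \<sigma>)\<^sup>2 \<le> ((w 0)\<^sup>2 + e\<^sup>2) * exp ((2 * L + 1) * J)"
proof -
  define k where "k = 2 * L + 1"
  define \<phi> where "\<phi> t = - (((w t)\<^sup>2 + e\<^sup>2) * exp (- (k * t)))" for t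
  have "\<phi> 0 \<le> \<phi> \<sigma>"
  proof (rule log_time_mono[OF \<sigma>(1)])
    fix t assume t: "0 \<le> t" "t \<le> \<sigma>"
    show "(\<phi> has_real_derivative (k * ((w t)\<^sup>2 + e\<^sup>2) - 2 * w t * w' t) * exp (- (k * t))) (at t)"
      unfolding \<phi>_def using t \<sigma>
      by (auto intro!: derivative_eq_intros der simp: algebra_simps power2_eq_square)
    have "2 * w t * w' t \<le> 2 * \<bar>w t\<bar> * \<bar>w' t\<bar>"
      using abs_ge_self[of "2 * w t * w' t"] by (simp add: abs_mult)
    also have "\<dots> \<le> 2 * \<bar>w t\<bar> * (e + L * \<bar>w t\<bar>)"
      using bd[of t] t \<sigma> by (intro mult_left_mono) auto
    also have "\<dots> = 2 * \<bar>w t\<bar> * e + 2 * L * (w t)\<^sup>2"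
      by (simp add: algebra_simps power2_eq_square)
    also have "2 * \<bar>w t\<bar> * e \<le> (w t)\<^sup>2 + e\<^sup>2"
      using zero_le_power2[of "\<bar>w t\<bar> - e"] by (simp add: power2_diff)
    finally have "2 * w t * w' t \<le> k * (w t)\<^sup>2 + e\<^sup>2"
      by (simp add: k_def algebra_simps)
    also have "e\<^sup>2 \<le> k * e\<^sup>2" using L by (simp add: k_def algebra_simps)
    finally show "(k * ((w t)\<^sup>2 + e\<^sup>2) - 2 * w t * w' t) * exp (- (k * t)) \<ge> 0"
      by (intro mult_nonneg_nonneg) (auto simp: algebra_simps)
  qed
  then have "((w \<sigma>)\<^sup>2 + e\<^sup>2) * exp (- (k * \<sigma>)) \<le> (w 0)\<^sup>2 + e\<^sup>2" by (simp add: \<phi>_def)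
  then have "((w \<sigma>)\<^sup>2 + e\<^sup>2) * exp (- (k * \<sigma>)) * exp (k * \<sigma>) \<le> ((w 0)\<^sup>2 + e\<^sup>2) * exp (k * \<sigma>)"
    by (intro mult_right_mono) auto
  then have "(w \<sigma>)\<^sup>2 + e\<^sup>2 \<le> ((w 0)\<^sup>2 + e\<^sup>2) * exp (k * \<sigma>)"
    by (simp add: mult.assoc flip: exp_add)
  also have "\<dots> \<le> ((w 0)\<^sup>2 + e\<^sup>2) * exp (k * J)"
    using \<sigma> L by (intro mult_left_mono) (auto simp: k_def intro!: mult_left_mono)
  finally show ?thesis using zero_le_power2[of e] unfolding k_def by linarith
qed

lemma gronwall_square_two_sided:
  fixes w :: "real \<Rightarrow> real"
  assumes e: "e \<ge> 0" and L: "L \<ge> 0"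
    and der: "\<And>\<sigma>. \<bar>\<sigma>\<bar> \<le> J \<Longrightarrow> (w has_real_derivative w' \<sigma>) (at \<sigma>)"
    and bd: "\<And>\<sigma>. \<bar>\<sigma>\<bar> \<le> J \<Longrightarrow> \<bar>w' \<sigma>\<bar> \<le> e + L * \<bar>w \<sigma>\<bar>"
    and \<sigma>: "\<bar>\<sigma>\<bar> \<le> J"
  shows "(w \<sigma>)\<^sup>2 \<le> ((w 0)\<^sup>2 + e\<^sup>2) * exp ((2 * L + 1) * J)"
proof (cases "\<sigma> \<ge> 0")
  case True
  show ?thesis
    by (rule gronwall_square[OF e L, of J w w']) (use der bd \<sigma> True in auto)
next
  case False
  have "(w (- (- \<sigma>)))\<^sup>2 \<le> ((w (- 0))\<^sup>2 + e\<^sup>2) * exp ((2 * L + 1) * J)"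
  proof (rule gronwall_square[OF e L, of J "\<lambda>t. w (- t)" "\<lambda>t. - w' (- t)"])
    fix t assume t: "0 \<le> t" "t \<le> J"
    have "(w has_real_derivative w' (- t)) (at (- t))" using der[of "- t"] t by auto
    from DERIV_chain2[where f = w and g = uminus, OF this DERIV_minus[OF DERIV_ident]]
    show "((\<lambda>t. w (- t)) has_real_derivative - w' (- t)) (at t)" by simp
    show "\<bar>- w' (- t)\<bar> \<le> e + L * \<bar>w (- t)\<bar>" using bd[of "- t"] t by auto
  qed (use \<sigma> False in auto)
  then show ?thesis by simp
qed

lemma tendsto_via_diagonal:
  fixes X :: "nat \<Rightarrow> real"
  assumes J: "filterlim J at_top sequentially" and f: "f \<longlonglongrightarrow> l"
    and X: "eventually (\<lambda>n. \<bar>X n - f (J n)\<bar> \<le> 1 / (real (J n) + 1)) sequentially"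
  shows "X \<longlonglongrightarrow> l"
proof -
  have "(\<lambda>j. 1 / (real j + 1)) \<longlonglongrightarrow> 0"
    using LIMSEQ_inverse_real_of_nat by (simp add: inverse_eq_divide add.commute)
  then have "(\<lambda>n. 1 / (real (J n) + 1)) \<longlonglongrightarrow> 0" by (rule filterlim_compose[OF _ J])
  then have "(\<lambda>n. X n - f (J n)) \<longlonglongrightarrow> 0"
    by (rule Lim_null_comparison[rotated]) (use X in simp)
  from tendsto_add[OF this filterlim_compose[OF f J]] show ?thesis by simp
qed

text \<open>The orbit of the limit system on the level a^2/2 of the first integral, with time zero
  where y = 2; \<open>force\<close> is its F component.\<close>

definition slope :: "real \<Rightarrow> real \<Rightarrow> real" where
  "slope a \<sigma> = 2 + a * tanh (a * \<sigma> / 2)"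

definition force :: "real \<Rightarrow> real \<Rightarrow> real" where
  "force a \<sigma> = a\<^sup>2 / 2 * (1 - (tanh (a * \<sigma> / 2))\<^sup>2)"

lemma slope_deriv: "(slope a has_real_derivative force a \<sigma>) (at \<sigma>)"
  unfolding slope_def[abs_def] force_def
  by (auto intro!: derivative_eq_intros simp: power2_eq_square field_simps)

lemma slope_force: "force a \<sigma> = a\<^sup>2 / 2 - (slope a \<sigma> - 2)\<^sup>2 / 2"
  by (simp add: slope_def force_def power_mult_distrib algebra_simps)

lemma abs_tanh_le_1: "\<bar>tanh x\<bar> \<le> 1" for x :: real
  using tanh_real_bounds[of x] by auto

lemma slope_abs_le:
  assumes "0 < a" "a \<le> 2"
  shows "\<bar>slope a \<sigma> - 2\<bar> \<le> 2"
proof -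
  have "\<bar>a * tanh (a * \<sigma> / 2)\<bar> \<le> 2 * 1"
    unfolding abs_mult using assms abs_tanh_le_1 by (intro mult_mono) auto
  then show ?thesis by (simp add: slope_def)
qed

lemma force_pos: "0 < a \<Longrightarrow> force a \<sigma> > 0"
proof -
  assume "0 < a"
  have "(tanh (a * \<sigma> / 2))\<^sup>2 < 1"
    using tanh_real_bounds[of "a * \<sigma> / 2"] by (intro abs_square_less_1[THEN iffD2]) auto
  then show ?thesis using \<open>0 < a\<close> by (simp add: force_def)
qed

section \<open>Comparison with the limit orbit\<close>

context radial_family
begin

text \<open>eta is the level in units of g(mu). It does not change when the times move by o(g(mu)),
  because g(u) has a bounded derivative in s; this is why a whole bubble has a single eta.\<close>

definition at_scale :: "real \<Rightarrow> (nat \<Rightarrow> real) \<Rightarrow> bool" where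
  "at_scale \<eta> \<tau> \<longleftrightarrow> eventually (\<lambda>n. \<tau> n < 0 \<and> t0 < UU n (\<tau> n)) sequentially \<and>
     (\<lambda>n. GG n (\<tau> n) / NN n) \<longlonglongrightarrow> \<eta>"

lemma at_scale_dom:
  assumes "at_scale \<eta> \<tau>" "d < \<eta>"
  shows "eventually (\<lambda>n. dom d n (\<tau> n)) sequentially"
proof -
  have "eventually (\<lambda>n. d < GG n (\<tau> n) / NN n) sequentially"
    using assms by (intro order_tendstoD(1)) (auto simp: at_scale_def)
  moreover have "eventually (\<lambda>n. \<tau> n < 0 \<and> t0 < UU n (\<tau> n)) sequentially"
    using assms by (simp add: at_scale_def)
  ultimately show ?thesis
    using eventually_NN[of 0] by eventually_elim (auto simp: dom_def field_simps)
qed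

lemma at_scale_if_close:
  assumes s: "at_scale \<eta> s"
    and \<tau>: "eventually (\<lambda>n. \<tau> n < 0 \<and> t0 < UU n (\<tau> n)) sequentially"
    and "\<And>e. e > 0 \<Longrightarrow> eventually (\<lambda>n. \<bar>GG n (\<tau> n) - GG n (s n)\<bar> \<le> e * NN n) sequentially"
  shows "at_scale \<eta> \<tau>"
proof -
  have "(\<lambda>n. GG n (\<tau> n) / NN n - GG n (s n) / NN n) \<longlonglongrightarrow> 0"
  proof (rule tendsto_zero_of_linear_bound[where C = 1])
    fix e :: real assume "e > 0"
    from assms(3)[OF this] eventually_NN[of 0]
    show "eventually (\<lambda>n. \<bar>GG n (\<tau> n) / NN n - GG n (s n) / NN n\<bar> \<le> e * 1) sequentially"
    proof eventually_elim
      case (elim n)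
      then show ?case
        by (simp add: diff_divide_distrib[symmetric] abs_divide pos_divide_le_eq)
    qed
  qed
  from tendsto_add[OF this, of "\<lambda>n. GG n (s n) / NN n" \<eta>] s
  have "(\<lambda>n. GG n (\<tau> n) / NN n) \<longlonglongrightarrow> \<eta>" by (simp add: at_scale_def)
  with \<tau> show ?thesis by (simp add: at_scale_def)
qed

lemma EE_tendsto:
  assumes "(\<lambda>n. yy n (\<tau> n)) \<longlonglongrightarrow> y0" "(\<lambda>n. FF n (\<tau> n)) \<longlonglongrightarrow> F0"
  shows "(\<lambda>n. EE n (\<tau> n)) \<longlonglongrightarrow> F0 + (y0 - 2)\<^sup>2 / 2"
  unfolding EE_def by (intro tendsto_intros assms) simp

abbreviation close_on :: "real \<Rightarrow> (nat \<Rightarrow> real) \<Rightarrow> real \<Rightarrow> real \<Rightarrow> real \<Rightarrow> nat \<Rightarrow> bool" where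
  "close_on a \<tau> J e d n \<equiv> (\<forall>\<sigma>. \<bar>\<sigma>\<bar> \<le> J \<longrightarrow> dom d n (\<tau> n + \<sigma>) \<and>
    \<bar>yy n (\<tau> n + \<sigma>) - slope a \<sigma>\<bar> \<le> e \<and> \<bar>FF n (\<tau> n + \<sigma>) - force a \<sigma>\<bar> \<le> e \<and>
    \<bar>GG n (\<tau> n + \<sigma>) - GG n (\<tau> n)\<bar> \<le> e * NN n \<and>
    \<bar>ln (g1 (UU n (\<tau> n + \<sigma>))) - ln (g1 (UU n (\<tau> n)))\<bar> \<le> e)"

text \<open>The first integral eliminates F: up to small errors y' is a^2/2 - (y - 2)^2/2, the
  scalar equation of \<open>slope\<close>. Their difference thus obeys one Gronwall inequality
  instead of a planar one, and F is recovered from the first integral afterwards.\<close>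

lemma bubble_window:
  assumes \<eta>: "at_scale \<eta> \<tau>" "\<eta> > 0" and a: "0 < a" "a \<le> 2"
    and y: "(\<lambda>n. yy n (\<tau> n)) \<longlonglongrightarrow> 2" and F: "(\<lambda>n. FF n (\<tau> n)) \<longlonglongrightarrow> a\<^sup>2 / 2"
    and J: "J > 0" and e: "e > 0"
  obtains d where "d > 0" "eventually (\<lambda>n. close_on a \<tau> J e d n) sequentially"
proof -
  define d where "d = min \<eta> 1 / 2"
  have d: "0 < d" "d < 1" "d < \<eta>" using \<eta> by (auto simp: d_def)
  obtain C where C: "C > 0" "eventually (\<lambda>n. slow_bounds (d / 2) C n) sequentially"
    using dom_slow[of "d / 2"] d by auto
  define L where "L = C + 8"
  define X where "X = exp ((2 * L + 1) * J)"
  have L: "L > 0" using C by (simp add: L_def)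
  have X: "X \<ge> 1" using L J by (simp add: X_def)
  \<comment> \<open>The inhomogeneity of the Gronwall inequality is 4 e1: 3 e1 from the first
    integral and e1 from the term with \<open>eps\<close>. The initial error is at most e1, whence
    the factor 1 + 4^2 = 17.\<close>
  define e2 where "e2 = min e (e / (2 * L))"
  define e1 where "e1 = min (e / 8) (e2 / (17 * X))"
  have e2: "e2 > 0" "e2 \<le> e" "e2 \<le> e / (2 * L)" using e L by (auto simp: e2_def)
  have e1: "e1 > 0" "e1 \<le> e / 8" "e1 \<le> e2 / (17 * X)" using e e2 X by (auto simp: e1_def)
  \<comment> \<open>\<open>dom_drift\<close> works forward in time only, so the window is entered at
    its left end tau - J and has length 2 J.\<close>
  have "eventually (\<lambda>n. dom d n (\<tau> n)) sequentially" using at_scale_dom[OF \<eta>(1) d(3)] .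
  then have "eventually (\<lambda>n. dom d n (\<tau> n - J)) sequentially"
    by eventually_elim (rule dom_down, use J in auto)
  moreover have "(\<lambda>n. 2 * J / NN n) \<longlonglongrightarrow> 0"
    by (rule tendsto_divide_0[OF tendsto_const]) (rule filterlim_at_top_imp_at_infinity[OF NN_at_top])
  ultimately have dr: "eventually (\<lambda>n. \<forall>s. \<tau> n - J \<le> s \<and> s \<le> \<tau> n - J + 2 * J \<longrightarrow> dom (d / 2) n s \<and>
    \<bar>GG n s - GG n (\<tau> n - J)\<bar> \<le> e1 * NN n \<and> \<bar>EE n s - EE n (\<tau> n - J)\<bar> \<le> e1 \<and>
    \<bar>ln (g1 (UU n s)) - ln (g1 (UU n (\<tau> n - J)))\<bar> \<le> e1) sequentially"
    using J by (intro dom_drift[OF d(1,2) e1(1)]) auto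
  have y1: "eventually (\<lambda>n. \<bar>yy n (\<tau> n) - 2\<bar> < e1) sequentially"
    using tendstoD[OF y e1(1)] by (simp add: dist_real_def)
  have E1: "eventually (\<lambda>n. \<bar>EE n (\<tau> n) - a\<^sup>2 / 2\<bar> < e1) sequentially"
    using tendstoD[OF EE_tendsto[OF y F] e1(1)] by (simp add: dist_real_def)
  show ?thesis
  proof (rule that[of "d / 2"])
    show "d / 2 > 0" using d by simp
    show "eventually (\<lambda>n. close_on a \<tau> J e (d / 2) n) sequentially"
      using dr y1 E1 C(2) eventually_NN[of "C * C\<^sup>2 / e1"]
    proof eventually_elim
      case (elim n)
      let ?t = "\<tau> n"
      have N: "NN n > 0" using elim by auto
      have w: "dom (d / 2) n (?t + \<sigma>)" "\<bar>GG n (?t + \<sigma>) - GG n (?t - J)\<bar> \<le> e1 * NN n"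
        "\<bar>EE n (?t + \<sigma>) - EE n (?t - J)\<bar> \<le> e1"
        "\<bar>ln (g1 (UU n (?t + \<sigma>))) - ln (g1 (UU n (?t - J)))\<bar> \<le> e1" if "\<bar>\<sigma>\<bar> \<le> J" for \<sigma>
      proof -
        have "?t - J \<le> ?t + \<sigma> \<and> ?t + \<sigma> \<le> ?t - J + 2 * J" using that by auto
        then show "dom (d / 2) n (?t + \<sigma>)" "\<bar>GG n (?t + \<sigma>) - GG n (?t - J)\<bar> \<le> e1 * NN n"
          "\<bar>EE n (?t + \<sigma>) - EE n (?t - J)\<bar> \<le> e1"
          "\<bar>ln (g1 (UU n (?t + \<sigma>))) - ln (g1 (UU n (?t - J)))\<bar> \<le> e1"
          using elim(1) by blast+
      qed
      have w0: "\<bar>GG n ?t - GG n (?t - J)\<bar> \<le> e1 * NN n"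
        "\<bar>EE n ?t - EE n (?t - J)\<bar> \<le> e1"
        "\<bar>ln (g1 (UU n ?t)) - ln (g1 (UU n (?t - J)))\<bar> \<le> e1" using w[of 0] J by auto
      have bd: "0 \<le> yy n (?t + \<sigma>)" "yy n (?t + \<sigma>) \<le> C" "0 < eps n (?t + \<sigma>)"
          "eps n (?t + \<sigma>) \<le> C / NN n" if "\<bar>\<sigma>\<bar> \<le> J" for \<sigma>
        using elim(4) w(1)[OF that] by auto
      have small: "C / NN n * C\<^sup>2 \<le> e1"
        using elim(5) N e1(1) by (simp add: field_simps)
      have Ea: "\<bar>EE n (?t + \<sigma>) - a\<^sup>2 / 2\<bar> \<le> 3 * e1" if "\<bar>\<sigma>\<bar> \<le> J" for \<sigma>
        using w(3)[OF that] w0(2) elim(3) by linarith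
      have sum: "\<bar>(yy n (?t + \<sigma>) - 2) + (slope a \<sigma> - 2)\<bar> \<le> 2 * L" if "\<bar>\<sigma>\<bar> \<le> J" for \<sigma>
        using bd(1,2)[OF that] slope_abs_le[OF a, of \<sigma>] C by (auto simp: L_def abs_le_iff)
      let ?w = "\<lambda>\<sigma>. yy n (?t + \<sigma>) - slope a \<sigma>"
      let ?w' = "\<lambda>\<sigma>. FF n (?t + \<sigma>) - eps n (?t + \<sigma>) * (yy n (?t + \<sigma>))\<^sup>2 - force a \<sigma>"
      have diffsq: "(yy n (?t + \<sigma>) - 2)\<^sup>2 / 2 - (slope a \<sigma> - 2)\<^sup>2 / 2
          = ?w \<sigma> * ((yy n (?t + \<sigma>) - 2) + (slope a \<sigma> - 2)) / 2" for \<sigma>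
        by (simp add: power2_eq_square algebra_simps add_divide_distrib diff_divide_distrib)
      have diffle: "\<bar>(yy n (?t + \<sigma>) - 2)\<^sup>2 / 2 - (slope a \<sigma> - 2)\<^sup>2 / 2\<bar> \<le> L * \<bar>?w \<sigma>\<bar>"
        if "\<bar>\<sigma>\<bar> \<le> J" for \<sigma>
      proof -
        have gen: "\<bar>x * y / 2\<bar> \<le> L * \<bar>x\<bar>" if "\<bar>y\<bar> \<le> 2 * L" for x y
          using mult_left_mono[OF that, of "\<bar>x\<bar>"] by (simp add: abs_mult algebra_simps)
        show ?thesis unfolding diffsq by (rule gen[OF sum[OF that]])
      qed
      have W: "(?w \<sigma>)\<^sup>2 \<le> ((?w 0)\<^sup>2 + (4 * e1)\<^sup>2) * exp ((2 * L + 1) * J)" if "\<bar>\<sigma>\<bar> \<le> J" for \<sigma>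
      proof (rule gronwall_square_two_sided[where w' = ?w', OF _ _ _ _ that])
        fix \<sigma> assume \<sigma>: "\<bar>\<sigma>\<bar> \<le> J"
        note D = domD[OF w(1)[OF \<sigma>]]
        have "((\<lambda>\<sigma>. yy n (?t + \<sigma>)) has_real_derivative
            FF n (?t + \<sigma>) - eps n (?t + \<sigma>) * (yy n (?t + \<sigma>))\<^sup>2) (at \<sigma>)"
          using yy_deriv[OF D(1,2)] DERIV_shift[of "yy n" _ \<sigma> ?t] by (simp add: add.commute)
        then show "(?w has_real_derivative ?w' \<sigma>) (at \<sigma>)"
          by (intro DERIV_diff slope_deriv)
        have "eps n (?t + \<sigma>) * (yy n (?t + \<sigma>))\<^sup>2 \<le> C / NN n * C\<^sup>2"
          using bd[OF \<sigma>] C N by (intro mult_mono power_mono) auto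
        then have "\<bar>eps n (?t + \<sigma>) * (yy n (?t + \<sigma>))\<^sup>2\<bar> \<le> e1"
          using small bd(3)[OF \<sigma>] by simp
        moreover have "?w' \<sigma> = (EE n (?t + \<sigma>) - a\<^sup>2 / 2) - eps n (?t + \<sigma>) * (yy n (?t + \<sigma>))\<^sup>2
            - ((yy n (?t + \<sigma>) - 2)\<^sup>2 / 2 - (slope a \<sigma> - 2)\<^sup>2 / 2)"
          by (simp add: EE_def slope_force)
        ultimately show "\<bar>?w' \<sigma>\<bar> \<le> 4 * e1 + L * \<bar>?w \<sigma>\<bar>"
          using Ea[OF \<sigma>] diffle[OF \<sigma>] by linarith
      qed (use e1 L in auto)
      have w00: "(?w 0)\<^sup>2 \<le> e1\<^sup>2"
        using elim(2) by (intro power2_le_iff_abs_le[THEN iffD2]) (auto simp: slope_def)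
      have we2: "\<bar>?w \<sigma>\<bar> \<le> e2" if "\<bar>\<sigma>\<bar> \<le> J" for \<sigma>
      proof -
        have "(?w \<sigma>)\<^sup>2 \<le> ((?w 0)\<^sup>2 + (4 * e1)\<^sup>2) * X" using W[OF that] by (simp add: X_def)
        also have "\<dots> \<le> (e1\<^sup>2 + (4 * e1)\<^sup>2) * X" using w00 X by (intro mult_right_mono) auto
        also have "\<dots> = 17 * X * e1\<^sup>2" by (simp add: power_mult_distrib)
        also have "\<dots> \<le> 17 * X * (e2 / (17 * X))\<^sup>2"
          using e1 X by (intro mult_left_mono power_mono) auto
        also have "\<dots> = e2\<^sup>2 / (17 * X)" using X by (simp add: power2_eq_square)
        also have "\<dots> \<le> e2\<^sup>2 / 1" using X by (intro divide_left_mono) auto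
        finally show ?thesis using e2(1) by (simp add: power2_le_iff_abs_le)
      qed
      show ?case
      proof (intro allI impI conjI)
        fix \<sigma> assume \<sigma>: "\<bar>\<sigma>\<bar> \<le> J"
        show "dom (d / 2) n (?t + \<sigma>)" using w(1)[OF \<sigma>] .
        show "\<bar>?w \<sigma>\<bar> \<le> e" using we2[OF \<sigma>] e2 by simp
        have "FF n (?t + \<sigma>) - force a \<sigma> = (EE n (?t + \<sigma>) - a\<^sup>2 / 2)
            - ((yy n (?t + \<sigma>) - 2)\<^sup>2 / 2 - (slope a \<sigma> - 2)\<^sup>2 / 2)"
          by (simp add: EE_def slope_force)
        moreover have "L * \<bar>?w \<sigma>\<bar> \<le> L * e2" using we2[OF \<sigma>] L by simp
        moreover have "L * e2 \<le> e / 2" using e2(3) L by (simp add: field_simps)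
        ultimately show "\<bar>FF n (?t + \<sigma>) - force a \<sigma>\<bar> \<le> e"
          using Ea[OF \<sigma>] e1(2) diffle[OF \<sigma>] e by linarith
        have "e1 * NN n \<le> e / 8 * NN n" using e1 N by (intro mult_right_mono) auto
        moreover have "e * NN n > 0" using e N by simp
        ultimately show "\<bar>GG n (?t + \<sigma>) - GG n ?t\<bar> \<le> e * NN n" using w(2)[OF \<sigma>] w0(1) by linarith
        show "\<bar>ln (g1 (UU n (?t + \<sigma>))) - ln (g1 (UU n ?t))\<bar> \<le> e"
          using w(4)[OF \<sigma>] w0(3) e1(2) e by linarith
      qed
    qed
  qed
qed

text \<open>As long as $y < 2$, the derivative of $\log F + y$ is at least a positive constant minus
  $o(1)$: with $z = 2 - y \in [0, 2]$ and $F + z^2/2 \approx a^2/2$ it is about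
  $z - z^2/2 + a^2/2$. Hence $y = 2$ is reached within time $o(g(\mu))$.\<close>

lemma entry_to_bubble:
  assumes \<eta>: "at_scale \<eta> s" "\<eta> > 0" and a: "0 < a" "a \<le> 2"
    and y: "(\<lambda>n. yy n (s n)) \<longlonglongrightarrow> 2 - a" and F: "(\<lambda>n. FF n (s n)) \<longlonglongrightarrow> 0"
    and lnF: "(\<lambda>n. ln (FF n (s n)) / NN n) \<longlonglongrightarrow> 0"
  obtains \<tau> where "at_scale \<eta> \<tau>" "(\<lambda>n. yy n (\<tau> n)) \<longlonglongrightarrow> 2" "(\<lambda>n. FF n (\<tau> n)) \<longlonglongrightarrow> a\<^sup>2 / 2"
proof -
  define d where "d = min \<eta> 1 / 2"
  have d: "0 < d" "d < 1" "d < \<eta>" using \<eta> by (auto simp: d_def)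
  obtain C where C: "C > 0" "eventually (\<lambda>n. slow_bounds (d / 2) C n) sequentially"
    using dom_slow[of "d / 2"] d by auto
  \<comment> \<open>The first integral supplies a^2/2 = 2 c. Of this, c/2 is lost to its drift and
    its initial error and c/4 to \<open>kap\<close> and \<open>eps\<close>, so the derivative of log
    F + y stays above c.\<close>
  define c where "c = a\<^sup>2 / 4"
  have c: "c > 0" using a by (simp add: c_def)
  \<comment> \<open>Growth of log F + y at rate c over this time would exceed |log F(s)| + 2 C, the
    most that the bounds on y and F allow.\<close>
  define \<Delta> where "\<Delta> n = (\<bar>ln (FF n (s n))\<bar> + 2 * C + 1) / c" for n
  have \<Delta>0: "\<Delta> n \<ge> 0" for n using C c by (simp add: \<Delta>_def)
  have "(\<lambda>n. (\<bar>ln (FF n (s n)) / NN n\<bar> + (2 * C + 1) / NN n) / c) \<longlonglongrightarrow> (\<bar>0\<bar> + 0) / c"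
    by (intro tendsto_intros lnF tendsto_divide_0[OF tendsto_const]
        filterlim_at_top_imp_at_infinity[OF NN_at_top]) (use c in auto)
  moreover have "eventually (\<lambda>n. (\<bar>ln (FF n (s n)) / NN n\<bar> + (2 * C + 1) / NN n) / c = \<Delta> n / NN n)
      sequentially"
    using eventually_NN[of 0] 
    by eventually_elim (simp add: \<Delta>_def abs_divide add_divide_distrib[symmetric] mult.commute)
  ultimately have \<Delta>: "(\<lambda>n. \<Delta> n / NN n) \<longlonglongrightarrow> 0"
    using Lim_transform_eventually by fastforce
  have ds: "eventually (\<lambda>n. dom d n (s n)) sequentially" using at_scale_dom[OF \<eta>(1) d(3)] .
  note drift = dom_drift[OF d(1,2) _ ds \<Delta>0 \<Delta>]
  have Es: "(\<lambda>n. EE n (s n)) \<longlonglongrightarrow> a\<^sup>2 / 2" using EE_tendsto[OF y F] by simp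
  have E1: "eventually (\<lambda>n. \<bar>EE n (s n) - a\<^sup>2 / 2\<bar> < c / 4) sequentially"
    using tendstoD[OF Es, of "c / 4"] c by (simp add: dist_real_def)
  have ylt: "eventually (\<lambda>n. yy n (s n) < 2) sequentially"
    using order_tendstoD(2)[OF y, of 2] a by simp
  have dr: "eventually (\<lambda>n. \<forall>t. s n \<le> t \<and> t \<le> s n + \<Delta> n \<longrightarrow> dom (d / 2) n t \<and>
    \<bar>GG n t - GG n (s n)\<bar> \<le> c / 4 * NN n \<and> \<bar>EE n t - EE n (s n)\<bar> \<le> c / 4 \<and>
    \<bar>ln (g1 (UU n t)) - ln (g1 (UU n (s n)))\<bar> \<le> c / 4) sequentially"
    by (rule drift) (use c in auto)
  have "eventually (\<lambda>n. \<exists>t. s n \<le> t \<and> t \<le> s n + \<Delta> n \<and> yy n t = 2) sequentially"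
    using dr E1 ylt C(2) eventually_NN[of "4 * (1 + C * C + C * C\<^sup>2) / c"]
  proof eventually_elim
    case (elim n)
    have N: "NN n > 0" using elim by auto
    have D: "dom (d / 2) n t" "\<bar>EE n t - EE n (s n)\<bar> \<le> c / 4" if "s n \<le> t" "t \<le> s n + \<Delta> n" for t
      using elim(1) that by blast+
    have bd: "0 \<le> yy n t" "yy n t \<le> C" "0 < FF n t" "FF n t \<le> C" "\<bar>kap t\<bar> \<le> 1 / NN n"
      "0 < eps n t" "eps n t \<le> C / NN n" if "s n \<le> t" "t \<le> s n + \<Delta> n" for t
      using elim(4) D(1)[OF that] by auto
    have small: "1 / NN n + C / NN n * C + C / NN n * C\<^sup>2 \<le> c / 4"
    proof -
      have "1 + C * C + C * C\<^sup>2 \<le> c / 4 * NN n" using elim(5) c by (simp add: field_simps)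
      then have "(1 + C * C + C * C\<^sup>2) / NN n \<le> c / 4" using N by (simp add: pos_divide_le_eq)
      then show ?thesis by (simp add: add_divide_distrib)
    qed
    have "\<exists>t. s n \<le> t \<and> t \<le> s n + \<Delta> n \<and> yy n t \<ge> 2"
    proof (rule ccontr)
      assume "\<not> (\<exists>t. s n \<le> t \<and> t \<le> s n + \<Delta> n \<and> yy n t \<ge> 2)"
      then have lt: "yy n t < 2" if "s n \<le> t" "t \<le> s n + \<Delta> n" for t using that by force
      have "ln (FF n (s n)) + yy n (s n) - c * s n
          \<le> ln (FF n (s n + \<Delta> n)) + yy n (s n + \<Delta> n) - c * (s n + \<Delta> n)"
      proof (rule log_time_mono[where \<phi> = "\<lambda>t. ln (FF n t) + yy n t - c * t"])
        show "s n \<le> s n + \<Delta> n" using \<Delta>0 by simp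
        fix t assume t: "s n \<le> t" "t \<le> s n + \<Delta> n"
        note Dt = domD[OF D(1)[OF t]] and b = bd[OF t]
        have "((\<lambda>t. ln (FF n t)) has_real_derivative
            1 / FF n t * (FF n t * (2 + kap t - yy n t - eps n t * yy n t))) (at t)"
          by (rule DERIV_chain2[where f = ln, OF DERIV_ln_divide FF_deriv]) (use Dt b in auto)
        from DERIV_diff[OF DERIV_add[OF this yy_deriv[OF Dt(1,2)]] DERIV_cmult_Id[of c]]
        show "((\<lambda>t. ln (FF n t) + yy n t - c * t) has_real_derivative
            (2 + kap t - yy n t - eps n t * yy n t) + (FF n t - eps n t * (yy n t)\<^sup>2) - c) (at t)"
          using b by simp
        have "eps n t * yy n t \<le> C / NN n * C"
          using b C(1) N by (intro mult_mono) auto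
        moreover have "eps n t * (yy n t)\<^sup>2 \<le> C / NN n * C\<^sup>2"
          using b C(1) N by (intro mult_mono power_mono) auto
        ultimately have "kap t - eps n t * yy n t - eps n t * (yy n t)\<^sup>2 \<ge> - (c / 4)"
          using b(5) small by linarith
        moreover have "FF n t \<ge> 2 * c - c / 2 - (yy n t - 2)\<^sup>2 / 2"
        proof -
          have "FF n t = EE n t - (yy n t - 2)\<^sup>2 / 2" by (simp add: EE_def)
          moreover have "EE n t \<ge> 2 * c - c / 2"
            using D(2)[OF t] elim(2) unfolding c_def by linarith
          ultimately show ?thesis by linarith
        qed
        moreover have "(yy n t - 2)\<^sup>2 / 2 \<le> 2 - yy n t"
        proof -
          have "(2 - yy n t) * (2 - yy n t) \<le> 2 * (2 - yy n t)"
            using lt[OF t] b(1) by (intro mult_right_mono) auto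
          then show ?thesis by (simp add: power2_eq_square field_simps)
        qed
        ultimately show "(2 + kap t - yy n t - eps n t * yy n t) +
            (FF n t - eps n t * (yy n t)\<^sup>2) - c \<ge> 0" using c by linarith
      qed
      moreover have "c * (s n + \<Delta> n) = c * s n + (\<bar>ln (FF n (s n))\<bar> + 2 * C + 1)"
        using c unfolding \<Delta>_def distrib_left by simp
      moreover have "ln (FF n (s n + \<Delta> n)) \<le> C"
      proof -
        have "ln (FF n (s n + \<Delta> n)) \<le> FF n (s n + \<Delta> n) - 1"
          using bd(3)[of "s n + \<Delta> n"] \<Delta>0[of n] by (intro ln_le_minus_one) auto
        then show ?thesis using bd(4)[of "s n + \<Delta> n"] \<Delta>0[of n] by auto
      qed
      moreover have "yy n (s n + \<Delta> n) \<le> C" "0 \<le> yy n (s n)"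
        using bd(2)[of "s n + \<Delta> n"] bd(1)[of "s n"] \<Delta>0[of n] by auto
      ultimately show False by linarith
    qed
    then obtain t where t: "s n \<le> t" "t \<le> s n + \<Delta> n" "yy n t \<ge> 2" by blast
    have "continuous_on {s n..t} (yy n)"
    proof (rule DERIV_continuous_on)
      fix x assume x: "x \<in> {s n..t}"
      then have "dom (d / 2) n x" using D(1)[of x] t by auto
      then show "(yy n has_real_derivative FF n x - eps n x * (yy n x)\<^sup>2) (at x within {s n..t})"
        by (intro has_field_derivative_at_within[OF yy_deriv]) (auto dest: domD)
    qed
    then obtain x where "s n \<le> x" "x \<le> t" "yy n x = 2"
      using IVT'[of "yy n" "s n" 2 t] t elim(3) by auto
    then show ?case using t by (intro exI[of _ x]) auto
  qed
  then obtain \<tau> where \<tau>: "eventually (\<lambda>n. s n \<le> \<tau> n \<and> \<tau> n \<le> s n + \<Delta> n \<and> yy n (\<tau> n) = 2) sequentially"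
    by (rule eventually_choice)
  show ?thesis
  proof (rule that[of \<tau>])
    have "eventually (\<lambda>n. \<tau> n < 0 \<and> t0 < UU n (\<tau> n)) sequentially"
      using dr \<tau> by eventually_elim (auto dest: domD)
    moreover have "eventually (\<lambda>n. \<bar>GG n (\<tau> n) - GG n (s n)\<bar> \<le> e * NN n) sequentially" if "e > 0" for e
      using drift[OF that] \<tau> by eventually_elim auto
    ultimately show "at_scale \<eta> \<tau>" by (intro at_scale_if_close[OF \<eta>(1)]) auto
    show "(\<lambda>n. yy n (\<tau> n)) \<longlonglongrightarrow> 2"
      by (rule tendsto_eventually) (use \<tau> in eventually_elim, auto)
    \<comment> \<open>Where y = 2 the first integral is F itself, so its vanishing drift determines
      the limit of F.\<close>
    have "(\<lambda>n. EE n (\<tau> n) - EE n (s n)) \<longlonglongrightarrow> 0"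
    proof (rule tendsto_zero_of_linear_bound[where C = 1])
      fix e :: real assume "e > 0"
      from drift[OF this] \<tau> show "eventually (\<lambda>n. \<bar>EE n (\<tau> n) - EE n (s n)\<bar> \<le> e * 1) sequentially"
        by eventually_elim auto
    qed
    from tendsto_add[OF this Es] have "(\<lambda>n. EE n (\<tau> n)) \<longlonglongrightarrow> a\<^sup>2 / 2" by simp
    moreover have "eventually (\<lambda>n. EE n (\<tau> n) = FF n (\<tau> n)) sequentially"
      using \<tau> by eventually_elim (simp add: EE_def)
    ultimately show "(\<lambda>n. FF n (\<tau> n)) \<longlonglongrightarrow> a\<^sup>2 / 2" by (rule Lim_transform_eventually)
  qed
qed

end

section \<open>The first bubble and the passage between bubbles\<close>

context radial_family
begin

section \<open>Leaving the centre\<close>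

lemma level_exists:
  assumes "0 < d" "d < 1"
  shows "eventually (\<lambda>n. \<exists>s. GG n s = d * NN n \<and> dom d n s) sequentially"
  using eventually_NN[of "max 0 (g t0 / d)"]
    filterlim_at_top_dense[THEN iffD1, OF mu_top, rule_format, of t0]
proof eventually_elim
  case (elim n)
  then have N: "NN n > 0" "g t0 < d * NN n"
    using assms by (simp_all add: pos_divide_less_eq mult.commute)
  have "d * NN n < NN n" using N assms by simp
  then obtain v where v: "t0 \<le> v" "v \<le> mu n" "g v = d * NN n"
    using IVT'[of g t0 "d * NN n" "mu n"] elim N
      continuous_on_subset[OF continuous_on_g, of "{t0..mu n}"] by (auto simp: NN_def)
  have "v \<noteq> t0" "v \<noteq> mu n" using v N \<open>d * NN n < NN n\<close> by (auto simp: NN_def)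
  then have v': "t0 < v" "v < mu n" using v by auto
  obtain r where r: "0 \<le> r" "r \<le> 1" "u n r = v"
    using IVT2'[of "u n" 1 v 0] v' t0_nonneg u_1[of n] u_0[of n] continuous_on_u[of n] by auto
  have "r \<noteq> 0" "r \<noteq> 1" using r v' t0_nonneg u_1[of n] u_0[of n] by auto
  then show ?case
    using r v v' by (intro exI[of _ "ln r"]) (auto simp: dom_def GG_def UU_def)
qed

text \<open>Near the origin $F' \approx 2 F$ and $y' \approx F$, so that $F - y$, $3 y - F$ and $g(u) + F$ are
  nondecreasing.\<close>

lemma near_origin:
  assumes D: "dom d n s" and small: "\<And>t. t \<le> s \<Longrightarrow> \<bar>kap t\<bar> \<le> 1 / 4"
    "\<And>t. t \<le> s \<Longrightarrow> yy n t \<le> 1 / 4" "\<And>t. t \<le> s \<Longrightarrow> eps n t * yy n t \<le> 1 / 4"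
  shows "yy n s \<le> FF n s" "FF n s \<le> 3 * yy n s" "NN n - GG n s \<le> FF n s"
proof -
  let ?y = "\<lambda>r. - r * u1 n r * g1 (u n r)"
  let ?F = "\<lambda>r. lam n * r\<^sup>2 * h r * f (u n r) * g1 (u n r)"
  have eq: "?y (exp t) = yy n t" "?F (exp t) = FF n t" "g (u n (exp t)) = GG n t" for t
    by (simp_all add: yy_def FF_def GG_def MM_def PP_def UU_def)
  have fac: "1 \<le> 2 + kap t - yy n t - eps n t * yy n t" "2 + kap t - yy n t - eps n t * yy n t \<le> 9 / 4"
    "0 \<le> eps n t * yy n t" if "t \<le> s" for t
  proof -
    note Dt = domD[OF dom_down[OF D that]]
    show "0 \<le> eps n t * yy n t" using eps_pos[of t n] yy_nonneg[of t n] Dt by simp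
    then show "1 \<le> 2 + kap t - yy n t - eps n t * yy n t" "2 + kap t - yy n t - eps n t * yy n t \<le> 9 / 4"
      using small[OF that] yy_nonneg[of t n] Dt by linarith+
  qed
  have yF: "yy n t \<le> FF n t" if "t \<le> s" for t
  proof -
    have "(\<lambda>r. ?F r - ?y r) 0 \<le> (\<lambda>r. ?F r - ?y r) (exp t)"
    proof (rule mono_from_zero)
      show "continuous_on {0..exp t} (\<lambda>r. ?F r - ?y r)"
        by (rule continuous_on_diff; rule dom_continuous_parts[OF dom_down[OF D that]])
      fix t' assume t': "t' \<le> t"
      then have ts: "t' \<le> s" using that by simp
      note Dt = domD[OF dom_down[OF D ts]]
      show "((\<lambda>t. ?F (exp t) - ?y (exp t)) has_real_derivative
          FF n t' * (2 + kap t' - yy n t' - eps n t' * yy n t') - (FF n t' - eps n t' * (yy n t')\<^sup>2)) (at t')"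
        unfolding eq by (intro DERIV_diff FF_deriv yy_deriv Dt)
      have "FF n t' * 1 \<le> FF n t' * (2 + kap t' - yy n t' - eps n t' * yy n t')"
        using FF_pos[of t' n] Dt fac[OF ts] by (intro mult_left_mono) auto
      moreover have "0 \<le> eps n t' * (yy n t')\<^sup>2" using eps_pos[of t' n] Dt by simp
      ultimately show "FF n t' * (2 + kap t' - yy n t' - eps n t' * yy n t') -
          (FF n t' - eps n t' * (yy n t')\<^sup>2) \<ge> 0" by simp
    qed
    then show ?thesis unfolding eq by simp
  qed
  show "yy n s \<le> FF n s" by (rule yF) simp
  have "(\<lambda>r. 3 * ?y r - ?F r) 0 \<le> (\<lambda>r. 3 * ?y r - ?F r) (exp s)"
  proof (rule mono_from_zero)
    show "continuous_on {0..exp s} (\<lambda>r. 3 * ?y r - ?F r)"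
      by (intro continuous_on_diff continuous_on_mult_left dom_continuous_parts[OF D])
    fix t assume t: "t \<le> s"
    note Dt = domD[OF dom_down[OF D t]]
    show "((\<lambda>t. 3 * ?y (exp t) - ?F (exp t)) has_real_derivative
        3 * (FF n t - eps n t * (yy n t)\<^sup>2) - FF n t * (2 + kap t - yy n t - eps n t * yy n t)) (at t)"
      unfolding eq by (intro DERIV_diff DERIV_cmult FF_deriv yy_deriv Dt)
    have Fp: "FF n t > 0" using FF_pos[of t n] Dt by auto
    have "eps n t * (yy n t)\<^sup>2 = (eps n t * yy n t) * yy n t" by (simp add: power2_eq_square)
    also have "\<dots> \<le> (1 / 4) * FF n t"
      using small(3)[OF t] yF[OF t] yy_nonneg[of t n] Dt by (intro mult_mono) auto
    finally have "eps n t * (yy n t)\<^sup>2 \<le> (1 / 4) * FF n t" .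
    moreover have "FF n t * (2 + kap t - yy n t - eps n t * yy n t) \<le> FF n t * (9 / 4)"
      using Fp fac[OF t] by (intro mult_left_mono) auto
    moreover have "3 * (x - y) - z \<ge> 0" if "y \<le> (1 / 4) * x" "z \<le> x * (9 / 4)" for x y z :: real
      using that by argo
    ultimately show "3 * (FF n t - eps n t * (yy n t)\<^sup>2)
        - FF n t * (2 + kap t - yy n t - eps n t * yy n t) \<ge> 0" by blast
  qed
  then show "FF n s \<le> 3 * yy n s" unfolding eq by simp
  have "(\<lambda>r. g (u n r) + ?F r) 0 \<le> (\<lambda>r. g (u n r) + ?F r) (exp s)"
  proof (rule mono_from_zero)
    show "continuous_on {0..exp s} (\<lambda>r. g (u n r) + ?F r)"
      by (intro continuous_on_add continuous_on_g1_u[OF D] dom_continuous_parts[OF D])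
    fix t assume t: "t \<le> s"
    note Dt = domD[OF dom_down[OF D t]]
    show "((\<lambda>t. g (u n (exp t)) + ?F (exp t)) has_real_derivative
        - yy n t + FF n t * (2 + kap t - yy n t - eps n t * yy n t)) (at t)"
      unfolding eq by (intro DERIV_add GG_deriv FF_deriv Dt)
    have "FF n t * 1 \<le> FF n t * (2 + kap t - yy n t - eps n t * yy n t)"
      using FF_pos[of t n] Dt fac[OF t] by (intro mult_left_mono) auto
    then show "- yy n t + FF n t * (2 + kap t - yy n t - eps n t * yy n t) \<ge> 0"
      using yF[OF t] by simp
  qed
  then show "NN n - GG n s \<le> FF n s" unfolding eq by (simp add: u_0 NN_def)
qed

text \<open>y need not be monotone, but -u_s is, and replacing g'(u) by g'(mu) costs a bounded
  factor. Smallness of y at s thus passes to all earlier times, which \<open>near_origin\<close>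
  requires.\<close>

lemma yy_le_later:
  assumes D: "dom d n s" and t: "t \<le> s"
  shows "yy n t \<le> yy n s * (g1 (mu n) / g1 (UU n s))"
proof -
  note Ds = domD[OF D] and Dt = domD[OF dom_down[OF D t]]
  have "yy n t \<le> MM n s * g1 (mu n)"
    unfolding yy_def using MM_mono[OF t] g1_mono[of "UU n t" "mu n"] UU_le_mu[of t n] MM_nonneg[of s n]
      g1_UU_pos[of t n] Dt Ds by (intro mult_mono) auto
  then show ?thesis using g1_UU_pos[of s n] Ds by (simp add: yy_def)
qed

lemma g1_mu_ratio_bounded:
  assumes d: "0 < d" "d < 1"
  shows "eventually (\<lambda>n. \<forall>s. dom d n s \<longrightarrow> g1 (mu n) / g1 (UU n s) \<le> 1 / d\<^sup>2) sequentially"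
proof -
  obtain T where T: "T > t0" "\<And>t. t \<ge> T \<Longrightarrow> g t > 0"
    "\<And>x y. T \<le> x \<Longrightarrow> x \<le> y \<Longrightarrow> d * g y \<le> g x \<Longrightarrow> ln (g1 y) - ln (g1 x) \<le> 2 * ln (1 / d)"
    "\<And>t. t \<ge> T \<Longrightarrow> g2 t / (g1 t)\<^sup>2 \<le> 2 / g t"
    by (rule g1_ratio_bound[OF d(1)], rule that) blast+
  show ?thesis using eventually_dom_large[OF d(1), of T]
  proof eventually_elim
    case (elim n)
    show ?case
    proof (intro allI impI)
      fix s assume D: "dom d n s"
      have p: "g1 (mu n) > 0" "g1 (UU n s) > 0"
        using g1_UU_pos[of s n] g1_pos[of "mu n"] UU_le_mu[of s n] domD[OF D] by auto
      have "ln (g1 (mu n)) - ln (g1 (UU n s)) \<le> 2 * ln (1 / d)"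
        using T(3)[of "UU n s" "mu n"] elim D UU_le_mu[of s n] domD[OF D] by (simp add: NN_def GG_def)
      then have "ln (g1 (mu n) / g1 (UU n s)) \<le> ln ((1 / d)\<^sup>2)"
        using p d by (simp add: ln_div ln_realpow power2_eq_square ln_mult)
      then show "g1 (mu n) / g1 (UU n s) \<le> 1 / d\<^sup>2"
        using p d by (subst (asm) ln_le_cancel_iff) (auto simp: power_divide)
    qed
  qed
qed

lemma ln_NN_over_NN: "(\<lambda>n. ln (NN n) / NN n) \<longlonglongrightarrow> 0"
  by (rule filterlim_compose[OF ln_x_over_x_tendsto_0 NN_at_top])

lemma const_over_NN: "(\<lambda>n. c / NN n) \<longlonglongrightarrow> 0"
  by (rule tendsto_divide_0[OF tendsto_const]) (rule filterlim_at_top_imp_at_infinity[OF NN_at_top])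

text \<open>The entry time is where y = 1/NN. By \<open>near_origin\<close> F lies there between
  1/NN and 3/NN: it tends to 0, while log F is only of order log NN. So the first bubble starts from
  y = 0 with the same kind of data as the later ones.\<close>

lemma initial_entry:
  obtains s where "at_scale 1 s" "(\<lambda>n. yy n (s n)) \<longlonglongrightarrow> 0" "(\<lambda>n. FF n (s n)) \<longlonglongrightarrow> 0"
    "(\<lambda>n. ln (FF n (s n)) / NN n) \<longlonglongrightarrow> 0"
proof -
  obtain C where C: "C > 0" "eventually (\<lambda>n. slow_bounds (1 / 2) C n) sequentially"
    using dom_slow[of "1 / 2"] by auto
  have lev: "eventually (\<lambda>n. \<exists>s. GG n s = 1 / 2 * NN n \<and> dom (1 / 2) n s) sequentially"
    by (rule level_exists) auto
  have rat: "eventually (\<lambda>n. \<forall>s. dom (1 / 2) n s \<longrightarrow> g1 (mu n) / g1 (UU n s) \<le> 1 / (1 / 2)\<^sup>2) sequentially"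
    by (rule g1_mu_ratio_bounded) auto
  have "eventually (\<lambda>n. \<exists>s. dom (1 / 2) n s \<and> 1 / NN n \<le> FF n s \<and> FF n s \<le> 3 / NN n \<and>
      yy n s = 1 / NN n \<and> NN n - GG n s \<le> 3 / NN n) sequentially"
    using C(2) lev rat eventually_NN[of "max 16 C"]
  proof eventually_elim
    case (elim n)
    have N: "NN n > 16" "NN n > C" using elim by auto
    then have N4: "1 / NN n \<le> 1 / 16" "C / NN n \<le> 1" using C(1) by (auto simp: field_simps)
    have bd: "0 \<le> yy n t" "\<bar>kap t\<bar> \<le> 1 / NN n" "0 < eps n t" "eps n t \<le> C / NN n"
      if "dom (1 / 2) n t" for t using elim(1) that by auto
    have near: "yy n s \<le> FF n s" "FF n s \<le> 3 * yy n s" "NN n - GG n s \<le> FF n s"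
      if D: "dom (1 / 2) n s" and y: "yy n s \<le> 1 / NN n" for s
    proof -
      have yt: "yy n t \<le> 1 / 4" if "t \<le> s" for t
      proof -
        have "yy n s * (g1 (mu n) / g1 (UU n s)) \<le> (1 / NN n) * 4"
          using y elim(3) D bd(1)[OF D] N g1_UU_pos[of s n] g1_pos[of "mu n"] UU_le_mu[of s n] domD[OF D]
          by (intro mult_mono) (auto simp: power2_eq_square)
        then show ?thesis using yy_le_later[OF D that] N4 by linarith
      qed
      have kt: "\<bar>kap t\<bar> \<le> 1 / 4" if "t \<le> s" for t
        using bd(2)[OF dom_down[OF D that]] N4 by linarith
      have et: "eps n t * yy n t \<le> 1 / 4" if "t \<le> s" for t
      proof -
        note b = bd[OF dom_down[OF D that]]
        have "eps n t * yy n t \<le> 1 * (1 / 4)"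
          using b N4 yt[OF that] by (intro mult_mono) auto
        then show ?thesis by simp
      qed
      show "yy n s \<le> FF n s" "FF n s \<le> 3 * yy n s" "NN n - GG n s \<le> FF n s"
        using near_origin[OF D kt yt et] by auto
    qed
    obtain s1 where s1: "GG n s1 = 1 / 2 * NN n" "dom (1 / 2) n s1" using elim(2) by blast
    \<comment> \<open>At the level NN/2 the value 1/NN of y has been reached: otherwise
      \<open>near_origin\<close> would bound the drop NN/2 of g(u) by 3/NN. The time at which it is
      attained is then found in r, where y starts from 0.\<close>
    have "yy n s1 \<ge> 1 / NN n"
    proof (rule ccontr)
      assume "\<not> ?thesis"
      then have y: "yy n s1 \<le> 1 / NN n" by simp
      from near[OF s1(2) y] y s1(1) have "NN n / 2 \<le> 3 * (1 / NN n)" by linarith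
      then show False using N N4 by linarith
    qed
    then obtain r where r: "0 \<le> r" "r \<le> exp s1" "- r * u1 n r * g1 (u n r) = 1 / NN n"
      using IVT'[of "\<lambda>r. - r * u1 n r * g1 (u n r)" 0 "1 / NN n" "exp s1"]
        dom_continuous_parts(1)[OF s1(2)] N by (auto simp: yy_def MM_def UU_def)
    have "r \<noteq> 0" using r N by auto
    define s where "s = ln r"
    have rs: "r = exp s" using r \<open>r \<noteq> 0\<close> by (simp add: s_def)
    have ys: "yy n s = 1 / NN n" using r(3) by (simp add: yy_def MM_def UU_def rs)
    have D: "dom (1 / 2) n s" using r(2) by (intro dom_down[OF s1(2)]) (simp add: rs)
    show ?case using near[OF D] ys D by (intro exI[of _ s]) auto
  qed
  then obtain s where s: "eventually (\<lambda>n. dom (1 / 2) n (s n) \<and> 1 / NN n \<le> FF n (s n) \<and>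
      FF n (s n) \<le> 3 / NN n \<and> yy n (s n) = 1 / NN n \<and> NN n - GG n (s n) \<le> 3 / NN n) sequentially"
    by (rule eventually_choice)
  show ?thesis
  proof (rule that[of s])
    have "(\<lambda>n. GG n (s n) / NN n) \<longlonglongrightarrow> 1"
    proof (rule tendsto_sandwich)
      show "eventually (\<lambda>n. 1 - 3 / NN n \<le> GG n (s n) / NN n) sequentially"
        using s eventually_NN[of 1]
      proof eventually_elim
        case (elim n)
        have "3 / NN n \<le> 3" using elim by (simp add: field_simps)
        then have "NN n - 3 \<le> GG n (s n)" using elim by linarith
        then show ?case using elim by (simp add: field_simps)
      qed
      show "eventually (\<lambda>n. GG n (s n) / NN n \<le> 1) sequentially"
        using s eventually_NN[of 1]
      proof eventually_elim
        case (elim n)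
        then have "GG n (s n) \<le> NN n" by (intro GG_le_NN) (auto dest: domD)
        then show ?case using elim by simp
      qed
      show "(\<lambda>n. 1 - 3 / NN n) \<longlonglongrightarrow> 1"
        using tendsto_diff[OF tendsto_const const_over_NN[of 3], of 1] by simp
    qed auto
    moreover have "eventually (\<lambda>n. s n < 0 \<and> t0 < UU n (s n)) sequentially"
      using s by eventually_elim (auto dest: domD)
    ultimately show "at_scale 1 s" by (simp add: at_scale_def)
    show "(\<lambda>n. yy n (s n)) \<longlonglongrightarrow> 0"
      by (rule Lim_transform_eventually[OF const_over_NN[of 1]]) (use s in eventually_elim, auto)
    show "(\<lambda>n. FF n (s n)) \<longlonglongrightarrow> 0"
    proof (rule tendsto_sandwich[OF _ _ const_over_NN[of 1] const_over_NN[of 3]])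
      show "eventually (\<lambda>n. 1 / NN n \<le> FF n (s n)) sequentially"
        "eventually (\<lambda>n. FF n (s n) \<le> 3 / NN n) sequentially"
        by (use s in eventually_elim, simp)+
    qed
    show "(\<lambda>n. ln (FF n (s n)) / NN n) \<longlonglongrightarrow> 0"
    proof (rule tendsto_sandwich)
      show "eventually (\<lambda>n. - (ln (NN n) / NN n) \<le> ln (FF n (s n)) / NN n) sequentially"
        using s eventually_NN[of 1]
      proof eventually_elim
        case (elim n)
        then have "ln (1 / NN n) \<le> ln (FF n (s n))" by (subst ln_le_cancel_iff) (auto intro: less_le_trans[of 0 "1 / NN n"])
        then have "- ln (NN n) / NN n \<le> ln (FF n (s n)) / NN n"
          using elim by (intro divide_right_mono) (auto simp: ln_div)
        then show ?case by simp
      qed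
      show "eventually (\<lambda>n. ln (FF n (s n)) / NN n \<le> ln 3 / NN n - ln (NN n) / NN n) sequentially"
        using s eventually_NN[of 1]
      proof eventually_elim
        case (elim n)
        then have "ln (FF n (s n)) \<le> ln (3 / NN n)" by (subst ln_le_cancel_iff) (auto intro: less_le_trans[of 0 "1 / NN n"])
        then have "ln (FF n (s n)) / NN n \<le> (ln 3 - ln (NN n)) / NN n"
          using elim by (intro divide_right_mono) (auto simp: ln_div)
        then show ?case by (simp add: diff_divide_distrib)
      qed
      show "(\<lambda>n. - (ln (NN n) / NN n)) \<longlonglongrightarrow> 0" using tendsto_minus[OF ln_NN_over_NN] by simp
      show "(\<lambda>n. ln 3 / NN n - ln (NN n) / NN n) \<longlonglongrightarrow> 0"
        using tendsto_diff[OF const_over_NN[of "ln 3"] ln_NN_over_NN] by simp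
    qed
  qed
qed

section \<open>From one bubble to the next\<close>

lemma (in growth) g_chord:
  assumes "t0 \<le> x" "x \<le> v" "v \<le> y"
  shows "g v * (y - x) \<le> (y - v) * g x + (v - x) * g y"
proof -
  have "(g v + g1 v * (x - v)) * (y - v) \<le> g x * (y - v)"
    "(g v + g1 v * (y - v)) * (v - x) \<le> g y * (v - x)"
    using g_tangent[of v x] g_tangent[of v y] assms by (auto intro!: mult_right_mono)
  then show ?thesis by (simp add: algebra_simps)
qed

text \<open>Between two bubbles \<open>MM\<close> is almost constant, so that $\log$ \<open>PP\<close> is almost the convex function
  \<open>B\<close> of $u$; the chord bound on \<open>B\<close> makes \<open>PP\<close> integrable with a small integral.\<close>

lemma passage_estimate:
  fixes n :: nat and s0 s2 c \<kappa> :: real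
  defines "m0 \<equiv> MM n s0" and "T \<equiv> s2 - s0" and "X \<equiv> UU n s2" and "Y \<equiv> UU n s0"
  defines "B \<equiv> \<lambda>v. g v - g Y + 2 / m0 * (Y - v)"
  defines "A \<equiv> PP n s0 * exp (\<kappa> * T) / (c * m0)"
  assumes s: "s0 \<le> s2" "s2 < 0" "t0 < X" and m0: "m0 > 0" and c: "c > 0" and \<kappa>: "\<kappa> \<ge> 0"
    and kap: "\<And>t. s0 \<le> t \<Longrightarrow> t \<le> s2 \<Longrightarrow> \<bar>kap t\<bar> \<le> \<kappa>"
    and chord: "B X \<le> - c * (Y - X)"
  shows "m0 * T \<le> Y - X" "m0 \<le> MM n s2" "MM n s2 \<le> m0 + A"
    "\<bar>ln (PP n s2) - ln (PP n s0) - B X\<bar> \<le> (\<kappa> + 2 * A / m0) * T"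
proof -
  have D: "t < 0" "t0 < UU n t" "X \<le> UU n t" "UU n t \<le> Y" if "s0 \<le> t" "t \<le> s2" for t
    using that s UU_antimono[of t s2 n] UU_antimono[of s0 t n] by (auto simp: X_def Y_def)
  have M: "m0 \<le> MM n t" if "s0 \<le> t" "t \<le> s2" for t
    using MM_mono[of s0 t n] D[OF that] that by (simp add: m0_def)
  have XY: "X \<le> Y" using D[of s0] s by (simp add: Y_def)
  show "m0 \<le> MM n s2" using M s by simp
  have "- UU n s0 - m0 * s0 \<le> - UU n s2 - m0 * s2"
  proof (rule log_time_mono[OF s(1), where \<phi> = "\<lambda>t. - UU n t - m0 * t"])
    fix t assume t: "s0 \<le> t" "t \<le> s2"
    show "((\<lambda>t. - UU n t - m0 * t) has_real_derivative (- (- MM n t) - m0)) (at t)"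
      by (intro DERIV_diff DERIV_minus UU_deriv DERIV_cmult_Id D(1)[OF t])
    show "- (- MM n t) - m0 \<ge> 0" using M[OF t] by simp
  qed
  then show "m0 * T \<le> Y - X" by (simp add: T_def X_def Y_def algebra_simps)
  have Bd: "((\<lambda>t. B (UU n t)) has_real_derivative - yy n t + 2 / m0 * MM n t) (at t)"
    if "s0 \<le> t" "t \<le> s2" for t
  proof -
    have "((\<lambda>t. GG n t - g Y + 2 / m0 * (Y - UU n t)) has_real_derivative
        (- yy n t - 0 + 2 / m0 * (0 - (- MM n t)))) (at t)"
      by (intro DERIV_add DERIV_diff DERIV_cmult DERIV_const GG_deriv UU_deriv D[OF that])
    then show ?thesis by (simp add: B_def GG_def)
  qed
  have lnP: "((\<lambda>t. ln (PP n t)) has_real_derivative 2 + kap t - yy n t) (at t)"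
    if "s0 \<le> t" "t \<le> s2" for t
  proof -
    have "PP n t > 0" using PP_pos D[OF that] by auto
    then show ?thesis
      using DERIV_chain2[where f = ln, OF DERIV_ln_divide PP_deriv[OF D(1,2)[OF that]]] by simp
  qed
  \<comment> \<open>Since -u_s >= m0 on the whole gap, log \<open>PP\<close> - B grows at most at
    the rate of \<open>kap\<close>.\<close>
  have up: "ln (PP n t) \<le> ln (PP n s0) + B (UU n t) + \<kappa> * (t - s0)" if t: "s0 \<le> t" "t \<le> s2" for t
  proof -
    have "- (ln (PP n s0) - B (UU n s0) - \<kappa> * s0) \<le> - (ln (PP n t) - B (UU n t) - \<kappa> * t)"
    proof (rule log_time_mono[OF t(1), where \<phi> = "\<lambda>t. - (ln (PP n t) - B (UU n t) - \<kappa> * t)"])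
      fix x assume "s0 \<le> x" "x \<le> t"
      then have x: "s0 \<le> x" "x \<le> s2" using t by auto
      show "((\<lambda>t. - (ln (PP n t) - B (UU n t) - \<kappa> * t)) has_real_derivative
          - (2 + kap x - yy n x - (- yy n x + 2 / m0 * MM n x) - \<kappa>)) (at x)"
        by (intro DERIV_minus DERIV_diff DERIV_cmult_Id lnP Bd x)
      have "2 \<le> 2 / m0 * MM n x" using M[OF x] m0 by (simp add: field_simps)
      then show "- (2 + kap x - yy n x - (- yy n x + 2 / m0 * MM n x) - \<kappa>) \<ge> 0"
        using kap[OF x] by linarith
    qed
    moreover have "B (UU n s0) = 0" by (simp add: B_def Y_def)
    ultimately show ?thesis by (simp add: algebra_simps)
  qed
  have Bc: "B v \<le> - c * (Y - v)" if v: "X \<le> v" "v \<le> Y" for v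
  proof (cases "X = Y")
    case True
    then have "v = Y" using v by simp
    then show ?thesis by (simp add: B_def)
  next
    case False
    then have YX: "Y - X > 0" using XY by simp
    have "g v * (Y - X) \<le> (Y - v) * g X + (v - X) * g Y"
      using g_chord[of X v Y] v s by simp
    then have "B v * (Y - X) \<le> (Y - v) * B X"
      by (simp add: B_def algebra_simps)
    also have "\<dots> \<le> (Y - v) * (- c * (Y - X))"
      using chord v by (intro mult_left_mono) auto
    finally have "B v * (Y - X) \<le> (- c * (Y - v)) * (Y - X)" by (simp add: algebra_simps)
    then show ?thesis by (rule mult_right_le_imp_le[OF _ YX])
  qed
  define D0 where "D0 = PP n s0 * exp (\<kappa> * T)"
  have P0: "PP n s0 > 0" using PP_pos[of s0 n] D[of s0] s by auto
  have A: "A > 0" "A * c * m0 = D0" using P0 c m0 by (simp_all add: A_def D0_def)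
  have PD: "PP n t \<le> D0 * exp (- c * (Y - UU n t))" if t: "s0 \<le> t" "t \<le> s2" for t
  proof -
    have "\<kappa> * (t - s0) \<le> \<kappa> * T" using t \<kappa> by (intro mult_left_mono) (auto simp: T_def)
    then have "ln (PP n t) \<le> ln (PP n s0) + \<kappa> * T + (- c * (Y - UU n t))"
      using up[OF t] Bc[of "UU n t"] D[OF t] by linarith
    then have "exp (ln (PP n t)) \<le> exp (ln (PP n s0) + \<kappa> * T + (- c * (Y - UU n t)))"
      by (simp only: exp_le_cancel_iff)
    moreover have "PP n t > 0" using PP_pos[of t n] D[OF t] by simp
    ultimately show ?thesis using P0 by (simp only: exp_add D0_def exp_ln)
  qed
  \<comment> \<open>With u as variable of integration, the integral of \<open>PP\<close> is at most
    1/m0 times that of D0 exp (- c (Y - u)) over u, hence at most D0/(c m0) = A. The barrier A exp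
    (- c (Y - u)) expresses this through monotonicity in s.\<close>
  have MA: "MM n t \<le> m0 + A" if t: "s0 \<le> t" "t \<le> s2" for t
  proof -
    let ?\<phi> = "\<lambda>t. - (A * exp (- c * (Y - UU n t))) - MM n t"
    have "?\<phi> s0 \<le> ?\<phi> t"
    proof (rule log_time_mono[OF t(1), where \<phi> = ?\<phi>])
      fix x assume "s0 \<le> x" "x \<le> t"
      then have x: "s0 \<le> x" "x \<le> s2" using t by auto
      have "((\<lambda>t. - c * (Y - UU n t)) has_real_derivative - c * (0 - (- MM n x))) (at x)"
        by (intro DERIV_cmult DERIV_diff DERIV_const UU_deriv D(1)[OF x])
      from DERIV_fun_exp[OF this]
      show "(?\<phi> has_real_derivative
          - (A * (exp (- c * (Y - UU n x)) * (- c * (0 - (- MM n x))))) - PP n x) (at x)"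
        by (intro DERIV_diff DERIV_minus DERIV_cmult MM_deriv D(1)[OF x])
      have "A * c * m0 * exp (- c * (Y - UU n x)) \<le> A * c * MM n x * exp (- c * (Y - UU n x))"
        using A c M[OF x] by (intro mult_right_mono mult_left_mono) auto
      moreover have "- (A * (exp (- c * (Y - UU n x)) * (- c * (0 - (- MM n x)))))
          = A * c * MM n x * exp (- c * (Y - UU n x))"
        by (simp add: mult_ac)
      ultimately show "- (A * (exp (- c * (Y - UU n x)) * (- c * (0 - (- MM n x))))) - PP n x \<ge> 0"
        using PD[OF x] unfolding A(2) by linarith
    qed
    moreover have "A * exp (- c * (Y - UU n t)) > 0" using A by simp
    ultimately show ?thesis by (simp add: m0_def Y_def)
  qed
  show "MM n s2 \<le> m0 + A" using MA s by simp
  \<comment> \<open>The reverse comparison uses the upper bound m0 + A just obtained; it costs 2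
    A/m0 per unit of time.\<close>
  have low: "ln (PP n s0) + B X - (\<kappa> + 2 * A / m0) * T \<le> ln (PP n s2)"
  proof -
    let ?\<phi> = "\<lambda>t. ln (PP n t) - B (UU n t) + (\<kappa> + 2 * A / m0) * t"
    have "?\<phi> s0 \<le> ?\<phi> s2"
    proof (rule log_time_mono[OF s(1), where \<phi> = ?\<phi>])
      fix x assume x: "s0 \<le> x" "x \<le> s2"
      show "(?\<phi> has_real_derivative
          2 + kap x - yy n x - (- yy n x + 2 / m0 * MM n x) + (\<kappa> + 2 * A / m0)) (at x)"
        by (intro DERIV_add DERIV_diff DERIV_cmult_Id lnP Bd x)
      have "2 / m0 * MM n x \<le> 2 / m0 * (m0 + A)" using MA[OF x] m0 by (intro mult_left_mono) auto
      also have "\<dots> = 2 + 2 * A / m0" using m0 by (simp add: field_simps)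
      finally show "2 + kap x - yy n x - (- yy n x + 2 / m0 * MM n x) + (\<kappa> + 2 * A / m0) \<ge> 0"
        using kap[OF x] by linarith
    qed
    moreover have "B (UU n s0) = 0" by (simp add: B_def Y_def)
    ultimately show ?thesis unfolding T_def X_def right_diff_distrib by linarith
  qed
  have "0 \<le> 2 * A / m0 * T" using A m0 s by (simp add: T_def)
  then show "\<bar>ln (PP n s2) - ln (PP n s0) - B X\<bar> \<le> (\<kappa> + 2 * A / m0) * T"
    using up[of s2] low s by (simp add: T_def X_def algebra_simps abs_le_iff)
qed

end

lemma slope_tendsto:
  assumes "0 < a"
  shows "(slope a \<longlongrightarrow> 2 + a) at_top" "(force a \<longlongrightarrow> 0) at_top"
proof -
  have "filterlim (\<lambda>\<sigma>. (a / 2) * \<sigma>) at_top at_top"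
    using assms by (intro filterlim_tendsto_pos_mult_at_top[OF tendsto_const] filterlim_ident) auto
  then have "filterlim (\<lambda>\<sigma>. a * \<sigma> / 2) at_top at_top" by simp
  then have t: "((\<lambda>\<sigma>. tanh (a * \<sigma> / 2)) \<longlongrightarrow> 1) at_top"
    by (rule filterlim_compose[OF tanh_real_at_top])
  have "((\<lambda>\<sigma>. 2 + a * tanh (a * \<sigma> / 2)) \<longlongrightarrow> 2 + a * 1) at_top"
    by (intro tendsto_intros t)
  then show "(slope a \<longlongrightarrow> 2 + a) at_top" by (simp add: slope_def[abs_def])
  have "((\<lambda>\<sigma>. a\<^sup>2 / 2 * (1 - (tanh (a * \<sigma> / 2))\<^sup>2)) \<longlongrightarrow> a\<^sup>2 / 2 * (1 - 1\<^sup>2)) at_top"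
    by (intro tendsto_intros t)
  then show "(force a \<longlongrightarrow> 0) at_top" by (simp add: force_def[abs_def])
qed

context radial_family
begin

lemma at_scale_le_1:
  assumes "at_scale \<eta> \<tau>"
  shows "\<eta> \<le> 1"
proof (rule tendsto_upperbound)
  show "(\<lambda>n. GG n (\<tau> n) / NN n) \<longlonglongrightarrow> \<eta>" using assms by (simp add: at_scale_def)
  have "eventually (\<lambda>n. \<tau> n < 0 \<and> t0 < UU n (\<tau> n)) sequentially"
    using assms by (simp add: at_scale_def)
  then show "eventually (\<lambda>n. GG n (\<tau> n) / NN n \<le> 1) sequentially"
    using eventually_NN[of 0] by eventually_elim (use GG_le_NN in auto)
qed simp

lemma at_scale_ge_t0: "at_scale \<eta> \<tau> \<Longrightarrow> eventually (\<lambda>n. UU n (\<tau> n) \<ge> t0) sequentially"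
  by (auto simp: at_scale_def elim!: eventually_mono)

lemma at_scale_ratio: "at_scale \<eta> \<tau> \<Longrightarrow> (\<lambda>n. g (UU n (\<tau> n)) / g (mu n)) \<longlonglongrightarrow> \<eta>"
  by (simp add: at_scale_def GG_def NN_def)

lemma at_scale_at_top: "at_scale \<eta> \<tau> \<Longrightarrow> \<eta> > 0 \<Longrightarrow> filterlim (\<lambda>n. UU n (\<tau> n)) at_top sequentially"
  by (rule X_at_top[OF at_scale_ge_t0 mu_top at_scale_ratio])

text \<open>With 1/m0 = g'(Y)/y0 and Y - X = L g(Y)/g'(Y), the function B of
  \<open>passage_estimate\<close> takes at the end of the gap the value b g(Y), where b tends to
  \<open>gap q a \<sigma>\<close>. So the negative sign of \<open>gap\<close> yields the chord
  hypothesis there, and log F / g(mu) changes by eta times \<open>gap\<close>. As -u_s is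
  asymptotically constant, y changes only through g'(u), by the factor sigma^(1/q).\<close>

lemma passage:
  assumes s0: "at_scale \<eta> s0" "\<eta> > 0" and a: "a > 0"
    and y: "(\<lambda>n. yy n (s0 n)) \<longlonglongrightarrow> 2 + a" and F: "(\<lambda>n. FF n (s0 n)) \<longlonglongrightarrow> 0"
    and lnF: "(\<lambda>n. ln (FF n (s0 n)) / NN n) \<longlonglongrightarrow> 0"
    and \<sigma>: "0 < \<sigma>" "\<sigma> < 1" and neg: "gap q a \<sigma> < 0"
  obtains s2 where "at_scale (\<eta> * \<sigma>) s2" "(\<lambda>n. yy n (s2 n)) \<longlonglongrightarrow> (2 + a) * \<sigma> powr (1 / q)"
    "(\<lambda>n. FF n (s2 n)) \<longlonglongrightarrow> 0" "(\<lambda>n. ln (FF n (s2 n)) / NN n) \<longlonglongrightarrow> \<eta> * gap q a \<sigma>"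
proof -
  have \<eta>1: "\<eta> \<le> 1" by (rule at_scale_le_1[OF s0(1)])
  have \<eta>\<sigma>: "0 < \<eta> * \<sigma>" "\<eta> * \<sigma> < 1"
    using mult_pos_pos[OF s0(2) \<sigma>(1)] \<sigma> mult_right_mono[OF \<eta>1, of \<sigma>] by linarith+
  \<comment> \<open>Any fraction from eta sigma up to below eta would do: below eta the starting
    time is in the region, and from there the level eta sigma is hit.\<close>
  define d where "d = \<eta> * ((1 + \<sigma>) / 2)"
  have d: "\<eta> * \<sigma> \<le> d" "d < \<eta>" using s0(2) \<sigma> by (simp_all add: d_def)
  have "eventually (\<lambda>n. \<forall>a. dom d n a \<longrightarrow>
      (\<exists>s. a \<le> s \<and> GG n s = \<eta> * \<sigma> * NN n \<and> dom (\<eta> * \<sigma>) n s)) sequentially"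
    by (rule level_hit[OF \<eta>\<sigma>(1) d(1)])
  with at_scale_dom[OF s0(1) d(2)]
  have "eventually (\<lambda>n. \<exists>s. s0 n \<le> s \<and> GG n s = \<eta> * \<sigma> * NN n \<and> dom (\<eta> * \<sigma>) n s) sequentially"
    by eventually_elim auto
  then obtain s2 where s2: "eventually (\<lambda>n. s0 n \<le> s2 n \<and> GG n (s2 n) = \<eta> * \<sigma> * NN n \<and>
      dom (\<eta> * \<sigma>) n (s2 n)) sequentially"
    by (rule eventually_choice)
  obtain C where C: "C > 0" "eventually (\<lambda>n. slow_bounds (\<eta> * \<sigma>) C n) sequentially"
    using dom_slow[OF \<eta>\<sigma>] by auto
  have as2: "at_scale (\<eta> * \<sigma>) s2"
    unfolding at_scale_def
  proof
    show "eventually (\<lambda>n. s2 n < 0 \<and> t0 < UU n (s2 n)) sequentially"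
      using s2 by eventually_elim (auto dest: domD)
    show "(\<lambda>n. GG n (s2 n) / NN n) \<longlonglongrightarrow> \<eta> * \<sigma>"
      by (rule tendsto_eventually) (use s2 eventually_NN[of 0] in eventually_elim, simp)
  qed
  define X Y where "X n = UU n (s2 n)" and "Y n = UU n (s0 n)" for n
  have ratio: "(\<lambda>n. g (X n) / g (Y n)) \<longlonglongrightarrow> \<sigma>"
  proof -
    have "(\<lambda>n. (GG n (s2 n) / NN n) / (GG n (s0 n) / NN n)) \<longlonglongrightarrow> \<eta> * \<sigma> / \<eta>"
      using s0 as2 by (intro tendsto_divide) (auto simp: at_scale_def)
    moreover have "eventually (\<lambda>n. (GG n (s2 n) / NN n) / (GG n (s0 n) / NN n) = g (X n) / g (Y n)) sequentially"
      using eventually_NN[of 0] by eventually_elim (simp add: GG_def X_def Y_def)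
    ultimately show ?thesis using s0(2) Lim_transform_eventually by fastforce
  qed
  note cond = at_scale_ge_t0[OF as2, folded X_def] at_scale_at_top[OF s0, folded Y_def] ratio \<sigma>(1)
  define L where "L n = (Y n - X n) * g1 (Y n) / g (Y n)" for n
  define R where "R n = g1 (X n) / g1 (Y n)" for n
  define lq where "lq = log_q q \<sigma>"
  have L: "L \<longlonglongrightarrow> lq" unfolding L_def[abs_def] lq_def by (rule log_q_tendsto[OF cond])
  have R: "R \<longlonglongrightarrow> \<sigma> powr (1 / q)" unfolding R_def[abs_def] by (rule g1_ratio_tendsto[OF cond])
  have lq: "lq > 0" unfolding lq_def using log_q_pos[OF q_ge_1 q_less_2 \<sigma>] .
  define y0 where "y0 n = yy n (s0 n)" for n
  define b where "b n = g (X n) / g (Y n) - 1 + 2 / y0 n * L n" for n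
  have b: "b \<longlonglongrightarrow> gap q a \<sigma>"
  proof -
    have "b \<longlonglongrightarrow> \<sigma> - 1 + 2 / (2 + a) * lq"
      unfolding b_def[abs_def] y0_def using a by (intro tendsto_intros ratio L y) auto
    moreover have "\<sigma> - 1 + 2 / (2 + a) * lq = gap q a \<sigma>" by (simp add: gap_def lq_def)
    ultimately show ?thesis by simp
  qed
  \<comment> \<open>The chord slope will be c = k g'(Y), obtained by solving B(X) = - c (Y - X) with
    both sides expressed by g(Y).\<close>
  define k where "k n = - b n / L n" for n
  have k: "k \<longlonglongrightarrow> - gap q a \<sigma> / lq"
    unfolding k_def[abs_def] using lq by (intro tendsto_intros b L) auto
  have kpos: "- gap q a \<sigma> / lq > 0" using neg lq by (simp add: divide_neg_pos)
  \<comment> \<open>\<open>K1\<close> will bound the duration of the gap divided by NN, and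
    \<open>e\<close> the ratio A/m0, which vanishes in the limit because F does at the
    start.\<close>
  define K1 where "K1 = lq / (2 + a) + 1"
  define e where "e n = FF n (s0 n) * exp K1 / (k n * (y0 n)\<^sup>2)" for n
  have "e \<longlonglongrightarrow> 0 * exp K1 / ((- gap q a \<sigma> / lq) * (2 + a)\<^sup>2)"
    unfolding e_def[abs_def] y0_def using a kpos by (intro tendsto_intros F k y) auto
  then have e: "e \<longlonglongrightarrow> 0" by simp
  have Ly: "(\<lambda>n. L n / y0 n) \<longlonglongrightarrow> lq / (2 + a)"
    unfolding y0_def using a by (intro tendsto_intros L y) auto
  have y2: "eventually (\<lambda>n. 2 < yy n (s0 n)) sequentially"
    using order_tendstoD(1)[OF y, of 2] a by simp
  have LyK: "eventually (\<lambda>n. L n / y0 n < K1) sequentially"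
    using order_tendstoD(2)[OF Ly, of K1] by (simp add: K1_def)
  have main: "eventually (\<lambda>n. yy n (s2 n) = y0 n * (MM n (s2 n) / MM n (s0 n)) * R n \<and>
      1 \<le> MM n (s2 n) / MM n (s0 n) \<and> MM n (s2 n) / MM n (s0 n) \<le> 1 + e n \<and>
      \<bar>ln (FF n (s2 n)) / NN n - (ln (FF n (s0 n)) / NN n + ln (R n) / NN n + b n * (GG n (s0 n) / NN n))\<bar>
        \<le> K1 / NN n + 2 * e n * K1) sequentially"
    using s2 C(2) y2 order_tendstoD(1)[OF k kpos]
      order_tendstoD(1)[OF L lq] LyK eventually_pos_XY[OF cond]
  proof eventually_elim
    case (elim n)
    have N: "NN n > 0" using elim by auto
    have y0: "y0 n > 0" using elim(3) a by (simp add: y0_def)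
    have kn: "k n > 0" and Ln: "L n > 0" and LK: "L n / y0 n < K1"
      using elim by auto
    have gp: "g (X n) > 0" "g (Y n) > 0" "g1 (X n) > 0" "g1 (Y n) > 0" using elim by auto
    have D2: "dom (\<eta> * \<sigma>) n (s2 n)" and le: "s0 n \<le> s2 n" using elim(1) by auto
    note D = domD[OF D2] and D0 = domD[OF dom_down[OF D2 le]]
    define m0 where "m0 = MM n (s0 n)"
    have y0m: "y0 n = m0 * g1 (Y n)" by (simp add: y0_def yy_def m0_def Y_def)
    have m0: "m0 > 0" using y0 gp unfolding y0m by (simp add: zero_less_mult_iff)
    have LX: "Y n - X n = L n * g (Y n) / g1 (Y n)" using gp by (simp add: L_def)
    define B where "B v = g v - g (Y n) + 2 / m0 * (Y n - v)" for v
    have BX: "B (X n) = b n * g (Y n)"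
      unfolding B_def b_def LX y0m using gp m0 by (simp add: field_simps)
    define c where "c = k n * g1 (Y n)"
    have c: "c > 0" using kn gp by (simp add: c_def)
    have chord: "B (X n) \<le> - c * (Y n - X n)"
      unfolding BX LX c_def k_def using gp Ln by simp
    define T where "T = s2 n - s0 n"
    define A where "A = PP n (s0 n) * exp (1 / NN n * T) / (c * m0)"
    have kp: "\<bar>kap t\<bar> \<le> 1 / NN n" if "s0 n \<le> t" "t \<le> s2 n" for t
      using elim(2) dom_down[OF D2 that(2)] by auto
    have pe: "m0 * T \<le> Y n - X n" "m0 \<le> MM n (s2 n)" "MM n (s2 n) \<le> m0 + A"
      "\<bar>ln (PP n (s2 n)) - ln (PP n (s0 n)) - B (X n)\<bar> \<le> (1 / NN n + 2 * A / m0) * T"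
      using passage_estimate[of "s0 n" "s2 n" n c "1 / NN n", OF le D(1,2) _ c _ kp]
        m0 chord N unfolding m0_def B_def X_def Y_def A_def T_def by auto
    have "T * y0 n \<le> L n * g (Y n)"
      using pe(1) gp unfolding y0m LX by (simp add: field_simps)
    also have "\<dots> \<le> L n * NN n"
      using GG_le_NN[OF D0(1,2)] Ln by (intro mult_left_mono) (auto simp: GG_def Y_def)
    finally have "T \<le> L n / y0 n * NN n" using y0 by (simp add: field_simps)
    also have "\<dots> \<le> K1 * NN n" using LK N by (intro mult_right_mono) auto
    finally have TK: "T / NN n \<le> K1" using N by (simp add: pos_divide_le_eq)
    have T0: "T \<ge> 0" using le by (simp add: T_def)
    have Am: "A / m0 \<le> e n"
    proof -
      have "A / m0 = FF n (s0 n) * exp (T / NN n) / (k n * (y0 n)\<^sup>2)"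
        unfolding A_def c_def y0m FF_def using gp m0 by (simp add: Y_def power2_eq_square)
      also have "\<dots> \<le> e n"
        unfolding e_def using TK kn y0 FF_pos[OF D0(1,2)]
        by (intro divide_right_mono mult_left_mono) auto
      finally show ?thesis .
    qed
    have A0: "A / m0 \<ge> 0" using PP_nonneg[OF D0(1), of n] c m0 by (simp add: A_def)
    have r1: "1 \<le> MM n (s2 n) / m0" using pe(2) m0 by simp
    have "MM n (s2 n) / m0 \<le> (m0 + A) / m0" using pe(3) m0 by (intro divide_right_mono) auto
    also have "\<dots> = 1 + A / m0" using m0 by (simp add: add_divide_distrib)
    finally have r2: "MM n (s2 n) / m0 \<le> 1 + e n" using Am by simp
    have r0: "yy n (s2 n) = y0 n * (MM n (s2 n) / m0) * R n"
      unfolding y0m R_def using gp m0 by (simp add: yy_def X_def)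
    have "ln (FF n (s2 n)) = ln (PP n (s2 n)) + ln (g1 (X n))"
      unfolding FF_def X_def using PP_pos[OF D(1,2)] gp(3) by (simp add: ln_mult X_def)
    moreover have "ln (FF n (s0 n)) = ln (PP n (s0 n)) + ln (g1 (Y n))"
      unfolding FF_def Y_def using PP_pos[OF D0(1,2)] gp(4) by (simp add: ln_mult Y_def)
    moreover have "ln (R n) = ln (g1 (X n)) - ln (g1 (Y n))"
      using gp by (simp add: R_def ln_div)
    ultimately have "\<bar>ln (FF n (s2 n)) - (ln (FF n (s0 n)) + ln (R n) + b n * g (Y n))\<bar>
        \<le> (1 / NN n + 2 * A / m0) * T"
      using pe(4) unfolding BX by simp
    then have "\<bar>ln (FF n (s2 n)) - (ln (FF n (s0 n)) + ln (R n) + b n * g (Y n))\<bar> / NN n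
        \<le> (1 / NN n + 2 * A / m0) * T / NN n"
      using N by (intro divide_right_mono) auto
    also have "\<dots> = (T / NN n) / NN n + 2 * (A / m0) * (T / NN n)"
      using N by (simp add: field_simps)
    also have "\<dots> \<le> K1 / NN n + 2 * e n * K1"
      using TK T0 N Am A0 by (intro add_mono divide_right_mono mult_mono) auto
    finally have "\<bar>ln (FF n (s2 n)) - (ln (FF n (s0 n)) + ln (R n) + b n * g (Y n))\<bar> / NN n
        \<le> K1 / NN n + 2 * e n * K1" .
    moreover have "\<bar>ln (FF n (s2 n)) - (ln (FF n (s0 n)) + ln (R n) + b n * g (Y n))\<bar> / NN n
        = \<bar>ln (FF n (s2 n)) / NN n - (ln (FF n (s0 n)) / NN n + ln (R n) / NN n + b n * (GG n (s0 n) / NN n))\<bar>"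
      using N by (simp add: GG_def Y_def add_divide_distrib diff_divide_distrib
          flip: abs_divide[of _ "NN n", simplified abs_of_pos[OF N]])
    ultimately show ?case using r0 r1 r2 by (simp add: m0_def)
  qed
  show ?thesis
  proof (rule that[OF as2])
    have "(\<lambda>n. MM n (s2 n) / MM n (s0 n)) \<longlonglongrightarrow> 1"
    proof (rule tendsto_sandwich)
      show "eventually (\<lambda>n. 1 \<le> MM n (s2 n) / MM n (s0 n)) sequentially"
        using main by eventually_elim blast
      show "eventually (\<lambda>n. MM n (s2 n) / MM n (s0 n) \<le> 1 + e n) sequentially"
        using main by eventually_elim blast
      show "(\<lambda>n. 1 + e n) \<longlonglongrightarrow> 1" using tendsto_add[OF tendsto_const e, of 1] by simp
    qed simp
    from tendsto_mult[OF tendsto_mult[OF y this] R]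
    have "(\<lambda>n. y0 n * (MM n (s2 n) / MM n (s0 n)) * R n) \<longlonglongrightarrow> (2 + a) * \<sigma> powr (1 / q)"
      by (simp add: y0_def)
    then show "(\<lambda>n. yy n (s2 n)) \<longlonglongrightarrow> (2 + a) * \<sigma> powr (1 / q)"
      by (rule Lim_transform_eventually) (use main in eventually_elim, auto)
    have "(\<lambda>n. K1 / NN n + 2 * e n * K1) \<longlonglongrightarrow> 0 + 2 * 0 * K1"
      by (intro tendsto_intros const_over_NN e)
    then have err: "(\<lambda>n. K1 / NN n + 2 * e n * K1) \<longlonglongrightarrow> 0" by simp
    let ?D = "\<lambda>n. ln (FF n (s0 n)) / NN n + ln (R n) / NN n + b n * (GG n (s0 n) / NN n)"
    have "(\<lambda>n. ln (FF n (s2 n)) / NN n - ?D n) \<longlonglongrightarrow> 0"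
      by (rule Lim_null_comparison[OF _ err]) (use main in eventually_elim, simp)
    moreover have "(\<lambda>n. ln (R n) / NN n) \<longlonglongrightarrow> 0"
      using \<sigma> by (intro real_tendsto_divide_at_top[OF tendsto_ln[OF R] NN_at_top]) auto
    then have "?D \<longlonglongrightarrow> 0 + 0 + gap q a \<sigma> * \<eta>"
      using s0 by (intro tendsto_intros lnF b) (auto simp: at_scale_def)
    ultimately have "(\<lambda>n. (ln (FF n (s2 n)) / NN n - ?D n) + ?D n) \<longlonglongrightarrow> 0 + (0 + 0 + gap q a \<sigma> * \<eta>)"
      by (rule tendsto_add)
    then show lim: "(\<lambda>n. ln (FF n (s2 n)) / NN n) \<longlonglongrightarrow> \<eta> * gap q a \<sigma>"
      by (simp add: mult.commute)
    define w where "w = - (\<eta> * gap q a \<sigma>) / 2"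
    have w: "w > 0" "\<eta> * gap q a \<sigma> < - w"
      using s0(2) neg by (auto simp: w_def mult_pos_neg)
    show "(\<lambda>n. FF n (s2 n)) \<longlonglongrightarrow> 0"
    proof (rule tendsto_sandwich[of "\<lambda>_. 0"])
      show "eventually (\<lambda>n. 0 \<le> FF n (s2 n)) sequentially"
        using s2 C(2) by eventually_elim (auto intro: less_imp_le)
      show "eventually (\<lambda>n. FF n (s2 n) \<le> exp (- (w * NN n))) sequentially"
        using s2 C(2) order_tendstoD(2)[OF lim w(2)]
      proof eventually_elim
        case (elim n)
        then have p: "NN n > 0" "FF n (s2 n) > 0" by auto
        have "ln (FF n (s2 n)) \<le> - (w * NN n)"
          using elim(3) p by (simp add: pos_divide_less_eq)
        then have "exp (ln (FF n (s2 n))) \<le> exp (- (w * NN n))" by (simp only: exp_le_cancel_iff)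
        then show ?case using p by simp
      qed
      have "filterlim (\<lambda>n. w * NN n) at_top sequentially"
        by (rule filterlim_tendsto_pos_mult_at_top[OF tendsto_const w(1) NN_at_top])
      then have "filterlim (\<lambda>n. - (w * NN n)) at_bot sequentially"
        by (simp add: filterlim_uminus_at_top)
      then show "(\<lambda>n. exp (- (w * NN n))) \<longlonglongrightarrow> 0"
        by (rule filterlim_compose[OF exp_at_bot])
    qed simp
  qed
qed

text \<open>The time marks the centre of the bubble, where y crosses 2 and F has its limiting
  maximum a^2/2.\<close>

definition bubble :: "real \<Rightarrow> real \<Rightarrow> (nat \<Rightarrow> real) \<Rightarrow> bool" where
  "bubble a \<eta> \<tau> \<longleftrightarrow> 0 < a \<and> a \<le> 2 \<and> 0 < \<eta> \<and> at_scale \<eta> \<tau> \<and>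
     (\<lambda>n. yy n (\<tau> n)) \<longlonglongrightarrow> 2 \<and> (\<lambda>n. FF n (\<tau> n)) \<longlonglongrightarrow> a\<^sup>2 / 2"

text \<open>For fixed j the time tau + j is governed by the limit orbit and log F is bounded there.
  Letting j tend to infinity slowly takes y to 2 + a and F to 0, while log F remains
  o(g(mu)).\<close>

lemma bubble_exit:
  assumes "bubble a \<eta> \<tau>"
  obtains s0 where "at_scale \<eta> s0" "(\<lambda>n. yy n (s0 n)) \<longlonglongrightarrow> 2 + a" "(\<lambda>n. FF n (s0 n)) \<longlonglongrightarrow> 0"
    "(\<lambda>n. ln (FF n (s0 n)) / NN n) \<longlonglongrightarrow> 0"
proof -
  have a: "0 < a" "a \<le> 2" and \<eta>: "at_scale \<eta> \<tau>" "0 < \<eta>"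
    and y: "(\<lambda>n. yy n (\<tau> n)) \<longlonglongrightarrow> 2" and F: "(\<lambda>n. FF n (\<tau> n)) \<longlonglongrightarrow> a\<^sup>2 / 2"
    using assms by (auto simp: bubble_def)
  let ?Q = "\<lambda>j n. (\<tau> n + real j < 0 \<and> t0 < UU n (\<tau> n + real j)) \<and>
    \<bar>yy n (\<tau> n + real j) - slope a (real j)\<bar> \<le> 1 / (real j + 1) \<and>
    \<bar>FF n (\<tau> n + real j) - force a (real j)\<bar> \<le> 1 / (real j + 1) \<and>
    \<bar>GG n (\<tau> n + real j) / NN n - \<eta>\<bar> \<le> 1 / (real j + 1) \<and>
    \<bar>ln (FF n (\<tau> n + real j)) / NN n - 0\<bar> \<le> 1 / (real j + 1)"
  have "eventually (?Q j) sequentially" for j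
  proof -
    let ?j = "real j" and ?i = "1 / (real j + 1)"
    \<comment> \<open>An error of at most half of \<open>force\<close> keeps F away from 0 for this
      j, so that log F is bounded and negligible against NN.\<close>
    define e where "e = min (?i / 2) (force a ?j / 2)"
    have e: "e > 0" "e \<le> ?i / 2" "e \<le> force a ?j / 2"
      using force_pos[OF a(1), of ?j] by (auto simp: e_def)
    obtain d where d: "d > 0" "eventually (\<lambda>n. close_on a \<tau> (?j + 1) e d n) sequentially"
      by (rule bubble_window[OF \<eta> a y F _ e(1), of "?j + 1"]) auto
    define l where "l = \<bar>ln (force a ?j / 2)\<bar> + \<bar>ln (2 * force a ?j)\<bar>"
    have G: "eventually (\<lambda>n. \<bar>GG n (\<tau> n) / NN n - \<eta>\<bar> < ?i / 2) sequentially"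
      using \<eta>(1) tendstoD[of "\<lambda>n. GG n (\<tau> n) / NN n" \<eta> sequentially "?i / 2"]
      by (simp add: at_scale_def dist_real_def)
    show ?thesis
      using d(2) G eventually_NN[of "max 0 (l / ?i)"]
    proof eventually_elim
      case (elim n)
      let ?s = "\<tau> n + ?j"
      have N: "NN n > 0" "l / ?i < NN n" using elim(3) by auto
      have "\<bar>?j\<bar> \<le> ?j + 1" by simp
      with elim(1) have w: "dom d n ?s" "\<bar>yy n ?s - slope a ?j\<bar> \<le> e" "\<bar>FF n ?s - force a ?j\<bar> \<le> e"
        "\<bar>GG n ?s - GG n (\<tau> n)\<bar> \<le> e * NN n" by blast+
      have fp: "force a ?j > 0" using force_pos[OF a(1)] .
      have "force a ?j / 2 \<le> FF n ?s" "FF n ?s \<le> 2 * force a ?j" using w(3) e(3) fp by linarith+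
      then have "ln (force a ?j / 2) \<le> ln (FF n ?s)" "ln (FF n ?s) \<le> ln (2 * force a ?j)"
        using fp by (subst ln_le_cancel_iff; simp)+
      then have "\<bar>ln (FF n ?s)\<bar> \<le> l" by (simp add: l_def)
      moreover have "l \<le> ?i * NN n" using N by (simp add: field_simps)
      ultimately have lF: "\<bar>ln (FF n ?s) / NN n\<bar> \<le> ?i" using N by (simp add: abs_divide pos_divide_le_eq)
      have "\<bar>GG n ?s / NN n - GG n (\<tau> n) / NN n\<bar> = \<bar>GG n ?s - GG n (\<tau> n)\<bar> / NN n"
        using N by (simp add: diff_divide_distrib[symmetric])
      also have "\<dots> \<le> e" using w(4) N by (simp add: pos_divide_le_eq)
      finally have "\<bar>GG n ?s / NN n - GG n (\<tau> n) / NN n\<bar> \<le> e" .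
      moreover have "\<bar>x - z\<bar> \<le> i" if "\<bar>x - y\<bar> \<le> e" "\<bar>y - z\<bar> < i / 2" "e \<le> i / 2" for x y z i :: real
        using that by linarith
      ultimately have "\<bar>GG n ?s / NN n - \<eta>\<bar> \<le> ?i" using elim(2) e(2) by blast
      moreover have ei: "e \<le> ?i" by (rule order_trans[OF e(2)]) (simp add: field_simps)
      moreover have "\<bar>ln (FF n ?s) / NN n - 0\<bar> \<le> ?i" using lF by simp
      ultimately show ?case
        using order_trans[OF w(2) ei] order_trans[OF w(3) ei] domD(1,2)[OF w(1)] by blast
    qed
  qed
  then obtain J where J: "filterlim J at_top sequentially" "eventually (\<lambda>n. ?Q (J n) n) sequentially"
    by (rule diagonal_sequence[of ?Q]) auto
  note Jr = filterlim_compose[OF filterlim_real_sequentially J(1)]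
  show ?thesis
  proof (rule that[of "\<lambda>n. \<tau> n + real (J n)"])
    have "(\<lambda>n. GG n (\<tau> n + real (J n)) / NN n) \<longlonglongrightarrow> \<eta>"
      by (rule tendsto_via_diagonal[OF J(1), of "\<lambda>_. \<eta>"]) (use J(2) in \<open>auto elim: eventually_mono\<close>)
    moreover have "eventually (\<lambda>n. \<tau> n + real (J n) < 0 \<and> t0 < UU n (\<tau> n + real (J n))) sequentially"
      using J(2) by eventually_elim blast
    ultimately show "at_scale \<eta> (\<lambda>n. \<tau> n + real (J n))" by (simp add: at_scale_def)
    show "(\<lambda>n. yy n (\<tau> n + real (J n))) \<longlonglongrightarrow> 2 + a"
      by (rule tendsto_via_diagonal[OF J(1) filterlim_compose[OF slope_tendsto(1)[OF a(1)] filterlim_real_sequentially]])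
        (use J(2) in \<open>eventually_elim, blast\<close>)
    show "(\<lambda>n. FF n (\<tau> n + real (J n))) \<longlonglongrightarrow> 0"
      by (rule tendsto_via_diagonal[OF J(1) filterlim_compose[OF slope_tendsto(2)[OF a(1)] filterlim_real_sequentially]])
        (use J(2) in \<open>eventually_elim, blast\<close>)
    show "(\<lambda>n. ln (FF n (\<tau> n + real (J n))) / NN n) \<longlonglongrightarrow> 0"
      by (rule tendsto_via_diagonal[OF J(1), of "\<lambda>_. 0"]) (use J(2) in \<open>auto elim: eventually_mono\<close>)
  qed
qed

text \<open>\<open>passage\<close> degenerates at the root, where the chord slope vanishes. It is
  applied at levels decreasing to the root; by continuity of \<open>gap\<close> a diagonal choice
  arrives there with log F = o(g(mu)), and F still tends to 0.\<close>

lemma next_entry: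
  assumes "bubble a \<eta> \<tau>"
  defines "\<sigma> \<equiv> gap_root q a"
  obtains s where "at_scale (\<eta> * \<sigma>) s" "(\<lambda>n. yy n (s n)) \<longlonglongrightarrow> (2 + a) * \<sigma> powr (1 / q)"
    "(\<lambda>n. FF n (s n)) \<longlonglongrightarrow> 0" "(\<lambda>n. ln (FF n (s n)) / NN n) \<longlonglongrightarrow> 0"
proof -
  have a: "0 < a" "a \<le> 2" and \<eta>: "0 < \<eta>" using assms by (auto simp: bubble_def)
  note q = q_ge_1 q_less_2
  have \<sigma>: "0 < \<sigma>" "\<sigma> < 1" using gap_root_bounds[OF q a] by (auto simp: \<sigma>_def)
  obtain s0 where s0: "at_scale \<eta> s0" "(\<lambda>n. yy n (s0 n)) \<longlonglongrightarrow> 2 + a" "(\<lambda>n. FF n (s0 n)) \<longlonglongrightarrow> 0"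
    "(\<lambda>n. ln (FF n (s0 n)) / NN n) \<longlonglongrightarrow> 0"
    using bubble_exit[OF assms(1)] by blast
  \<comment> \<open>The shift by 2 keeps the level below 1 also for j = 0.\<close>
  define sg where "sg j = \<sigma> + (1 - \<sigma>) * (1 / (real j + 2))" for j
  have sgb: "\<sigma> < sg j" "sg j < 1" for j
  proof -
    have "0 < 1 / (real j + 2)" "1 / (real j + 2) < 1" by auto
    then have "0 < (1 - \<sigma>) * (1 / (real j + 2))" "(1 - \<sigma>) * (1 / (real j + 2)) < (1 - \<sigma>) * 1"
      using \<sigma> by (intro mult_pos_pos mult_strict_left_mono; simp)+
    then show "\<sigma> < sg j" "sg j < 1" by (auto simp: sg_def)
  qed
  have "(\<lambda>j. 1 / (real (Suc j) + 1)) \<longlonglongrightarrow> 0"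
    using LIMSEQ_Suc[OF LIMSEQ_inverse_real_of_nat] by (simp add: inverse_eq_divide add_ac)
  then have "(\<lambda>j. \<sigma> + (1 - \<sigma>) * (1 / (real (Suc j) + 1))) \<longlonglongrightarrow> \<sigma> + (1 - \<sigma>) * 0"
    by (intro tendsto_intros)
  then have sg: "sg \<longlonglongrightarrow> \<sigma>" by (simp add: sg_def[abs_def] add_ac)
  have gapc: "(\<lambda>j. \<eta> * gap q a (sg j)) \<longlonglongrightarrow> 0"
  proof -
    have "isCont (gap q a) \<sigma>" using DERIV_isCont[OF gap_deriv[OF q(1) \<sigma>(1)]] .
    then have "(\<lambda>j. gap q a (sg j)) \<longlonglongrightarrow> gap q a \<sigma>" by (rule isCont_tendsto_compose[OF _ sg])
    then have "(\<lambda>j. \<eta> * gap q a (sg j)) \<longlonglongrightarrow> \<eta> * gap q a \<sigma>" by (intro tendsto_intros)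
    then show ?thesis using gap_gap_root[OF q a] by (simp add: \<sigma>_def)
  qed
  let ?Q = "\<lambda>j n. \<exists>s. (s < 0 \<and> t0 < UU n s) \<and> \<bar>GG n s / NN n - \<eta> * sg j\<bar> \<le> 1 / (real j + 1) \<and>
    \<bar>yy n s - (2 + a) * sg j powr (1 / q)\<bar> \<le> 1 / (real j + 1) \<and>
    \<bar>FF n s - 0\<bar> \<le> 1 / (real j + 1) \<and>
    \<bar>ln (FF n s) / NN n - \<eta> * gap q a (sg j)\<bar> \<le> 1 / (real j + 1)"
  have "eventually (?Q j) sequentially" for j
  proof -
    have neg: "gap q a (sg j) < 0" using gap_neg[OF q a, of "sg j"] sgb[of j] by (simp add: \<sigma>_def)
    have "0 < sg j" using sgb(1)[of j] \<sigma> by simp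
    then obtain s2 where s2: "at_scale (\<eta> * sg j) s2"
      "(\<lambda>n. yy n (s2 n)) \<longlonglongrightarrow> (2 + a) * sg j powr (1 / q)"
      "(\<lambda>n. FF n (s2 n)) \<longlonglongrightarrow> 0" "(\<lambda>n. ln (FF n (s2 n)) / NN n) \<longlonglongrightarrow> \<eta> * gap q a (sg j)"
      using passage[OF s0(1) \<eta> a(1) s0(2-4) _ sgb(2) neg] by blast
    have i: "1 / (real j + 1) > 0" by simp
    have close: "eventually (\<lambda>n. \<bar>X n - l\<bar> \<le> 1 / (real j + 1)) sequentially"
      if "X \<longlonglongrightarrow> l" for X :: "nat \<Rightarrow> real" and l
      using tendstoD[OF that i] by (auto elim!: eventually_mono simp: dist_real_def)
    have s2': "eventually (\<lambda>n. s2 n < 0 \<and> t0 < UU n (s2 n)) sequentially"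
      "(\<lambda>n. GG n (s2 n) / NN n) \<longlonglongrightarrow> \<eta> * sg j"
      using s2(1) by (auto simp: at_scale_def)
    show ?thesis
      using s2'(1) close[OF s2'(2)] close[OF s2(2)] close[OF s2(3)] close[OF s2(4)]
      by eventually_elim blast
  qed
  then obtain J where J: "filterlim J at_top sequentially" "eventually (\<lambda>n. ?Q (J n) n) sequentially"
    by (rule diagonal_sequence[of ?Q]) auto
  from J(2) obtain s where s: "eventually (\<lambda>n. (s n < 0 \<and> t0 < UU n (s n)) \<and>
      \<bar>GG n (s n) / NN n - \<eta> * sg (J n)\<bar> \<le> 1 / (real (J n) + 1) \<and>
    \<bar>yy n (s n) - (2 + a) * sg (J n) powr (1 / q)\<bar> \<le> 1 / (real (J n) + 1) \<and>
    \<bar>FF n (s n) - 0\<bar> \<le> 1 / (real (J n) + 1) \<and>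
    \<bar>ln (FF n (s n)) / NN n - \<eta> * gap q a (sg (J n))\<bar> \<le> 1 / (real (J n) + 1)) sequentially"
    by (rule eventually_choice)
  show ?thesis
  proof (rule that[of s])
    have "(\<lambda>n. GG n (s n) / NN n) \<longlonglongrightarrow> \<eta> * \<sigma>"
      by (rule tendsto_via_diagonal[OF J(1) tendsto_mult[OF tendsto_const sg]])
        (use s in \<open>eventually_elim, blast\<close>)
    moreover have "eventually (\<lambda>n. s n < 0 \<and> t0 < UU n (s n)) sequentially"
      using s by eventually_elim blast
    ultimately show "at_scale (\<eta> * \<sigma>) s" by (simp add: at_scale_def)
    have "(\<lambda>j. (2 + a) * sg j powr (1 / q)) \<longlonglongrightarrow> (2 + a) * \<sigma> powr (1 / q)"
      using \<sigma> by (intro tendsto_intros sg) auto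
    then show "(\<lambda>n. yy n (s n)) \<longlonglongrightarrow> (2 + a) * \<sigma> powr (1 / q)"
      by (rule tendsto_via_diagonal[OF J(1)]) (use s in \<open>eventually_elim, blast\<close>)
    show "(\<lambda>n. FF n (s n)) \<longlonglongrightarrow> 0"
      by (rule tendsto_via_diagonal[OF J(1) tendsto_const]) (use s in \<open>eventually_elim, blast\<close>)
    show "(\<lambda>n. ln (FF n (s n)) / NN n) \<longlonglongrightarrow> 0"
      by (rule tendsto_via_diagonal[OF J(1) gapc]) (use s in \<open>eventually_elim, blast\<close>)
  qed
qed

text \<open>With s the root for a_k, the arrival value (2 + a_k) s^(1/q) of y is 2 - a_(k+1), which
  is the value from which a bubble of parameter a_(k+1) starts. The induction begins with y = 0 = 2
  - a_1.\<close>

lemma bubbles_exist: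
  assumes "k \<ge> 1"
  shows "\<exists>\<tau>. bubble (a_seq q k) (eta_seq q k) \<tau>"
  using assms
proof (induction k rule: nat_induct_at_least)
  case base
  obtain s where s: "at_scale 1 s" "(\<lambda>n. yy n (s n)) \<longlonglongrightarrow> 0" "(\<lambda>n. FF n (s n)) \<longlonglongrightarrow> 0"
    "(\<lambda>n. ln (FF n (s n)) / NN n) \<longlonglongrightarrow> 0"
    using initial_entry by blast
  obtain \<tau> where "at_scale 1 \<tau>" "(\<lambda>n. yy n (\<tau> n)) \<longlonglongrightarrow> 2" "(\<lambda>n. FF n (\<tau> n)) \<longlonglongrightarrow> 2\<^sup>2 / 2"
    using entry_to_bubble[OF s(1), of 2] s by auto
  then show ?case
    unfolding seq_1[OF q_ge_1 q_less_2] bubble_def by (intro exI[of _ \<tau>]) auto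
next
  case (Suc k)
  note q = q_ge_1 q_less_2
  let ?a = "a_seq q k" and ?\<eta> = "eta_seq q k"
  obtain \<tau> where b: "bubble ?a ?\<eta> \<tau>" using Suc by blast
  obtain s where s: "at_scale (?\<eta> * gap_root q ?a) s"
    "(\<lambda>n. yy n (s n)) \<longlonglongrightarrow> (2 + ?a) * gap_root q ?a powr (1 / q)"
    "(\<lambda>n. FF n (s n)) \<longlonglongrightarrow> 0" "(\<lambda>n. ln (FF n (s n)) / NN n) \<longlonglongrightarrow> 0"
    using next_entry[OF b] by blast
  have \<eta>: "?\<eta> * gap_root q ?a = eta_seq q (Suc k)"
    using eta_seq_Suc[OF q Suc(1)] by simp
  have y: "(2 + ?a) * gap_root q ?a powr (1 / q) = 2 - a_seq q (Suc k)"
    using a_seq_Suc[OF q Suc(1)] by simp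
  have k: "Suc k \<ge> 1" by simp
  note aS = a_seq_bounds[OF q k] eta_seq_pos[OF q k]
  obtain \<tau>' where "at_scale (eta_seq q (Suc k)) \<tau>'" "(\<lambda>n. yy n (\<tau>' n)) \<longlonglongrightarrow> 2"
    "(\<lambda>n. FF n (\<tau>' n)) \<longlonglongrightarrow> (a_seq q (Suc k))\<^sup>2 / 2"
    using entry_to_bubble[OF s(1)[unfolded \<eta>] aS(3,1,2) s(2)[unfolded y] s(3,4)] by blast
  then show ?case using aS by (auto simp: bubble_def)
qed

end

section \<open>The profiles in logarithmic coordinates\<close>

text \<open>The primitive of \<open>slope\<close> that vanishes at 0. As u_s = - y / g'(u), the
  rescaled solution is close to minus this function, which \<open>zprof_eq\<close> identifies with
  the profile.\<close>

definition prim :: "real \<Rightarrow> real \<Rightarrow> real" where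
  "prim a \<sigma> = 2 * \<sigma> + 2 * ln (cosh (a * \<sigma> / 2))"

lemma prim_deriv: "(prim a has_real_derivative slope a \<sigma>) (at \<sigma>)"
proof -
  have "((\<lambda>\<sigma>. a * \<sigma> / 2) has_real_derivative a / 2) (at \<sigma>)"
    by (auto intro!: derivative_eq_intros)
  from DERIV_chain2[where f = cosh, OF has_field_derivative_cosh[OF DERIV_ident] this]
  have c: "((\<lambda>\<sigma>. cosh (a * \<sigma> / 2)) has_real_derivative sinh (a * \<sigma> / 2) * (a / 2)) (at \<sigma>)"
    by simp
  have "((\<lambda>\<sigma>. ln (cosh (a * \<sigma> / 2))) has_real_derivative
      1 / cosh (a * \<sigma> / 2) * (sinh (a * \<sigma> / 2) * (a / 2))) (at \<sigma>)"
    by (rule DERIV_chain2[where f = ln, OF DERIV_ln_divide c]) (rule cosh_real_pos)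
  from DERIV_add[OF DERIV_cmult_Id[of 2] DERIV_cmult[OF this, of 2]]
  show ?thesis unfolding prim_def[abs_def] slope_def by (simp add: tanh_def mult.commute)
qed

lemma prim_0 [simp]: "prim a 0 = 0"
  by (simp add: prim_def)

context
  fixes a \<sigma> x E :: real
  assumes a: "0 < a" and x: "x = a / sqrt 2 * exp \<sigma>" and E: "E = exp (a * \<sigma>)"
begin

lemma profile_x_pos: "x > 0"
  using a x by simp

lemma profile_E_pos: "E > 0"
  using E by simp

text \<open>The scaling x = (a / sqrt 2) exp sigma comes from the normalization of gamma: at the
  centre of the bubble lambda r^2 h f' tends to a^2/2, so r/gamma tends to a / sqrt 2. The constant
  b is the one that makes b x^a the pure exponential exp (a sigma).\<close>

lemma profile_power: "b_of a * x powr a = E"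
proof -
  have "b_of a * x powr a = (sqrt 2 / a * x) powr a"
    unfolding b_of_def using a profile_x_pos by (subst powr_mult) auto
  also have "sqrt 2 / a * x = exp \<sigma>" using a by (simp add: x field_simps)
  finally show ?thesis by (simp add: E powr_def mult.commute)
qed

lemma tanh_half: "tanh (a * \<sigma> / 2) = (E - 1) / (E + 1)"
proof -
  have "tanh (a * \<sigma> / 2) = (1 - exp (- (a * \<sigma>))) / (1 + exp (- (a * \<sigma>)))"
    using tanh_real_altdef[of "a * \<sigma> / 2"] by simp
  also have "exp (- (a * \<sigma>)) = 1 / E" by (simp add: E exp_minus inverse_eq_divide)
  also have "(1 - 1 / E) / (1 + 1 / E) = (E * (1 - 1 / E)) / (E * (1 + 1 / E))"
    using profile_E_pos by simp
  also have "E * (1 - 1 / E) = E - 1"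
    using profile_E_pos by (simp add: right_diff_distrib)
  also have "E * (1 + 1 / E) = E + 1"
    using profile_E_pos by (simp add: distrib_left)
  finally show ?thesis .
qed

lemma zprof_eq: "zprof a x = - prim a \<sigma>"
proof -
  have xp: "x > 0" by (rule profile_x_pos)
  have b: "b_of a > 0" using a by (simp add: b_of_def)
  have lnx: "ln x = ln a - ln (sqrt 2) + \<sigma>"
    using a by (simp add: x ln_mult ln_div)
  have lnb: "ln (b_of a) = a * (ln (sqrt 2) - ln a)"
    using a by (simp add: b_of_def ln_powr ln_div)
  have s2: "2 * ln (sqrt 2) = ln 2" by (simp add: ln_sqrt)
  have c: "ln (cosh (a * \<sigma> / 2)) = ln (1 + E) - a * \<sigma> / 2 - ln 2"
  proof -
    have "exp (a * \<sigma> / 2) * exp (a * \<sigma> / 2) = E" by (simp add: E flip: exp_add)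
    then have "cosh (a * \<sigma> / 2) = (1 + E) / (2 * exp (a * \<sigma> / 2))"
      by (simp add: cosh_def exp_minus field_simps)
    moreover have "1 + E > 0" using profile_E_pos by simp
    ultimately show ?thesis by (simp add: ln_div ln_mult)
  qed
  have "zprof a x = ln (2 * a\<^sup>2 * b_of a) - (2 - a) * ln x - 2 * ln (1 + E)"
    unfolding zprof_def profile_power by simp
  also have "ln (2 * a\<^sup>2 * b_of a) = ln 2 + 2 * ln a + ln (b_of a)"
    using a b by (simp add: ln_mult ln_realpow power2_eq_square)
  finally have "zprof a x = ln 2 + 2 * ln (sqrt 2) - (2 - a) * \<sigma> - 2 * ln (1 + E)"
    unfolding lnx lnb by (simp add: algebra_simps)
  then show ?thesis unfolding s2 prim_def c by (simp add: algebra_simps)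
qed

lemma slope_eq: "slope a \<sigma> = 2 - a + 2 * a * E / (1 + E)"
  unfolding slope_def tanh_half using profile_E_pos by (simp add: field_simps)

lemma force_eq: "force a \<sigma> = 2 * a\<^sup>2 * E / (1 + E)\<^sup>2"
proof -
  have "1 - ((E - 1) / (E + 1))\<^sup>2 = ((E + 1)\<^sup>2 - (E - 1)\<^sup>2) / (E + 1)\<^sup>2"
    unfolding power_divide diff_divide_distrib[of "(E + 1)\<^sup>2"] using profile_E_pos by simp
  also have "(E + 1)\<^sup>2 - (E - 1)\<^sup>2 = 4 * E" by (simp add: power2_eq_square algebra_simps)
  finally have "1 - ((E - 1) / (E + 1))\<^sup>2 = 4 * E / (1 + E)\<^sup>2" by (simp add: add.commute)
  then show ?thesis unfolding force_def tanh_half by simp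
qed

lemma zprof1_eq: "zprof1 a x = - slope a \<sigma> / x"
proof -
  have xp: "x > 0" by (rule profile_x_pos)
  have "2 * a * b_of a * x powr (a - 1) = 2 * a * (b_of a * x powr a) / x"
    using xp by (simp add: powr_diff)
  then have "2 * a * b_of a * x powr (a - 1) = 2 * a * E / x" unfolding profile_power .
  then have "zprof1 a x = - (2 - a) / x - 2 * a * E / x / (1 + E)"
    unfolding zprof1_def profile_power by simp
  also have "2 * a * E / x / (1 + E) = (2 * a * E / (1 + E)) / x" by (simp add: mult.commute)
  also have "- (2 - a) / x - (2 * a * E / (1 + E)) / x = - (2 - a + 2 * a * E / (1 + E)) / x"
    by (simp only: minus_add_distrib diff_conv_add_uminus add_divide_distrib minus_divide_left)
  finally show ?thesis unfolding slope_eq .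
qed

lemma zprof2_eq: "zprof2 a x = (slope a \<sigma> - force a \<sigma>) / x\<^sup>2"
proof -
  have xp: "x > 0" by (rule profile_x_pos)
  have "2 * a * b_of a * (if a = 2 then 1 else x powr (a - 2)) = 2 * a * (b_of a * x powr a) / x\<^sup>2"
    using xp by (simp add: powr_diff powr_numeral)
  then have "2 * a * b_of a * (if a = 2 then 1 else x powr (a - 2)) = 2 * a * E / x\<^sup>2"
    unfolding profile_power .
  then have "zprof2 a x = (2 - a) / x\<^sup>2 - 2 * a * E / x\<^sup>2 * (a - 1 - E) / (1 + E)\<^sup>2"
    unfolding zprof2_def profile_power by simp
  also have "\<dots> = (2 - a - 2 * a * E * (a - 1 - E) / (1 + E)\<^sup>2) / x\<^sup>2"
    by (simp add: diff_divide_distrib)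
  also have "2 - a - 2 * a * E * (a - 1 - E) / (1 + E)\<^sup>2 = slope a \<sigma> - force a \<sigma>"
  proof -
    have "2 * a * E / (1 + E) = 2 * a * E * (1 + E) / (1 + E)\<^sup>2"
      using profile_E_pos by (simp add: power2_eq_square)
    then show ?thesis unfolding slope_eq force_eq
      by (simp add: diff_divide_distrib[symmetric] add_divide_distrib[symmetric] algebra_simps power2_eq_square)
  qed
  finally show ?thesis .
qed

end

lemma scaled_error:
  fixes \<rho> A B :: real
  assumes "\<bar>\<rho> - 1\<bar> \<le> \<delta>" "\<bar>A - B\<bar> \<le> \<delta>" "\<bar>B\<bar> \<le> K" "\<delta> \<le> 1"
  shows "\<bar>\<rho> * A - B\<bar> \<le> (2 + K) * \<delta>"
proof -
  have "\<bar>\<rho>\<bar> \<le> 2" using assms by linarith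
  then have "\<bar>\<rho>\<bar> * \<bar>A - B\<bar> \<le> 2 * \<delta>" using assms by (intro mult_mono) auto
  moreover have "\<bar>\<rho> - 1\<bar> * \<bar>B\<bar> \<le> \<delta> * K" using assms by (intro mult_mono) auto
  moreover have "\<rho> * A - B = \<rho> * (A - B) + (\<rho> - 1) * B" by (simp add: algebra_simps)
  then have "\<bar>\<rho> * A - B\<bar> \<le> \<bar>\<rho>\<bar> * \<bar>A - B\<bar> + \<bar>\<rho> - 1\<bar> * \<bar>B\<bar>"
    using abs_triangle_ineq[of "\<rho> * (A - B)" "(\<rho> - 1) * B"] by (simp add: abs_mult)
  ultimately show ?thesis by (simp add: algebra_simps)
qed

lemma abs_exp_minus_one_le:
  fixes x :: real
  assumes "\<bar>x\<bar> \<le> 1"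
  shows "\<bar>exp x - 1\<bar> \<le> 2 * \<bar>x\<bar>"
proof (cases "x \<ge> 0")
  case True
  have "exp x \<le> 1 + x + x\<^sup>2" using exp_bound[of x] True assms by auto
  moreover have "x\<^sup>2 \<le> x" using True assms mult_left_le[of x x] by (simp add: power2_eq_square)
  moreover have "1 + x \<le> exp x" by (rule exp_ge_add_one_self)
  ultimately show ?thesis using True by simp
next
  case False
  have "1 + x \<le> exp x" by (rule exp_ge_add_one_self)
  moreover have "exp x < 1" using False by simp
  ultimately show ?thesis using False by linarith
qed

context radial_family
begin

section \<open>Values of u at a given level, and integrals as differences of the flux\<close>

lemma f1_eq:
  assumes "t > t0"
  shows "f1 t = f t * g1 t"
proof -
  have "t \<in> interior {0..}" using assms t0_nonneg by simp
  then have "(f has_real_derivative f1 t) (at t)"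
    using f_deriv[of t] assms t0_nonneg at_within_interior[of t "{0..}"] by simp
  moreover have "(f has_real_derivative f t * g1 t) (at t)"
  proof (rule DERIV_cong[OF has_field_derivative_transform_within_open[where f = "\<lambda>t. exp (g t)"]])
    show "((\<lambda>t. exp (g t)) has_real_derivative exp (g t) * g1 t) (at t)"
      by (auto intro!: derivative_eq_intros g_DERIV assms)
    show "open {t0<..}" by simp
  qed (use assms f_exp in auto)
  ultimately show ?thesis by (rule DERIV_unique)
qed

text \<open>The analogue of \<open>at_scale\<close> for values of u instead of times. It also covers
  r = 0, the left end of the first bubble, which has no logarithmic time.\<close>

definition good :: "real \<Rightarrow> (nat \<Rightarrow> real) \<Rightarrow> bool" where
  "good \<eta> v \<longleftrightarrow> 0 < \<eta> \<and> eventually (\<lambda>n. t0 < v n) sequentially \<and> (\<lambda>n. g (v n) / NN n) \<longlonglongrightarrow> \<eta>"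

lemma at_scale_good: "at_scale \<eta> \<tau> \<Longrightarrow> 0 < \<eta> \<Longrightarrow> good \<eta> (\<lambda>n. UU n (\<tau> n))"
  by (auto simp: at_scale_def good_def GG_def elim: eventually_mono)

lemma good_mu: "good 1 mu"
proof -
  have "eventually (\<lambda>n. g (mu n) / NN n = 1) sequentially"
    using eventually_NN[of 0] by eventually_elim (simp add: NN_def)
  moreover have "eventually (\<lambda>n. t0 < mu n) sequentially"
    using mu_top by (simp add: filterlim_at_top_dense)
  ultimately show ?thesis by (simp add: good_def tendsto_eventually)
qed

lemma good_cong:
  assumes "good \<eta> v" "eventually (\<lambda>n. v n = w n) sequentially"
  shows "good \<eta> w"
proof -
  have "eventually (\<lambda>n. t0 < v n) sequentially" "(\<lambda>n. g (v n) / NN n) \<longlonglongrightarrow> \<eta>" "0 < \<eta>"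
    using assms(1) by (auto simp: good_def)
  moreover have "eventually (\<lambda>n. t0 < w n) sequentially"
    using calculation(1) assms(2) by eventually_elim simp
  moreover have "(\<lambda>n. g (w n) / NN n) \<longlonglongrightarrow> \<eta>"
    by (rule Lim_transform_eventually[OF calculation(2)]) (use assms(2) in eventually_elim, simp)
  ultimately show ?thesis by (simp add: good_def)
qed

context
  fixes \<eta> v
  assumes good: "good \<eta> v"
begin

lemma good_hyps: "eventually (\<lambda>n. v n \<ge> t0) sequentially" "(\<lambda>n. g (v n) / g (mu n)) \<longlonglongrightarrow> \<eta>" "\<eta> > 0"
  using good by (auto simp: good_def NN_def elim: eventually_mono)

lemma good_g1: "(\<lambda>n. g1 (v n) / g1 (mu n)) \<longlonglongrightarrow> \<eta> powr (1 / q)"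
  by (rule g1_ratio_tendsto[OF good_hyps(1) mu_top good_hyps(2,3)])

lemma good_ratio: "(\<lambda>n. v n / mu n) \<longlonglongrightarrow> (if q = 1 then 1 else \<eta> powr (1 / p_of q))"
  by (rule argument_ratio_tendsto[OF good_hyps(1) mu_top good_hyps(2,3) q_less_2])

lemma good_expansion:
  assumes "q = 1"
  shows "\<exists>e. e \<longlonglongrightarrow> 0 \<and>
    eventually (\<lambda>n. v n = mu n - (ln (1 / \<eta>) + e n) * g (mu n) / g1 (mu n)) sequentially"
proof -
  let ?e = "\<lambda>n. (mu n - v n) * g1 (mu n) / g (mu n) - ln (1 / \<eta>)"
  have "(\<lambda>n. (mu n - v n) * g1 (mu n) / g (mu n)) \<longlonglongrightarrow> log_q q \<eta>"
    by (rule log_q_tendsto[OF good_hyps(1) mu_top good_hyps(2,3)])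
  then have "(\<lambda>n. (mu n - v n) * g1 (mu n) / g (mu n)) \<longlonglongrightarrow> ln (1 / \<eta>)"
    using assms good_hyps(3) by (simp add: log_q_def ln_div)
  then have "?e \<longlonglongrightarrow> ln (1 / \<eta>) - ln (1 / \<eta>)" by (intro tendsto_intros)
  moreover have "eventually (\<lambda>n. v n = mu n - (ln (1 / \<eta>) + ?e n) * g (mu n) / g1 (mu n)) sequentially"
    using eventually_NN[of 0] good_mu[unfolded good_def, THEN conjunct2, THEN conjunct1]
  proof eventually_elim
    case (elim n)
    then show ?case using g1_pos[of "mu n"] by (simp add: NN_def field_simps)
  qed
  ultimately show ?thesis by (intro exI[of _ ?e]) simp
qed

end

lemma good_g1_ratio:
  assumes v: "good \<eta> v" and w: "good \<eta> w"
  shows "(\<lambda>n. g1 (v n) / g1 (w n)) \<longlonglongrightarrow> 1"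
proof -
  have "\<eta> powr (1 / q) \<noteq> 0" using v by (simp add: good_def)
  then have "(\<lambda>n. (g1 (v n) / g1 (mu n)) / (g1 (w n) / g1 (mu n))) \<longlonglongrightarrow> 1"
    using tendsto_divide[OF good_g1[OF v] good_g1[OF w]] by simp
  moreover have "eventually (\<lambda>n. (g1 (v n) / g1 (mu n)) / (g1 (w n) / g1 (mu n)) = g1 (v n) / g1 (w n)) sequentially"
    using good_hyps(1)[OF good_mu] by eventually_elim (use g1_pos in force)
  ultimately show ?thesis by (rule Lim_transform_eventually)
qed

text \<open>The flux, whose derivative in r is lambda h f(u) r. It is \<open>MM\<close> as a
  function of r, hence also available at r = 0.\<close>

definition mass :: "nat \<Rightarrow> real \<Rightarrow> real" where "mass n r = - r * u1 n r"

lemma mass_exp: "mass n (exp s) = MM n s"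
  by (simp add: mass_def MM_def)

lemma mass_0 [simp]: "mass n 0 = 0"
  by (simp add: mass_def)

lemma mass_has_integral:
  assumes "0 \<le> \<alpha>" "\<alpha> \<le> \<beta>" "\<beta> < 1"
  shows "((\<lambda>r. lam n * h r * f (u n r) * r) has_integral (mass n \<beta> - mass n \<alpha>)) {\<alpha>..\<beta>}"
proof (rule fundamental_theorem_of_calculus_interior[OF assms(2)])
  show "continuous_on {\<alpha>..\<beta>} (mass n)"
    unfolding mass_def[abs_def] using assms
    by (intro continuous_intros continuous_on_subset[OF continuous_on_u1]) auto
  fix r assume r: "r \<in> {\<alpha><..<\<beta>}"
  then have r1: "0 < r" "r < 1" using assms by auto
  have "(u1 n has_real_derivative u2 n r) (at r)"
    using u1_deriv[of r n] at_within_01[of r] r1 by auto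
  then have "(mass n has_real_derivative (- 1 * u1 n r + - r * u2 n r)) (at r)"
    unfolding mass_def[abs_def] by (auto intro!: derivative_eq_intros)
  moreover have "- 1 * u1 n r + - r * u2 n r = lam n * h r * f (u n r) * r"
  proof -
    have "(- u2 n r - u1 n r / r) * r = lam n * h r * f (u n r) * r" using ode[OF r1] by simp
    then show ?thesis using r1 by (simp add: algebra_simps)
  qed
  ultimately show "(mass n has_vector_derivative lam n * h r * f (u n r) * r) (at r)"
    by (simp add: has_real_derivative_iff_has_vector_derivative)
qed

lemma oint_mass:
  assumes "0 \<le> \<alpha>" "\<alpha> < 1" "0 \<le> \<beta>" "\<beta> < 1"
  shows "oint \<alpha> \<beta> (\<lambda>r. lam n * h r * f (u n r) * r) = mass n \<beta> - mass n \<alpha>"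
  unfolding oint_def
  using mass_has_integral[of \<alpha> \<beta> n] mass_has_integral[of \<beta> \<alpha> n] assms
  by (auto dest!: integral_unique)

text \<open>f' = g' f, and g'(u(r)) is nonincreasing in r because g is convex and u decreases; so on
  the interval it lies between its values at the two ends.\<close>

lemma oint_f1_bounds:
  assumes ab: "0 \<le> \<alpha>" "\<alpha> \<le> \<beta>" "0 < \<beta>" "\<beta> < 1" and \<beta>: "t0 < u n \<beta>"
  shows "g1 (u n \<beta>) * (mass n \<beta> - mass n \<alpha>) \<le> oint \<alpha> \<beta> (\<lambda>r. lam n * h r * f1 (u n r) * r)"
    "oint \<alpha> \<beta> (\<lambda>r. lam n * h r * f1 (u n r) * r) \<le> g1 (u n \<alpha>) * (mass n \<beta> - mass n \<alpha>)"
proof -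
  let ?I = "\<lambda>r. lam n * h r * f (u n r) * r" and ?I1 = "\<lambda>r. lam n * h r * f1 (u n r) * r"
  have mono: "u n y \<le> u n x" if "0 \<le> x" "x \<le> y" "0 < y" "y < 1" for x y
  proof (cases "x = 0")
    case True
    then show ?thesis using UU_le_mu[of "ln y" n] that by (simp add: UU_def u_0)
  next
    case False
    then show ?thesis using UU_antimono[of "ln x" "ln y" n] that by (simp add: UU_def)
  qed
  have u: "t0 < u n r" "u n \<beta> \<le> u n r" "u n r \<le> u n \<alpha>" if r: "r \<in> {\<alpha>..\<beta>}" for r
  proof -
    show "u n \<beta> \<le> u n r" using mono[of r \<beta>] r ab by auto
    then show "t0 < u n r" using \<beta> by simp
    show "u n r \<le> u n \<alpha>" using mono[of \<alpha> r] r ab by (cases "r = 0") auto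
  qed
  have sub: "{\<alpha>..\<beta>} \<subseteq> {0..1}" using ab by auto
  have "u n ` {\<alpha>..\<beta>} \<subseteq> {0..}"
  proof (rule image_subsetI)
    fix r assume "r \<in> {\<alpha>..\<beta>}"
    then show "u n r \<in> {0..}" using u(1)[of r] t0_nonneg by simp
  qed
  then have "continuous_on {\<alpha>..\<beta>} ?I1"
    by (intro continuous_intros continuous_on_subset[OF continuous_on_h sub]
        continuous_on_compose2[OF f1_cont continuous_on_subset[OF continuous_on_u sub]])
  then have I1: "(?I1 has_integral integral {\<alpha>..\<beta>} ?I1) {\<alpha>..\<beta>}"
    by (intro integrable_integral integrable_continuous_real)
  note I = mass_has_integral[OF ab(1,2,4), of n]
  have eq: "?I1 r = g1 (u n r) * ?I r" if "r \<in> {\<alpha>..\<beta>}" for r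
    using f1_eq[OF u(1)[OF that]] by simp
  have nn: "?I r \<ge> 0" if "r \<in> {\<alpha>..\<beta>}" for r
    using lam_pos[of n] h_pos[of r] f_nonneg[of "u n r"] u(1)[OF that] t0_nonneg that ab by simp
  have "g1 (u n \<beta>) * (mass n \<beta> - mass n \<alpha>) \<le> integral {\<alpha>..\<beta>} ?I1"
  proof (rule has_integral_le[OF has_integral_mult_right[OF I] I1])
    fix r assume r: "r \<in> {\<alpha>..\<beta>}"
    have "g1 (u n \<beta>) \<le> g1 (u n r)" using u[OF r] \<beta> by (intro g1_mono) auto
    then show "g1 (u n \<beta>) * ?I r \<le> ?I1 r" unfolding eq[OF r] by (rule mult_right_mono[OF _ nn[OF r]])
  qed
  moreover have "integral {\<alpha>..\<beta>} ?I1 \<le> g1 (u n \<alpha>) * (mass n \<beta> - mass n \<alpha>)"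
  proof (rule has_integral_le[OF I1 has_integral_mult_right[OF I]])
    fix r assume r: "r \<in> {\<alpha>..\<beta>}"
    have "g1 (u n r) \<le> g1 (u n \<alpha>)" using u[OF r] by (intro g1_mono) auto
    then show "?I1 r \<le> g1 (u n \<alpha>) * ?I r" unfolding eq[OF r] by (rule mult_right_mono[OF _ nn[OF r]])
  qed
  ultimately show "g1 (u n \<beta>) * (mass n \<beta> - mass n \<alpha>) \<le> oint \<alpha> \<beta> ?I1"
    "oint \<alpha> \<beta> ?I1 \<le> g1 (u n \<alpha>) * (mass n \<beta> - mass n \<alpha>)"
    using ab by (simp_all add: oint_def)
qed

section \<open>Rescaling around a bubble\<close>

lemma bubble_windowE:
  assumes "bubble a \<eta> \<tau>" "J > 0" "e > 0"
  obtains d where "d > 0" "eventually (\<lambda>n. close_on a \<tau> J e d n) sequentially"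
  using bubble_window[of \<eta> \<tau> a J e] assms unfolding bubble_def by blast

text \<open>The centre of a bubble is determined only up to o(1) in time. This freedom absorbs the
  discrepancy between F at the centre, which fixes gamma, and its limit a^2/2.\<close>

lemma bubble_shift:
  assumes b: "bubble a \<eta> \<tau>" and \<iota>: "\<iota> \<longlonglongrightarrow> 0"
  shows "bubble a \<eta> (\<lambda>n. \<tau> n + \<iota> n)"
proof -
  have ba: "0 < a" "a \<le> 2" "0 < \<eta>" "at_scale \<eta> \<tau>" using b by (auto simp: bubble_def)
  have i1: "eventually (\<lambda>n. \<bar>\<iota> n\<bar> \<le> 1) sequentially"
    using tendstoD[OF \<iota>, of 1] by (auto elim!: eventually_mono)
  have close: "eventually (\<lambda>n. (\<tau> n + \<iota> n < 0 \<and> t0 < UU n (\<tau> n + \<iota> n)) \<and>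
      \<bar>yy n (\<tau> n + \<iota> n) - slope a (\<iota> n)\<bar> \<le> e * 1 \<and> \<bar>FF n (\<tau> n + \<iota> n) - force a (\<iota> n)\<bar> \<le> e * 1 \<and>
      \<bar>GG n (\<tau> n + \<iota> n) - GG n (\<tau> n)\<bar> \<le> e * NN n) sequentially" if e: "e > 0" for e
  proof -
    obtain d where d: "d > 0" "eventually (\<lambda>n. close_on a \<tau> 1 e d n) sequentially"
      by (rule bubble_windowE[OF b zero_less_one e])
    from d(2) i1 show ?thesis by eventually_elim (use domD in auto)
  qed
  have "at_scale \<eta> (\<lambda>n. \<tau> n + \<iota> n)"
  proof (rule at_scale_if_close[OF ba(4)])
    show "eventually (\<lambda>n. \<tau> n + \<iota> n < 0 \<and> t0 < UU n (\<tau> n + \<iota> n)) sequentially"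
      using close[OF zero_less_one] by eventually_elim blast
    show "eventually (\<lambda>n. \<bar>GG n (\<tau> n + \<iota> n) - GG n (\<tau> n)\<bar> \<le> e * NN n) sequentially" if "e > 0" for e
      using close[OF that] by eventually_elim blast
  qed
  moreover have "(\<lambda>n. yy n (\<tau> n + \<iota> n) - slope a (\<iota> n)) \<longlonglongrightarrow> 0"
    "(\<lambda>n. FF n (\<tau> n + \<iota> n) - force a (\<iota> n)) \<longlonglongrightarrow> 0"
    by (rule tendsto_zero_of_linear_bound[where C = 1], erule eventually_mono[OF close], blast)+
  moreover have "(\<lambda>n. slope a (\<iota> n)) \<longlonglongrightarrow> 2"
    using isCont_tendsto_compose[OF DERIV_isCont[OF slope_deriv] \<iota>] by (simp add: slope_def)
  moreover have "isCont (force a) 0"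
    unfolding force_def[abs_def] by (intro continuous_intros) auto
  then have "(\<lambda>n. force a (\<iota> n)) \<longlonglongrightarrow> a\<^sup>2 / 2"
    using isCont_tendsto_compose[OF _ \<iota>, of "force a"] by (simp add: force_def)
  ultimately have "at_scale \<eta> (\<lambda>n. \<tau> n + \<iota> n)" "(\<lambda>n. yy n (\<tau> n + \<iota> n)) \<longlonglongrightarrow> 2"
    "(\<lambda>n. FF n (\<tau> n + \<iota> n)) \<longlonglongrightarrow> a\<^sup>2 / 2"
    using tendsto_add[of "\<lambda>n. yy n (\<tau> n + \<iota> n) - slope a (\<iota> n)" 0 sequentially "\<lambda>n. slope a (\<iota> n)" 2]
      tendsto_add[of "\<lambda>n. FF n (\<tau> n + \<iota> n) - force a (\<iota> n)" 0 sequentially "\<lambda>n. force a (\<iota> n)" "a\<^sup>2 / 2"]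
    by auto
  then show ?thesis using ba by (simp add: bubble_def)
qed

text \<open>y and F contain g'(u) at the running point, while c is constant over the window; the
  quotient of the two tends to 1 uniformly because log g'(u) hardly moves. For constant c the
  derivative of c u is - c times \<open>MM\<close>, and integrating it from the centre gives
  convergence to minus \<open>prim\<close>.\<close>

lemma rescaled_window:
  assumes b: "bubble a \<eta> \<tau>" and J: "J > 0" and e: "e > 0"
    and c: "(\<lambda>n. c n / g1 (UU n (\<tau> n))) \<longlonglongrightarrow> 1"
    and v: "(\<lambda>n. c n * (UU n (\<tau> n) - v n)) \<longlonglongrightarrow> 0"
  shows "eventually (\<lambda>n. \<forall>\<sigma>. \<bar>\<sigma>\<bar> \<le> J \<longrightarrow> \<tau> n + \<sigma> < 0 \<and> t0 < UU n (\<tau> n + \<sigma>) \<and>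
    \<bar>GG n (\<tau> n + \<sigma>) / NN n - \<eta>\<bar> \<le> e \<and> exp (\<tau> n + \<sigma>) \<le> e \<and>
    \<bar>yy n (\<tau> n + \<sigma>) - slope a \<sigma>\<bar> \<le> e \<and> \<bar>FF n (\<tau> n + \<sigma>) - force a \<sigma>\<bar> \<le> e \<and>
    \<bar>c n * MM n (\<tau> n + \<sigma>) - slope a \<sigma>\<bar> \<le> e \<and> \<bar>c n * PP n (\<tau> n + \<sigma>) - force a \<sigma>\<bar> \<le> e \<and>
    \<bar>c n * (UU n (\<tau> n + \<sigma>) - v n) + prim a \<sigma>\<bar> \<le> e) sequentially"
proof -
  have ba: "0 < a" "a \<le> 2" "0 < \<eta>" "at_scale \<eta> \<tau>" using b by (auto simp: bubble_def)
  \<comment> \<open>The quotient c/g'(u) is within 4 delta of 1 and the limits are bounded by 4, so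
    \<open>scaled_error\<close> gives 6 times 4 delta = 24 delta, and integration over the window 24
    delta J. The denominator 200 leaves room for both.\<close>
  define \<delta> where "\<delta> = min (1 / 16) (e / (200 * (1 + J)))"
  have "\<delta> > 0" using e J by (simp add: \<delta>_def)
  moreover have "\<delta> \<le> 1 / 16" unfolding \<delta>_def by (rule min.cobounded1)
  moreover have "\<delta> \<le> e / (200 * (1 + J))" unfolding \<delta>_def by (rule min.cobounded2)
  ultimately have \<delta>: "\<delta> > 0" "\<delta> \<le> 1 / 16" "\<delta> \<le> e / (200 * (1 + J))" .
  have "200 * \<delta> * (1 + J) \<le> e" using \<delta>(3) J by (simp add: field_simps)
  moreover have "\<delta> * J \<ge> 0" using \<delta> J by simp
  ultimately have \<delta>e: "200 * \<delta> \<le> e" "200 * (\<delta> * J) \<le> e" using \<delta>(1) by (simp_all add: algebra_simps)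
  obtain d where d: "d > 0" "eventually (\<lambda>n. close_on a \<tau> J \<delta> d n) sequentially"
    by (rule bubble_windowE[OF b J \<delta>(1)])
  have c1: "eventually (\<lambda>n. \<bar>c n / g1 (UU n (\<tau> n)) - 1\<bar> < \<delta>) sequentially"
    using tendstoD[OF c \<delta>(1)] by (simp add: dist_real_def)
  have v1: "eventually (\<lambda>n. \<bar>c n * (UU n (\<tau> n) - v n)\<bar> < \<delta>) sequentially"
    using tendstoD[OF v \<delta>(1)] by (simp add: dist_real_def)
  have G1: "eventually (\<lambda>n. \<bar>GG n (\<tau> n) / NN n - \<eta>\<bar> < \<delta>) sequentially"
    using ba(4) tendstoD[of "\<lambda>n. GG n (\<tau> n) / NN n" \<eta> sequentially \<delta>] \<delta>(1)
    by (simp add: at_scale_def dist_real_def)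
  have sm: "eventually (\<lambda>n. NN n > 0 \<and> (\<forall>s. dom (min d (1/2)) n s \<longrightarrow> exp s \<le> 1 / NN n)) sequentially"
  proof -
    have m: "0 < min d (1/2)" "min d (1/2) < 1" using d(1) by (simp, linarith)
    obtain C where "C > 0" "eventually (\<lambda>n. slow_bounds (min d (1/2)) C n) sequentially"
      using dom_slow[OF m] by blast
    from this(2) show ?thesis by eventually_elim auto
  qed
  show ?thesis
    using d(2) c1 v1 G1 sm eventually_NN[of "1 / e"]
  proof eventually_elim
    case (elim n)
    let ?t = "\<tau> n"
    have N: "NN n > 0" using elim by auto
    have w: "dom d n (?t + \<sigma>)" "\<bar>yy n (?t + \<sigma>) - slope a \<sigma>\<bar> \<le> \<delta>" "\<bar>FF n (?t + \<sigma>) - force a \<sigma>\<bar> \<le> \<delta>"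
      "\<bar>GG n (?t + \<sigma>) - GG n ?t\<bar> \<le> \<delta> * NN n"
      "\<bar>ln (g1 (UU n (?t + \<sigma>))) - ln (g1 (UU n ?t))\<bar> \<le> \<delta>" if "\<bar>\<sigma>\<bar> \<le> J" for \<sigma>
      using elim(1) that by blast+
    have D0: "?t < 0" "t0 < UU n ?t" using domD[OF w(1)[of 0]] J by auto
    define \<rho> where "\<rho> \<sigma> = c n / g1 (UU n (?t + \<sigma>))" for \<sigma>
    have \<rho>: "\<bar>\<rho> \<sigma> - 1\<bar> \<le> 4 * \<delta>" if "\<bar>\<sigma>\<bar> \<le> J" for \<sigma>
    proof -
      note D = domD[OF w(1)[OF that]]
      have p: "g1 (UU n ?t) > 0" "g1 (UU n (?t + \<sigma>)) > 0" using g1_UU_pos D D0 by auto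
      define \<xi> where "\<xi> = ln (g1 (UU n ?t)) - ln (g1 (UU n (?t + \<sigma>)))"
      have x: "\<bar>\<xi>\<bar> \<le> \<delta>" using w(5)[OF that] by (simp add: \<xi>_def abs_minus_commute)
      have "exp \<xi> = g1 (UU n ?t) / g1 (UU n (?t + \<sigma>))" using p by (simp add: \<xi>_def exp_diff)
      then have eq: "\<rho> \<sigma> = (c n / g1 (UU n ?t)) * exp \<xi>" using p by (simp add: \<rho>_def)
      let ?A = "c n / g1 (UU n ?t)"
      have "\<bar>\<xi>\<bar> \<le> 1" using x \<delta>(2) by linarith
      from abs_exp_minus_one_le[OF this] have ex: "\<bar>exp \<xi> - 1\<bar> \<le> 2 * \<delta>" using x by linarith
      then have "\<bar>exp \<xi>\<bar> \<le> 2" using \<delta>(2) by linarith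
      then have "\<bar>(?A - 1) * exp \<xi>\<bar> \<le> \<delta> * 2"
        unfolding abs_mult using elim(2) \<delta>(1) by (intro mult_mono) auto
      moreover have "\<rho> \<sigma> - 1 = (?A - 1) * exp \<xi> + (exp \<xi> - 1)"
        unfolding eq by (simp add: algebra_simps)
      ultimately show ?thesis using ex by linarith
    qed
    have M: "\<bar>c n * MM n (?t + \<sigma>) - slope a \<sigma>\<bar> \<le> 24 * \<delta>"
      and P: "\<bar>c n * PP n (?t + \<sigma>) - force a \<sigma>\<bar> \<le> 24 * \<delta>" if \<sigma>: "\<bar>\<sigma>\<bar> \<le> J" for \<sigma>
    proof -
      have p: "g1 (UU n (?t + \<sigma>)) > 0" using g1_UU_pos domD[OF w(1)[OF \<sigma>]] by auto
      have "c n * MM n (?t + \<sigma>) = \<rho> \<sigma> * yy n (?t + \<sigma>)" "c n * PP n (?t + \<sigma>) = \<rho> \<sigma> * FF n (?t + \<sigma>)"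
        using p by (simp_all add: \<rho>_def yy_def FF_def)
      moreover have "\<bar>slope a \<sigma>\<bar> \<le> 4" using slope_abs_le[OF ba(1,2), of \<sigma>] by linarith
      moreover have "\<bar>force a \<sigma>\<bar> \<le> 4"
      proof -
        have "a\<^sup>2 \<le> 4" using power_mono[of a 2 2] ba by simp
        then show ?thesis using force_pos[OF ba(1), of \<sigma>] slope_force[of a \<sigma>]
            zero_le_power2[of "slope a \<sigma> - 2"] by linarith
      qed
      ultimately show "\<bar>c n * MM n (?t + \<sigma>) - slope a \<sigma>\<bar> \<le> 24 * \<delta>"
        "\<bar>c n * PP n (?t + \<sigma>) - force a \<sigma>\<bar> \<le> 24 * \<delta>"
        using scaled_error[of "\<rho> \<sigma>" "4 * \<delta>" "yy n (?t + \<sigma>)" "slope a \<sigma>" 4]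
          scaled_error[of "\<rho> \<sigma>" "4 * \<delta>" "FF n (?t + \<sigma>)" "force a \<sigma>" 4] \<rho>[OF \<sigma>] w(2,3)[OF \<sigma>] \<delta> by auto
    qed
    have Ui: "\<bar>(c n * UU n (?t + x) + prim a x) - (c n * UU n (?t + y) + prim a y)\<bar> \<le> 24 * \<delta> * (x - y)"
      if "y \<le> x" "\<bar>y\<bar> \<le> J" "\<bar>x\<bar> \<le> J" for x y
    proof (rule increment_bound[OF that(1), where \<phi> = "\<lambda>x. c n * UU n (?t + x) + prim a x"])
      fix \<sigma> assume "y \<le> \<sigma>" "\<sigma> \<le> x"
      then have \<sigma>: "\<bar>\<sigma>\<bar> \<le> J" using that by auto
      have "((\<lambda>\<sigma>. UU n (?t + \<sigma>)) has_real_derivative - MM n (?t + \<sigma>)) (at \<sigma>)"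
        using UU_deriv[OF domD(1)[OF w(1)[OF \<sigma>]], of n] DERIV_shift[of "UU n" _ \<sigma> ?t] by (simp add: add.commute)
      then show "((\<lambda>x. c n * UU n (?t + x) + prim a x) has_real_derivative
          c n * - MM n (?t + \<sigma>) + slope a \<sigma>) (at \<sigma>)"
        by (intro DERIV_add DERIV_cmult prim_deriv)
      show "\<bar>c n * - MM n (?t + \<sigma>) + slope a \<sigma>\<bar> \<le> 24 * \<delta>" using M[OF \<sigma>] by (simp add: abs_minus_commute)
    qed
    show ?case
    proof (intro allI impI conjI)
      fix \<sigma> assume \<sigma>: "\<bar>\<sigma>\<bar> \<le> J"
      note D = domD[OF w(1)[OF \<sigma>]]
      show "?t + \<sigma> < 0" "t0 < UU n (?t + \<sigma>)" using D by auto
      have "dom (min d (1/2)) n (?t + \<sigma>)" using N by (intro dom_weaken[OF w(1)[OF \<sigma>]]) auto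
      then have "exp (?t + \<sigma>) \<le> 1 / NN n" using elim(5) by blast
      also have "\<dots> \<le> e" using elim(6) N e by (simp add: field_simps)
      finally show "exp (?t + \<sigma>) \<le> e" .
      have "\<bar>GG n (?t + \<sigma>) / NN n - GG n ?t / NN n\<bar> = \<bar>GG n (?t + \<sigma>) - GG n ?t\<bar> / NN n"
        using N by (simp add: diff_divide_distrib[symmetric])
      also have "\<dots> \<le> \<delta>" using w(4)[OF \<sigma>] N by (simp add: pos_divide_le_eq)
      finally show "\<bar>GG n (?t + \<sigma>) / NN n - \<eta>\<bar> \<le> e" using elim(4) \<delta>e \<delta>(1) by linarith
      show "\<bar>yy n (?t + \<sigma>) - slope a \<sigma>\<bar> \<le> e" "\<bar>FF n (?t + \<sigma>) - force a \<sigma>\<bar> \<le> e"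
        "\<bar>c n * MM n (?t + \<sigma>) - slope a \<sigma>\<bar> \<le> e" "\<bar>c n * PP n (?t + \<sigma>) - force a \<sigma>\<bar> \<le> e"
        using w(2,3)[OF \<sigma>] M[OF \<sigma>] P[OF \<sigma>] \<delta>e \<delta>(1) by linarith+
      have "\<bar>(c n * UU n (?t + \<sigma>) + prim a \<sigma>) - c n * UU n ?t\<bar> \<le> 24 * \<delta> * \<bar>\<sigma>\<bar>"
        using Ui[of 0 \<sigma>] Ui[of \<sigma> 0] \<sigma> J by (cases "\<sigma> \<ge> 0") (auto simp: abs_minus_commute)
      also have "\<dots> \<le> 24 * \<delta> * J" using \<sigma> \<delta> by (intro mult_left_mono) auto
      finally have "\<bar>(c n * UU n (?t + \<sigma>) + prim a \<sigma>) - c n * UU n ?t\<bar> \<le> 24 * \<delta> * J" .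
      moreover have "\<bar>c n * UU n ?t - c n * v n\<bar> < \<delta>" using elim(3) by (simp add: right_diff_distrib)
      ultimately show "\<bar>c n * (UU n (?t + \<sigma>) - v n) + prim a \<sigma>\<bar> \<le> e"
        unfolding right_diff_distrib using \<delta>e \<delta>(1) by linarith
    qed
  qed
qed

end

section \<open>C^2 convergence, for the first profile up to the origin\<close>

lemma profile_2:
  assumes "0 \<le> x"
  shows zprof_2: "zprof 2 x = ln 4 - 2 * ln (1 + x\<^sup>2 / 2)"
    and zprof1_2: "zprof1 2 x = - 2 * x / (1 + x\<^sup>2 / 2)"
    and zprof2_2: "zprof2 2 x = - 2 * (1 - x\<^sup>2 / 2) / (1 + x\<^sup>2 / 2)\<^sup>2"
proof -
  have b: "b_of 2 = 1 / 2"
    by (simp add: b_of_def powr_numeral power_divide)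
  have x2: "x powr 2 = x\<^sup>2" using assms by (cases "x = 0") (auto simp: powr_numeral)
  show "zprof 2 x = ln 4 - 2 * ln (1 + x\<^sup>2 / 2)"
    by (simp add: zprof_def b x2)
  have "x powr 1 = x" using assms by simp
  then show "zprof1 2 x = - 2 * x / (1 + x\<^sup>2 / 2)"
    by (simp add: zprof1_def b x2)
  have "zprof2 2 x = - ((2 - x\<^sup>2) / (1 + x\<^sup>2 / 2)\<^sup>2)"
    by (simp add: zprof2_def b x2)
  also have "\<dots> = - (2 - x\<^sup>2) / (1 + x\<^sup>2 / 2)\<^sup>2" by (rule minus_divide_left)
  also have "- (2 - x\<^sup>2) = - 2 * (1 - x\<^sup>2 / 2)" by simp
  finally show "zprof2 2 x = - 2 * (1 - x\<^sup>2 / 2) / (1 + x\<^sup>2 / 2)\<^sup>2" .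
qed

lemma profile_2_near_0:
  assumes x: "0 \<le> x" "x \<le> d" "d \<le> 1"
  shows "\<bar>zprof 2 x - zprof 2 d\<bar> \<le> d" "\<bar>zprof1 2 x\<bar> \<le> 2 * d" "\<bar>zprof2 2 x + 2\<bar> \<le> 3 * d"
proof -
  have d: "0 \<le> d" using x by simp
  have x2: "x\<^sup>2 \<le> d\<^sup>2" using x by (intro power_mono) auto
  have d2: "d\<^sup>2 \<le> d" using x d mult_left_le[of d d] by (simp add: power2_eq_square)
  have "0 \<le> ln (1 + x\<^sup>2 / 2)" by simp
  moreover have "ln (1 + x\<^sup>2 / 2) \<le> ln (1 + d\<^sup>2 / 2)"
    using x2 by (subst ln_le_cancel_iff) (auto simp: add_pos_nonneg)
  moreover have "ln (1 + d\<^sup>2 / 2) \<le> d\<^sup>2 / 2" by (rule ln_add_one_self_le_self) simp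
  ultimately show "\<bar>zprof 2 x - zprof 2 d\<bar> \<le> d"
    unfolding zprof_2[OF x(1)] zprof_2[OF d] using d2 by linarith
  have "2 * x / (1 + x\<^sup>2 / 2) \<le> 2 * x / 1" using x by (intro divide_left_mono) (auto simp: add_pos_nonneg)
  then show "\<bar>zprof1 2 x\<bar> \<le> 2 * d" unfolding zprof1_2[OF x(1)] using x by simp
  define w where "w = x\<^sup>2 / 2"
  have w: "0 \<le> w" "2 * w \<le> d" using x2 d2 by (auto simp: w_def)
  have "- 2 * (1 - w) / (1 + w)\<^sup>2 + 2 = (2 * (1 + w)\<^sup>2 - 2 * (1 - w)) / (1 + w)\<^sup>2"
  proof -
    have "- 2 * (1 - w) / B + 2 = (2 * B - 2 * (1 - w)) / B" if "B > 0" for B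
      using that by (simp add: field_simps)
    moreover have "(1 + w)\<^sup>2 > 0" using w by simp
    ultimately show ?thesis by blast
  qed
  also have "2 * (1 + w)\<^sup>2 - 2 * (1 - w) = 6 * w + 2 * w\<^sup>2" by (simp add: power2_eq_square algebra_simps)
  finally have eq: "zprof2 2 x + 2 = (6 * w + 2 * w\<^sup>2) / (1 + w)\<^sup>2"
    unfolding zprof2_2[OF x(1)] w_def[symmetric] .
  have "6 * w + 2 * w\<^sup>2 \<le> (6 * w) * (1 + w)\<^sup>2"
  proof -
    have "(6 * w) * (1 + w)\<^sup>2 - (6 * w + 2 * w\<^sup>2) = 10 * w\<^sup>2 + 6 * w ^ 3"
      by (simp add: power2_eq_square power3_eq_cube algebra_simps)
    moreover have "0 \<le> 10 * w\<^sup>2 + 6 * w ^ 3" using w by simp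
    ultimately show ?thesis by linarith
  qed
  then have "(6 * w + 2 * w\<^sup>2) / (1 + w)\<^sup>2 \<le> 6 * w"
    using w by (subst pos_divide_le_eq) (auto simp: zero_less_power)
  moreover have "0 \<le> (6 * w + 2 * w\<^sup>2) / (1 + w)\<^sup>2" using w by simp
  ultimately show "\<bar>zprof2 2 x + 2\<bar> \<le> 3 * d" unfolding eq using w by linarith
qed

context radial_family
begin

definition c2_error :: "real \<Rightarrow> real \<Rightarrow> real \<Rightarrow> real \<Rightarrow> nat \<Rightarrow> real \<Rightarrow> real" where
  "c2_error a \<gamma> c v n x = \<bar>c * (u n (\<gamma> * x) - v) - zprof a x\<bar> +
     \<bar>c * \<gamma> * u1 n (\<gamma> * x) - zprof1 a x\<bar> + \<bar>c * \<gamma>\<^sup>2 * u2 n (\<gamma> * x) - zprof2 a x\<bar>"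

text \<open>The equation gives r^2 u'' = \<open>MM\<close> - \<open>PP\<close>, so C^2 closeness
  reduces to closeness of c u, c \<open>MM\<close> and c \<open>PP\<close>.\<close>

lemma rescaled_derivatives:
  assumes s: "s < 0" and x: "x > 0" and \<gamma>: "\<gamma> * x = exp s"
  shows "c * \<gamma> * u1 n (\<gamma> * x) = - (c * MM n s) / x"
    and "c * \<gamma>\<^sup>2 * u2 n (\<gamma> * x) = (c * MM n s - c * PP n s) / x\<^sup>2"
proof -
  have r: "0 < exp s" "exp s < 1" using s by auto
  have M: "MM n s = - (\<gamma> * x) * u1 n (\<gamma> * x)" by (simp add: MM_def \<gamma>)
  show "c * \<gamma> * u1 n (\<gamma> * x) = - (c * MM n s) / x" unfolding M using x by simp
  have "(- u2 n (exp s) - u1 n (exp s) / exp s) * (exp s)\<^sup>2 = lam n * h (exp s) * f (u n (exp s)) * (exp s)\<^sup>2"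
    using ode[OF r] by simp
  then have "(exp s)\<^sup>2 * u2 n (exp s) = MM n s - PP n s"
    by (simp add: MM_def PP_def UU_def power2_eq_square algebra_simps)
  then have m: "(\<gamma> * x)\<^sup>2 * u2 n (\<gamma> * x) = MM n s - PP n s" by (simp add: \<gamma>)
  have "c * \<gamma>\<^sup>2 * u2 n (\<gamma> * x) * x\<^sup>2 = c * ((\<gamma> * x)\<^sup>2 * u2 n (\<gamma> * x))"
    by (simp add: power_mult_distrib mult_ac)
  then have "c * \<gamma>\<^sup>2 * u2 n (\<gamma> * x) * x\<^sup>2 = c * (MM n s - PP n s)" unfolding m .
  then show "c * \<gamma>\<^sup>2 * u2 n (\<gamma> * x) = (c * MM n s - c * PP n s) / x\<^sup>2"
    using x by (simp add: eq_divide_eq right_diff_distrib)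
qed

context
  fixes a \<eta> :: real and \<tau> \<gamma> c v :: "nat \<Rightarrow> real"
  assumes b: "bubble a \<eta> \<tau>"
    and c: "(\<lambda>n. c n / g1 (UU n (\<tau> n))) \<longlonglongrightarrow> 1"
    and v: "(\<lambda>n. c n * (UU n (\<tau> n) - v n)) \<longlonglongrightarrow> 0"
    and \<gamma>: "eventually (\<lambda>n. \<gamma> n = exp (\<tau> n) * (sqrt 2 / a)) sequentially"
begin

lemma a_bounds: "0 < a" "a \<le> 2"
  using b by (auto simp: bubble_def)

lemma c2_window:
  assumes x0: "0 < x0" "x0 \<le> x1" and e: "e > 0"
  shows "eventually (\<lambda>n. \<gamma> n > 0 \<and> (\<forall>x\<in>{x0..x1}. c2_error a (\<gamma> n) (c n) (v n) n x < e \<and>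
    \<gamma> n * x \<le> e \<and> \<gamma> n * x < 1 \<and> t0 < u n (\<gamma> n * x) \<and> \<bar>g (u n (\<gamma> n * x)) / NN n - \<eta>\<bar> \<le> e \<and>
    \<bar>c n * mass n (\<gamma> n * x) - slope a (ln (x * (sqrt 2 / a)))\<bar> \<le> e)) sequentially"
proof -
  note a = a_bounds
  define k where "k = sqrt 2 / a"
  have k: "k > 0" using a by (simp add: k_def)
  define J where "J = \<bar>ln (x0 * k)\<bar> + \<bar>ln (x1 * k)\<bar> + 1"
  have J: "J > 0" by (simp add: J_def)
  \<comment> \<open>The sum of the factors 1, 1/x and 2/x^2 at x = x0, by which the error of
    \<open>rescaled_window\<close> is multiplied in the function and its two derivatives.\<close>
  define K where "K = 1 + 1 / x0 + 2 / x0\<^sup>2"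
  have K: "K > 1" using x0 by (simp add: K_def add_pos_pos)
  define e1 where "e1 = e / (2 * K)"
  have e1: "e1 > 0" "e1 * K < e" "e1 \<le> e" using e K by (auto simp: e1_def field_simps)
  show ?thesis
    using rescaled_window[OF b J e1(1) c v] \<gamma>
  proof eventually_elim
    case (elim n)
    have "\<gamma> n > 0" using elim(2) k by (simp add: k_def[symmetric])
    moreover have "c2_error a (\<gamma> n) (c n) (v n) n x < e \<and>
      \<gamma> n * x \<le> e \<and> \<gamma> n * x < 1 \<and> t0 < u n (\<gamma> n * x) \<and> \<bar>g (u n (\<gamma> n * x)) / NN n - \<eta>\<bar> \<le> e \<and>
      \<bar>c n * mass n (\<gamma> n * x) - slope a (ln (x * k))\<bar> \<le> e" if x: "x \<in> {x0..x1}" for x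
    proof -
      have xp: "x > 0" using x x0 by auto
      define \<sigma> where "\<sigma> = ln (x * k)"
      have "ln (x0 * k) \<le> \<sigma>" "\<sigma> \<le> ln (x1 * k)"
        unfolding \<sigma>_def using x x0 k xp by (subst ln_le_cancel_iff; auto)+
      then have \<sigma>: "\<bar>\<sigma>\<bar> \<le> J" by (auto simp: J_def)
      have es: "exp \<sigma> = x * k" using xp k by (simp add: \<sigma>_def)
      then have x\<sigma>: "x = a / sqrt 2 * exp \<sigma>" using a by (simp add: k_def)
      have gx: "\<gamma> n * x = exp (\<tau> n + \<sigma>)"
        using elim(2) by (simp add: exp_add es k_def[symmetric])
      from elim(1) \<sigma> have w: "\<tau> n + \<sigma> < 0" "t0 < UU n (\<tau> n + \<sigma>)"
        "\<bar>GG n (\<tau> n + \<sigma>) / NN n - \<eta>\<bar> \<le> e1" "exp (\<tau> n + \<sigma>) \<le> e1"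
        "\<bar>c n * MM n (\<tau> n + \<sigma>) - slope a \<sigma>\<bar> \<le> e1" "\<bar>c n * PP n (\<tau> n + \<sigma>) - force a \<sigma>\<bar> \<le> e1"
        "\<bar>c n * (UU n (\<tau> n + \<sigma>) - v n) + prim a \<sigma>\<bar> \<le> e1" by blast+
      note z = zprof_eq[OF a(1) x\<sigma> refl] zprof1_eq[OF a(1) x\<sigma> refl] zprof2_eq[OF a(1) x\<sigma> refl]
      note dr = rescaled_derivatives[OF w(1) xp gx, of "c n" n]
      have "\<bar>c n * (u n (\<gamma> n * x) - v n) - zprof a x\<bar> \<le> e1"
        using w(7) by (simp add: z(1) gx UU_def)
      moreover have "\<bar>c n * \<gamma> n * u1 n (\<gamma> n * x) - zprof1 a x\<bar> \<le> e1 * (1 / x0)"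
      proof -
        have "c n * \<gamma> n * u1 n (\<gamma> n * x) - zprof1 a x = - (c n * MM n (\<tau> n + \<sigma>) - slope a \<sigma>) / x"
          unfolding dr(1) z(2) by (simp add: diff_divide_distrib)
        also have "\<bar>\<dots>\<bar> = \<bar>c n * MM n (\<tau> n + \<sigma>) - slope a \<sigma>\<bar> / x" using xp by (simp add: abs_divide)
        also have "\<dots> \<le> e1 / x0" using w(5) x x0 e1 by (intro frac_le) auto
        finally show ?thesis by simp
      qed
      moreover have "\<bar>c n * (\<gamma> n)\<^sup>2 * u2 n (\<gamma> n * x) - zprof2 a x\<bar> \<le> e1 * (2 / x0\<^sup>2)"
      proof -
        have "c n * (\<gamma> n)\<^sup>2 * u2 n (\<gamma> n * x) - zprof2 a x =
          ((c n * MM n (\<tau> n + \<sigma>) - slope a \<sigma>) - (c n * PP n (\<tau> n + \<sigma>) - force a \<sigma>)) / x\<^sup>2"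
          unfolding dr(2) z(3) by (simp add: diff_divide_distrib)
        also have "\<bar>\<dots>\<bar> = \<bar>(c n * MM n (\<tau> n + \<sigma>) - slope a \<sigma>) - (c n * PP n (\<tau> n + \<sigma>) - force a \<sigma>)\<bar> / x\<^sup>2"
          using xp by (simp add: abs_divide)
        also have "\<dots> \<le> (2 * e1) / x0\<^sup>2"
          using w(5,6) x x0 e1 by (intro frac_le power_mono) auto
        finally show ?thesis by (simp add: mult.commute)
      qed
      moreover have "e1 * K = e1 + e1 * (1 / x0) + e1 * (2 / x0\<^sup>2)"
        by (simp add: K_def algebra_simps)
      ultimately have "c2_error a (\<gamma> n) (c n) (v n) n x < e"
        unfolding c2_error_def using e1(2) by linarith
      moreover have "exp (\<tau> n + \<sigma>) < 1" using w(1) by simp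
      moreover have "mass n (\<gamma> n * x) = MM n (\<tau> n + \<sigma>)" by (simp add: gx mass_exp)
      ultimately show ?thesis
        using w(2-5) e1(3) by (auto simp: gx UU_def GG_def \<sigma>_def)
    qed
    ultimately show ?case by (simp add: k_def)
  qed
qed

text \<open>A logarithmic window stops at a positive x, so a neighbourhood of the centre is treated
  directly. There h and f(u) are nearly constant: c \<open>PP\<close> is about 4 x^2, c
  \<open>MM\<close> about 2 x^2, and the rescaled second derivative about 2 - 4 = -2, the value of
  z'' at 0. The level eta = 1 places the end of the window in \<open>dom (1/2)\<close>, where
  \<open>near_origin\<close> bounds the drop of g(u) from the centre.\<close>

lemma c2_zero:
  assumes first: "a = 2" "\<eta> = 1" and e: "e > 0"
  shows "\<exists>x0>0. eventually (\<lambda>n. \<forall>x\<in>{0..x0}. c2_error a (\<gamma> n) (c n) (v n) n x < e) sequentially"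
proof -
  \<comment> \<open>The three parts of the error turn out to be at most 3, 3 + 2 and 19 + 3 times
    delta.\<close>
  define \<delta> where "\<delta> = min e 1 / 100"
  have \<delta>: "0 < \<delta>" "\<delta> \<le> 1 / 100" "100 * \<delta> \<le> e" using e by (auto simp: \<delta>_def)
  have \<delta>2: "\<delta>\<^sup>2 \<le> \<delta> / 100" using \<delta> mult_left_mono[of \<delta> "1 / 100" \<delta>] by (simp add: power2_eq_square)
  have \<delta>2p: "\<delta>\<^sup>2 > 0" using \<delta> by simp
  have \<delta>3: "\<delta> * \<delta>\<^sup>2 \<le> \<delta>\<^sup>2 / 100" using \<delta> mult_right_mono[of \<delta> "1 / 100" "\<delta>\<^sup>2"] by simp
  \<comment> \<open>At time -J after the centre of the bubble the rescaled radius (2 / sqrt 2) exp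
    (- J) is delta; E below is b x^2 at this radius.\<close>
  define J where "J = ln (sqrt 2 / \<delta>)"
  have s2: "1 \<le> sqrt 2" by simp
  have Jp: "J > 0"
  proof -
    have "\<delta> < sqrt 2" using \<delta> s2 by linarith
    then show ?thesis unfolding J_def using \<delta> by (intro ln_gt_zero) (simp add: pos_less_divide_eq)
  qed
  define E where "E = \<delta>\<^sup>2 / 2"
  have E: "0 < E" "E \<le> \<delta> / 200" using \<delta>2 \<delta>2p by (auto simp: E_def)
  have eJ: "exp (- J) = \<delta> / sqrt 2" using \<delta> by (simp add: J_def exp_minus)
  have x\<sigma>: "\<delta> = 2 / sqrt 2 * exp (- J)" by (simp add: eJ)
  have EJ: "E = exp (2 * - J)"
  proof -
    have "exp (2 * - J) = exp (- J) * exp (- J)" by (simp flip: exp_add)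
    then show ?thesis by (simp add: eJ E_def power2_eq_square)
  qed
  define sJ fJ where "sJ = slope 2 (- J)" and "fJ = force 2 (- J)"
  have sJ: "sJ \<le> 2 * \<delta>\<^sup>2"
  proof -
    have "sJ = 4 * E / (1 + E)" using slope_eq[OF _ x\<sigma> EJ] by (simp add: sJ_def)
    also have "\<dots> \<le> 4 * E / 1" using E by (intro divide_left_mono) auto
    finally show ?thesis by (simp add: E_def)
  qed
  have fJeq: "fJ = \<delta>\<^sup>2 * (4 / (1 + E)\<^sup>2)"
    using force_eq[OF _ x\<sigma> EJ] by (simp add: fJ_def E_def)
  have H0: "4 - \<delta> \<le> 4 / (1 + E)\<^sup>2" "4 / (1 + E)\<^sup>2 \<le> 4"
  proof -
    have "(1 + E)\<^sup>2 \<ge> 1" using E by simp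
    then show "4 / (1 + E)\<^sup>2 \<le> 4" using divide_left_mono[of 1 "(1 + E)\<^sup>2" 4] E by simp
    have "(1 - 2 * E) * (1 + E)\<^sup>2 = 1 - 3 * E\<^sup>2 - 2 * E ^ 3"
      by (simp add: power2_eq_square power3_eq_cube algebra_simps)
    also have "\<dots> \<le> 1"
    proof -
      have "0 \<le> E\<^sup>2" "0 \<le> E ^ 3" using E by simp_all
      then show ?thesis by linarith
    qed
    finally have "(4 * (1 - 2 * E)) * (1 + E)\<^sup>2 \<le> 4" unfolding mult.assoc by linarith
    moreover have "0 < (1 + E)\<^sup>2" using E by simp
    ultimately have "4 * (1 - 2 * E) \<le> 4 / (1 + E)\<^sup>2" by (simp only: pos_le_divide_eq)
    then show "4 - \<delta> \<le> 4 / (1 + E)\<^sup>2" using E by simp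
  qed
  have fJ: "\<delta>\<^sup>2 * (4 - \<delta>) \<le> fJ" "fJ \<le> \<delta>\<^sup>2 * 4"
    unfolding fJeq by (rule mult_left_mono[OF H0(1)], simp) (rule mult_left_mono[OF H0(2)], simp)
  have h0: "h 0 > 0" by (rule h_pos) auto
  obtain r1 where r1: "r1 > 0" "\<And>r. 0 \<le> r \<Longrightarrow> r \<le> r1 \<Longrightarrow> r \<le> 1 \<Longrightarrow> \<bar>h r - h 0\<bar> \<le> h 0 * (\<delta> / 4)"
  proof -
    have "(h \<longlongrightarrow> h 0) (at 0 within {0..1})" using continuous_on_h by (simp add: continuous_on)
    then have "eventually (\<lambda>r. dist (h r) (h 0) < h 0 * (\<delta> / 4)) (at 0 within {0..1})"
      using h0 \<delta> by (intro tendstoD) auto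
    then obtain d where d: "d > 0" "\<And>r. r \<in> {0..1} \<Longrightarrow> r \<noteq> 0 \<Longrightarrow> dist r 0 < d \<Longrightarrow> dist (h r) (h 0) < h 0 * (\<delta> / 4)"
      unfolding eventually_at by blast
    show ?thesis
    proof (rule that[of "d / 2"])
      fix r :: real assume r: "0 \<le> r" "r \<le> d / 2" "r \<le> 1"
      show "\<bar>h r - h 0\<bar> \<le> h 0 * (\<delta> / 4)"
        using d(2)[of r] r d(1) h0 \<delta> by (cases "r = 0") (auto simp: dist_real_def)
    qed (use d in simp)
  qed
  have hratio: "1 - \<delta> \<le> h r / h r'" "h r / h r' \<le> 1 + \<delta>"
    if "0 \<le> r" "r \<le> r1" "r \<le> 1" "0 \<le> r'" "r' \<le> r1" "r' \<le> 1" for r r'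
  proof -
    define z where "z = h 0 * (\<delta> / 4)"
    have z: "z > 0" using h0 \<delta> by (simp add: z_def)
    have b: "\<bar>h r - h 0\<bar> \<le> z" "\<bar>h r' - h 0\<bar> \<le> z" using r1(2) that by (auto simp: z_def)
    have hz: "h 0 * \<delta> = 4 * z" by (simp add: z_def)
    have zh: "z * 4 \<le> h 0" using h0 \<delta> mult_left_mono[of \<delta> 1 "h 0"] by (simp add: z_def)
    have p: "h r' > 0" using h_pos that by auto
    have zd: "z * \<delta> \<le> z" "z * \<delta> \<ge> 0" using z \<delta> mult_left_mono[of \<delta> 1 z] by auto
    have "\<bar>(h r' - h 0) * \<delta>\<bar> \<le> z * \<delta>" unfolding abs_mult using b \<delta> by (intro mult_mono) auto
    then have "h 0 * \<delta> - z * \<delta> \<le> h r' * \<delta>" by (simp add: algebra_simps abs_le_iff)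
    then have hd: "3 * z \<le> h r' * \<delta>" using hz zd by linarith
    have "h r \<le> h r' + h r' * \<delta>" "h r' - h r' * \<delta> \<le> h r" using b hd z by linarith+
    then have "h r \<le> (1 + \<delta>) * h r'" "(1 - \<delta>) * h r' \<le> h r" by (simp_all add: algebra_simps)
    then show "1 - \<delta> \<le> h r / h r'" "h r / h r' \<le> 1 + \<delta>"
      by (simp_all only: pos_le_divide_eq[OF p] pos_divide_le_eq[OF p])
  qed
  \<comment> \<open>The errors are divided by delta^2 later, so they must be of order delta^3. The
    bound by r1 keeps exp s in the range where h is nearly constant.\<close>
  define e2 where "e2 = min (\<delta> * \<delta>\<^sup>2) r1"
  have e2: "0 < e2" "e2 \<le> \<delta> * \<delta>\<^sup>2" "e2 \<le> r1" using \<delta> r1 by (auto simp: e2_def)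
  have half: "0 < (1/2::real)" "1/2 < (1::real)" by auto
  obtain C where C: "C > 0" "eventually (\<lambda>n. slow_bounds (1/2) C n) sequentially"
    using dom_slow[OF half] by blast
  note b2 = b[unfolded first]
  have c2: "eventually (\<lambda>n. \<bar>c n / g1 (UU n (\<tau> n)) - 1\<bar> < 1 / 2) sequentially"
    using tendstoD[OF c, of "1 / 2"] by (simp add: dist_real_def)
  have "eventually (\<lambda>n. \<forall>x\<in>{0..\<delta>}. c2_error a (\<gamma> n) (c n) (v n) n x < e) sequentially"
    using rescaled_window[OF b2 Jp e2(1) c v] C(2) c2 g1_mu_ratio_bounded[OF half] \<gamma>
      eventually_NN[of "max 4 C"]
  proof eventually_elim
    case (elim n)
    define s where "s = \<tau> n - J"
    have "\<bar>- J\<bar> \<le> J" using Jp by simp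
    note W = elim(1)[rule_format, OF this]
    have w: "s < 0" "t0 < UU n s" "\<bar>GG n s / NN n - 1\<bar> \<le> e2" "exp s \<le> e2"
      "\<bar>yy n s - sJ\<bar> \<le> e2" "\<bar>FF n s - fJ\<bar> \<le> e2" "\<bar>c n * PP n s - fJ\<bar> \<le> e2"
      "\<bar>c n * (UU n s - v n) + prim 2 (- J)\<bar> \<le> e2"
      using W by (simp_all add: s_def sJ_def fJ_def)
    have "\<bar>0\<bar> \<le> J" using Jp by simp
    note W0 = elim(1)[rule_format, OF this]
    have t0s: "\<tau> n < 0" "t0 < UU n (\<tau> n)" using W0 by simp_all
    have N: "NN n > 4" "NN n > C" using elim(6) by auto
    have e2s: "e2 \<le> \<delta>\<^sup>2 / 100" "e2 \<le> \<delta>" "e2 \<le> 1 / 2" using e2 \<delta>3 \<delta>2 \<delta> by linarith+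
    have "GG n s / NN n \<ge> 1 / 2" using w(3) e2s by linarith
    then have D: "dom (1/2) n s" using w N by (simp add: dom_def field_simps)
    have FF5: "FF n s \<le> 5 * \<delta>\<^sup>2" using w(6) fJ(2) e2s \<delta>2p by linarith
    have yy3: "yy n s \<le> 3 * \<delta>\<^sup>2" using w(5) sJ e2s \<delta>2p by linarith
    have yt: "yy n t \<le> 1 / 4" if "t \<le> s" for t
    proof -
      have "yy n s * (g1 (mu n) / g1 (UU n s)) \<le> (3 * \<delta>\<^sup>2) * 4"
        using yy3 elim(4) D yy_nonneg[OF w(1,2)] g1_UU_pos[OF w(1,2)] g1_pos[of "mu n"] UU_le_mu[OF w(1), of n] w(2)
        by (intro mult_mono) (auto simp: power2_eq_square)
      then show ?thesis using yy_le_later[OF D that] \<delta>2 \<delta> by linarith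
    qed
    have NC: "1 / NN n \<le> 1 / 4" "C / NN n \<le> 1" using N C(1) by (auto simp: field_simps)
    have kt: "\<bar>kap t\<bar> \<le> 1 / 4" and et: "eps n t * yy n t \<le> 1 / 4" if "t \<le> s" for t
    proof -
      note Dt = dom_down[OF D that]
      have bd: "0 \<le> yy n t" "\<bar>kap t\<bar> \<le> 1 / NN n" "0 < eps n t" "eps n t \<le> C / NN n"
        using elim(2) Dt by auto
      show "\<bar>kap t\<bar> \<le> 1 / 4" using bd NC by linarith
      have "eps n t * yy n t \<le> 1 * (1 / 4)" using bd NC yt[OF that] by (intro mult_mono) auto
      then show "eps n t * yy n t \<le> 1 / 4" by simp
    qed
    have NG: "NN n - GG n s \<le> 5 * \<delta>\<^sup>2" using near_origin(3)[OF D kt yt et] FF5 by simp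
    have cg: "c n \<le> 2 * g1 (UU n s)" "0 < c n"
    proof -
      have p: "g1 (UU n (\<tau> n)) > 0" using g1_UU_pos t0s by auto
      have "c n / g1 (UU n (\<tau> n)) < 2" "0 < c n / g1 (UU n (\<tau> n))" using elim(3) by linarith+
      then have "c n < 2 * g1 (UU n (\<tau> n))" "0 < c n" using p by (simp_all add: pos_divide_less_eq zero_less_divide_iff)
      moreover have "g1 (UU n (\<tau> n)) \<le> g1 (UU n s)"
        using UU_antimono[of s "\<tau> n" n] t0s Jp by (intro g1_mono) (auto simp: s_def)
      ultimately show "c n \<le> 2 * g1 (UU n s)" "0 < c n" by auto
    qed
    have Ux: "\<bar>c n * (x - UU n s)\<bar> \<le> \<delta>" if x: "UU n s \<le> x" "g x \<le> NN n" for x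
    proof -
      have "g (UU n s) + g1 (UU n s) * (x - UU n s) \<le> g x" using x w by (intro g_tangent) auto
      then have "g1 (UU n s) * (x - UU n s) \<le> 5 * \<delta>\<^sup>2" using x NG by (simp add: GG_def)
      moreover have "c n * (x - UU n s) \<le> (2 * g1 (UU n s)) * (x - UU n s)"
        using cg x by (intro mult_right_mono) auto
      ultimately have "c n * (x - UU n s) \<le> \<delta>" using \<delta>2 \<delta> by linarith
      moreover have "0 \<le> c n * (x - UU n s)" using cg x by simp
      ultimately show ?thesis by simp
    qed
    have zs: "zprof 2 \<delta> = - prim 2 (- J)" by (rule zprof_eq[OF _ x\<sigma> refl]) simp
    have w0: "\<bar>c n * (x - v n) - zprof 2 y\<bar> \<le> 3 * \<delta>"
      if "UU n s \<le> x" "g x \<le> NN n" "0 \<le> y" "y \<le> \<delta>" for x y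
    proof -
      have "c n * (x - v n) = c n * (x - UU n s) + c n * (UU n s - v n)" by (simp add: algebra_simps)
      then show ?thesis
        using Ux[OF that(1,2)] w(8) e2s profile_2_near_0(1)[OF that(3,4)] \<delta> zs by linarith
    qed
    define P0 where "P0 = c n * PP n s / \<delta>\<^sup>2"
    have P0: "4 - 2 * \<delta> \<le> P0" "P0 \<le> 4 + \<delta>"
    proof -
      have "\<delta>\<^sup>2 * (4 - \<delta>) - \<delta> * \<delta>\<^sup>2 \<le> c n * PP n s" "c n * PP n s \<le> \<delta>\<^sup>2 * 4 + \<delta> * \<delta>\<^sup>2"
        using w(7) fJ e2 by linarith+
      then have "(4 - 2 * \<delta>) * \<delta>\<^sup>2 \<le> c n * PP n s" "c n * PP n s \<le> (4 + \<delta>) * \<delta>\<^sup>2"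
        by (simp_all add: algebra_simps)
      then show "4 - 2 * \<delta> \<le> P0" "P0 \<le> 4 + \<delta>"
        unfolding P0_def by (simp_all only: pos_le_divide_eq[OF \<delta>2p] pos_divide_le_eq[OF \<delta>2p])
    qed
    have P: "(4 - 6 * \<delta>) * (\<delta> * exp (t - s))\<^sup>2 \<le> c n * PP n t"
      "c n * PP n t \<le> (4 + 16 * \<delta>) * (\<delta> * exp (t - s))\<^sup>2" if t: "t \<le> s" for t
    proof -
      note Dt = domD[OF dom_down[OF D t]]
      \<comment> \<open>The factor by which \<open>PP\<close> at t differs from its value at s
        scaled by the square of the radius.\<close>
      define R where "R = h (exp t) / h (exp s) * exp (GG n t - GG n s)"
      have ets: "exp t \<le> exp s" using t by simp
      have hh: "1 - \<delta> \<le> h (exp t) / h (exp s)" "h (exp t) / h (exp s) \<le> 1 + \<delta>"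
        using hratio[of "exp t" "exp s"] ets w(1,4) e2(3) Dt(1) by auto
      have "GG n s \<le> GG n t" unfolding GG_def using UU_antimono[OF t w(1)] w(2) by (intro g_mono) auto
      moreover have "GG n t - GG n s \<le> 5 * \<delta>\<^sup>2" using GG_le_NN[OF Dt(1,2)] NG by linarith
      ultimately have G: "0 \<le> GG n t - GG n s" "GG n t - GG n s \<le> \<delta> / 20" using \<delta>2 by auto
      have "exp (GG n t - GG n s) - 1 \<le> 2 * (GG n t - GG n s)"
        using abs_exp_minus_one_le[of "GG n t - GG n s"] G \<delta> by auto
      then have ex: "1 \<le> exp (GG n t - GG n s)" "exp (GG n t - GG n s) \<le> 1 + \<delta>" using G by auto
      have "(1 - \<delta>) * 1 \<le> R" unfolding R_def using hh ex \<delta> by (intro mult_mono) auto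
      moreover have "R \<le> (1 + \<delta>) * (1 + \<delta>)" unfolding R_def using hh ex \<delta> by (intro mult_mono) auto
      moreover have "(1 + \<delta>) * (1 + \<delta>) \<le> 1 + 3 * \<delta>" using \<delta>2 \<delta> by (simp add: algebra_simps power2_eq_square)
      ultimately have R: "1 - \<delta> \<le> R" "R \<le> 1 + 3 * \<delta>" by auto
      have "(1 - \<delta>) * (4 - 2 * \<delta>) \<le> R * P0" using R P0 \<delta> by (intro mult_mono) auto
      moreover have "R * P0 \<le> (1 + 3 * \<delta>) * (4 + \<delta>)" using R P0 \<delta> by (intro mult_mono) auto
      moreover have "4 - 6 * \<delta> \<le> (1 - \<delta>) * (4 - 2 * \<delta>)" using \<delta> by (simp add: algebra_simps)
      moreover have "(1 + 3 * \<delta>) * (4 + \<delta>) \<le> 4 + 16 * \<delta>" using \<delta>2 \<delta> by (simp add: algebra_simps power2_eq_square)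
      ultimately have RP: "4 - 6 * \<delta> \<le> R * P0" "R * P0 \<le> 4 + 16 * \<delta>" by linarith+
      have "PP n t = PP n s * R * (exp (t - s))\<^sup>2"
      proof -
        have "f (UU n t) = exp (GG n t)" "f (UU n s) = exp (GG n s)"
          using f_exp Dt(2) w(2) by (auto simp: GG_def)
        moreover have "h (exp s) \<noteq> 0" using h_exp_pos[OF w(1)] by simp
        ultimately show ?thesis
          unfolding PP_def R_def by (simp add: exp_diff power_divide)
      qed
      then have eq: "c n * PP n t = R * P0 * (\<delta> * exp (t - s))\<^sup>2"
        using \<delta>(1) by (simp add: P0_def power_mult_distrib)
      show "(4 - 6 * \<delta>) * (\<delta> * exp (t - s))\<^sup>2 \<le> c n * PP n t"
        "c n * PP n t \<le> (4 + 16 * \<delta>) * (\<delta> * exp (t - s))\<^sup>2"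
        unfolding eq using RP by (auto intro!: mult_right_mono)
    qed
    \<comment> \<open>This is 1/gamma, so k exp t is the rescaled radius x.\<close>
    define k where "k = \<delta> / exp s"
    have kx: "\<delta> * exp (t - s) = k * exp t" for t by (simp add: k_def exp_diff)
    have u1c: "continuous_on {0..exp t} (u1 n)" if "t \<le> s" for t
      using that w(1) by (intro continuous_on_subset[OF continuous_on_u1]) (auto intro: order_trans)
    have Mlo: "(2 - 3 * \<delta>) * (k * exp t)\<^sup>2 \<le> c n * MM n t" if t: "t \<le> s" for t
    proof -
      let ?\<phi> = "\<lambda>r. c n * (- r * u1 n r) - (2 - 3 * \<delta>) * (k * r)\<^sup>2"
      have "?\<phi> 0 \<le> ?\<phi> (exp t)"
      proof (rule mono_from_zero)
        show "continuous_on {0..exp t} ?\<phi>" by (intro continuous_intros u1c t)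
        fix x assume "x \<le> t"
        then have x: "x \<le> s" using t by simp
        have "((\<lambda>t. (2 - 3 * \<delta>) * (k * exp t)\<^sup>2) has_real_derivative (4 - 6 * \<delta>) * (k * exp x)\<^sup>2) (at x)"
          by (auto intro!: derivative_eq_intros simp: power2_eq_square algebra_simps)
        from DERIV_diff[OF DERIV_cmult[OF MM_deriv[of x n, unfolded MM_def[abs_def]], of "c n"] this]
        show "((\<lambda>t. c n * (- exp t * u1 n (exp t)) - (2 - 3 * \<delta>) * (k * exp t)\<^sup>2) has_real_derivative
            c n * PP n x - (4 - 6 * \<delta>) * (k * exp x)\<^sup>2) (at x)"
          using x w(1) by simp
        show "0 \<le> c n * PP n x - (4 - 6 * \<delta>) * (k * exp x)\<^sup>2" using P(1)[OF x] unfolding kx by simp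
      qed
      then show ?thesis by (simp add: MM_def)
    qed
    have Mhi: "c n * MM n t \<le> (2 + 8 * \<delta>) * (k * exp t)\<^sup>2" if t: "t \<le> s" for t
    proof -
      let ?\<phi> = "\<lambda>r. (2 + 8 * \<delta>) * (k * r)\<^sup>2 - c n * (- r * u1 n r)"
      have "?\<phi> 0 \<le> ?\<phi> (exp t)"
      proof (rule mono_from_zero)
        show "continuous_on {0..exp t} ?\<phi>" by (intro continuous_intros u1c t)
        fix x assume "x \<le> t"
        then have x: "x \<le> s" using t by simp
        have "((\<lambda>t. (2 + 8 * \<delta>) * (k * exp t)\<^sup>2) has_real_derivative (4 + 16 * \<delta>) * (k * exp x)\<^sup>2) (at x)"
          by (auto intro!: derivative_eq_intros simp: power2_eq_square algebra_simps)
        from DERIV_diff[OF this DERIV_cmult[OF MM_deriv[of x n, unfolded MM_def[abs_def]], of "c n"]]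
        show "((\<lambda>t. (2 + 8 * \<delta>) * (k * exp t)\<^sup>2 - c n * (- exp t * u1 n (exp t))) has_real_derivative
            (4 + 16 * \<delta>) * (k * exp x)\<^sup>2 - c n * PP n x) (at x)"
          using x w(1) by simp
        show "0 \<le> (4 + 16 * \<delta>) * (k * exp x)\<^sup>2 - c n * PP n x" using P(2)[OF x] unfolding kx by simp
      qed
      then show ?thesis by (simp add: MM_def)
    qed
    have gam: "\<gamma> n = exp s / \<delta>"
    proof -
      have "exp (\<tau> n) = exp s * exp J" by (simp add: s_def flip: exp_add)
      also have "exp J = sqrt 2 / \<delta>" using \<delta> by (simp add: J_def)
      finally show ?thesis using elim(5) by (simp add: first(1) mult.assoc)
    qed
    have pos: "c2_error 2 (\<gamma> n) (c n) (v n) n x < e" "\<bar>c n * (\<gamma> n)\<^sup>2 * u2 n (\<gamma> n * x) + 2\<bar> \<le> 19 * \<delta>"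
      if x: "0 < x" "x \<le> \<delta>" for x
    proof -
      define t where "t = s + ln (x / \<delta>)"
      have et: "exp t = exp s * (x / \<delta>)" using x \<delta> by (simp add: t_def exp_add)
      have ts: "t \<le> s" using x \<delta> by (simp add: t_def)
      note Dt = domD[OF dom_down[OF D ts]]
      have kt: "k * exp t = x" using \<delta> by (simp add: k_def et)
      have gx: "\<gamma> n * x = exp t" by (simp add: gam et)
      note dr = rescaled_derivatives[OF Dt(1) x(1) gx, of "c n" n]
      note M = Mlo[OF ts, unfolded kt] Mhi[OF ts, unfolded kt]
      note Pt = P[OF ts, unfolded kx kt]
      have x2: "x\<^sup>2 > 0" using x by simp
      have 0: "\<bar>c n * (u n (\<gamma> n * x) - v n) - zprof 2 x\<bar> \<le> 3 * \<delta>"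
      proof -
        have "UU n s \<le> u n (\<gamma> n * x)" "g (u n (\<gamma> n * x)) \<le> NN n"
          using UU_antimono[OF ts w(1), of n] GG_le_NN[OF Dt(1,2)] by (simp_all add: gx UU_def GG_def)
        then show ?thesis using w0 x by simp
      qed
      have 1: "\<bar>c n * \<gamma> n * u1 n (\<gamma> n * x)\<bar> \<le> 3 * \<delta>"
      proof -
        have "0 \<le> (2 - 3 * \<delta>) * x\<^sup>2" using \<delta> by simp
        then have "\<bar>c n * MM n t\<bar> \<le> (2 + 8 * \<delta>) * x\<^sup>2" using M by linarith
        also have "\<dots> \<le> 3 * x\<^sup>2" using \<delta> by (intro mult_right_mono) auto
        finally have "\<bar>c n * MM n t\<bar> / x \<le> 3 * x\<^sup>2 / x" using x by (intro divide_right_mono) auto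
        then have "\<bar>c n * MM n t\<bar> / x \<le> 3 * x" using x by (simp add: power2_eq_square)
        moreover have "\<bar>- (c n * MM n t) / x\<bar> = \<bar>c n * MM n t\<bar> / x" using x(1) by (simp add: abs_divide)
        ultimately show ?thesis unfolding dr(1) using x by linarith
      qed
      have "(2 - 3 * \<delta> - (4 + 16 * \<delta>)) * x\<^sup>2 \<le> c n * MM n t - c n * PP n t"
        "c n * MM n t - c n * PP n t \<le> (2 + 8 * \<delta> - (4 - 6 * \<delta>)) * x\<^sup>2"
        unfolding left_diff_distrib[of _ _ "x\<^sup>2"] using M Pt by (simp_all add: left_diff_distrib)
      then have "2 - 3 * \<delta> - (4 + 16 * \<delta>) \<le> (c n * MM n t - c n * PP n t) / x\<^sup>2"
        "(c n * MM n t - c n * PP n t) / x\<^sup>2 \<le> 2 + 8 * \<delta> - (4 - 6 * \<delta>)"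
        using x2 by (simp_all add: pos_le_divide_eq pos_divide_le_eq)
      then show 2: "\<bar>c n * (\<gamma> n)\<^sup>2 * u2 n (\<gamma> n * x) + 2\<bar> \<le> 19 * \<delta>" unfolding dr(2) using \<delta> by linarith
      show "c2_error 2 (\<gamma> n) (c n) (v n) n x < e"
        unfolding c2_error_def
        using 0 1 2 profile_2_near_0(2,3)[of x \<delta>] x \<delta> by linarith
    qed
    have zero: "c2_error 2 (\<gamma> n) (c n) (v n) n 0 < e"
    proof -
      have 0: "\<bar>c n * (u n (\<gamma> n * 0) - v n) - zprof 2 0\<bar> \<le> 3 * \<delta>"
        using w0[of "mu n" 0] UU_le_mu[OF w(1), of n] \<delta> by (simp add: u_0 NN_def)
      \<comment> \<open>The equation is given for r > 0; at the centre the bound follows by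
        continuity of u''.\<close>
      have 2: "\<bar>c n * (\<gamma> n)\<^sup>2 * u2 n (\<gamma> n * 0) + 2\<bar> \<le> 19 * \<delta>"
      proof (rule continuous_le_on_closure[of "{0<..<\<delta>}" "\<lambda>x. \<bar>c n * (\<gamma> n)\<^sup>2 * u2 n (\<gamma> n * x) + 2\<bar>"])
        have cl: "closure {0<..<\<delta>} = {0..\<delta>}" using \<delta> by simp
        show "0 \<in> closure {0<..<\<delta>}" unfolding cl using \<delta> by simp
        have "(\<lambda>x. \<gamma> n * x) ` {0..\<delta>} \<subseteq> {0..1}"
        proof (rule image_subsetI)
          fix x assume x: "x \<in> {0..\<delta>}"
          then have "exp s * x \<le> 1 * \<delta>" using w(1) by (intro mult_mono) auto
          then show "\<gamma> n * x \<in> {0..1}" using x \<delta> by (simp add: gam)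
        qed
        then show "continuous_on (closure {0<..<\<delta>}) (\<lambda>x. \<bar>c n * (\<gamma> n)\<^sup>2 * u2 n (\<gamma> n * x) + 2\<bar>)"
          unfolding cl by (intro continuous_intros continuous_on_compose2[OF u2_cont])
        show "\<bar>c n * (\<gamma> n)\<^sup>2 * u2 n (\<gamma> n * x) + 2\<bar> \<le> 19 * \<delta>" if "x \<in> {0<..<\<delta>}" for x
          using pos(2)[of x] that by simp
      qed
      have z: "zprof1 2 0 = 0" "zprof2 2 0 = - 2" using zprof1_2[of 0] zprof2_2[of 0] by simp_all
      have "\<bar>c n * \<gamma> n * u1 n (\<gamma> n * 0) - zprof1 2 0\<bar> = 0" by (simp add: u1_0 z)
      moreover have "\<bar>c n * (\<gamma> n)\<^sup>2 * u2 n (\<gamma> n * 0) - zprof2 2 0\<bar> \<le> 19 * \<delta>"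
        using 2 unfolding z by simp
      ultimately show ?thesis unfolding c2_error_def using 0 \<delta> by linarith
    qed
    show ?case unfolding first(1)
    proof
      fix x assume "x \<in> {0..\<delta>}"
      then show "c2_error 2 (\<gamma> n) (c n) (v n) n x < e" using pos(1)[of x] zero by (cases "x = 0") auto
    qed
  qed
  then show ?thesis using \<delta>(1) by blast
qed

end

end

section \<open>The bubbles in the original variables\<close>

lemma real_plus_one_at_top: "filterlim (\<lambda>n. real n + 1) at_top sequentially"
  using filterlim_tendsto_add_at_top[OF tendsto_const filterlim_real_sequentially, of 1]
  by (simp add: add.commute)

lemma slope_at_bot:
  assumes "0 < a"
  shows "(slope a \<longlongrightarrow> 2 - a) at_bot"
proof -
  have "((\<lambda>x. 4 - slope a x) \<longlongrightarrow> 4 - (2 + a)) at_top"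
    by (intro tendsto_intros slope_tendsto assms)
  moreover have "slope a (- x) = 4 - slope a x" for x
    by (simp add: slope_def)
  ultimately show ?thesis by (simp add: filterlim_at_bot_mirror)
qed

context radial_family
begin

section \<open>Radii, windows and integrals for each bubble\<close>

lemma bubble_cong:
  assumes b: "bubble a \<eta> \<tau>" and eq: "eventually (\<lambda>n. \<tau> n = \<tau>' n) sequentially"
  shows "bubble a \<eta> \<tau>'"
proof -
  have tr: "(\<lambda>n. X n (\<tau>' n)) \<longlonglongrightarrow> l" if "(\<lambda>n. X n (\<tau> n)) \<longlonglongrightarrow> l" for X :: "nat \<Rightarrow> real \<Rightarrow> real" and l
    by (rule Lim_transform_eventually[OF that]) (use eq in eventually_elim, simp)
  have "eventually (\<lambda>n. \<tau> n < 0 \<and> t0 < UU n (\<tau> n)) sequentially"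
    using b by (simp add: bubble_def at_scale_def)
  with eq have "eventually (\<lambda>n. \<tau>' n < 0 \<and> t0 < UU n (\<tau>' n)) sequentially"
    by eventually_elim simp
  then show ?thesis
    using b tr[of yy 2] tr[of FF "a\<^sup>2 / 2"] tr[of "\<lambda>n t. GG n t / NN n" \<eta>]
    by (simp add: bubble_def at_scale_def)
qed

text \<open>The radii have to lie in (0, 1) for every n, whereas a bubble controls large n only;
  times that are not negative are replaced by -1.\<close>

lemma bubble_ex_neg:
  assumes b: "bubble a \<eta> \<tau>"
  shows "\<exists>\<tau>'. bubble a \<eta> \<tau>' \<and> (\<forall>n. \<tau>' n < 0)"
proof -
  have "eventually (\<lambda>n. \<tau> n < 0 \<and> t0 < UU n (\<tau> n)) sequentially"
    using b by (simp add: bubble_def at_scale_def)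
  then have "eventually (\<lambda>n. \<tau> n = min (\<tau> n) (if \<tau> n < 0 then 0 else - 1)) sequentially"
    by eventually_elim simp
  from bubble_cong[OF b this] show ?thesis
    by (intro exI[of _ "\<lambda>n. min (\<tau> n) (if \<tau> n < 0 then 0 else - 1)"]) auto
qed

text \<open>The last two clauses give the flux at both ends in the unit g'(mu), common to all
  bubbles, so that the right end of one bubble can be matched with the left end of the next.
  \<open>first\<close> marks the bubble whose window starts at the centre.\<close>

definition profile_limit :: "real \<Rightarrow> real \<Rightarrow> bool \<Rightarrow> (nat \<Rightarrow> real) \<Rightarrow> (nat \<Rightarrow> real) \<Rightarrow> (nat \<Rightarrow> real) \<Rightarrow> bool" where
  "profile_limit a \<eta> first r \<rho> \<rho>b \<longleftrightarrow>
     (\<forall>n. 0 \<le> \<rho> n \<and> \<rho> n < 1 \<and> 0 \<le> \<rho>b n \<and> \<rho>b n < 1) \<and> (first \<longrightarrow> (\<forall>n. \<rho>b n = 0)) \<and>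
     good \<eta> (\<lambda>n. u n (r n)) \<and> good \<eta> (\<lambda>n. u n (\<rho> n)) \<and> good \<eta> (\<lambda>n. u n (\<rho>b n)) \<and>
     (\<lambda>n. lam n * (r n)\<^sup>2 * h (r n) * f1 (u n (r n))) \<longlonglongrightarrow> a\<^sup>2 / 2 \<and>
     (let \<gamma> = (\<lambda>n. 1 / sqrt (lam n * h (r n) * f1 (u n (r n)))); c = (\<lambda>n. g1 (u n (r n))) in
       \<gamma> \<longlonglongrightarrow> 0 \<and> \<rho> \<longlonglongrightarrow> 0 \<and> (\<lambda>n. \<rho>b n / \<gamma> n) \<longlonglongrightarrow> 0 \<and>
       filterlim (\<lambda>n. \<rho> n / \<gamma> n) at_top sequentially \<and>
       C2_to_zero (\<lambda>n. \<rho>b n / \<gamma> n) (\<lambda>n. \<rho> n / \<gamma> n)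
          (\<lambda>n x. c n * (u n (\<gamma> n * x) - u n (r n)))
          (\<lambda>n x. c n * \<gamma> n * u1 n (\<gamma> n * x))
          (\<lambda>n x. c n * (\<gamma> n)\<^sup>2 * u2 n (\<gamma> n * x))
          (zprof a) (zprof1 a) (zprof2 a) \<and>
       (\<lambda>n. c n * oint (\<rho>b n) (\<rho> n) (\<lambda>x. lam n * h x * f (u n x) * x)) \<longlonglongrightarrow> 2 * a \<and>
       (\<lambda>n. oint (\<rho>b n) (\<rho> n) (\<lambda>x. lam n * h x * f1 (u n x) * x)) \<longlonglongrightarrow> 2 * a) \<and>
     (\<lambda>n. g1 (mu n) * mass n (\<rho> n)) \<longlonglongrightarrow> (2 + a) / \<eta> powr (1 / q) \<and>
     (\<lambda>n. g1 (mu n) * mass n (\<rho>b n)) \<longlonglongrightarrow> (2 - a) / \<eta> powr (1 / q)"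

text \<open>By a diagonal choice the window in the rescaled radius becomes [1/M, M] with M growing
  slowly, or [0, M] for the first bubble. In the unit g'(u(r_n)) the flux at its ends tends to 2 - a
  and 2 + a, and the integral of lambda h f(u) r is the difference.\<close>

lemma bubble_profile_limit:
  assumes b: "bubble a \<eta> \<tau>" and \<tau>: "\<And>n. \<tau> n < 0" and first: "first \<Longrightarrow> a = 2 \<and> \<eta> = 1"
  shows "\<exists>\<rho> \<rho>b. profile_limit a \<eta> first (\<lambda>n. exp (\<tau> n)) \<rho> \<rho>b"
proof -
  have a: "0 < a" "a \<le> 2" "0 < \<eta>" "at_scale \<eta> \<tau>" and F: "(\<lambda>n. FF n (\<tau> n)) \<longlonglongrightarrow> a\<^sup>2 / 2"
    using b by (auto simp: bubble_def)
  define r where "r n = exp (\<tau> n)" for n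
  define c where "c n = g1 (u n (r n))" for n
  define \<gamma> where "\<gamma> n = 1 / sqrt (lam n * h (r n) * f1 (u n (r n)))" for n
  define k where "k = sqrt 2 / a"
  have k: "k > 0" using a by (simp add: k_def)
  have ur: "u n (r n) = UU n (\<tau> n)" for n by (simp add: UU_def r_def)
  have ev0: "eventually (\<lambda>n. t0 < UU n (\<tau> n)) sequentially"
    using a(4) by (auto simp: at_scale_def elim: eventually_mono)
  have good_r: "good \<eta> (\<lambda>n. u n (r n))" unfolding ur by (rule at_scale_good[OF a(4,3)])
  have FFeq: "eventually (\<lambda>n. FF n (\<tau> n) = lam n * (r n)\<^sup>2 * h (r n) * f1 (u n (r n))) sequentially"
    using ev0
  proof eventually_elim
    case (elim n)
    then show ?case using f1_eq[of "UU n (\<tau> n)"] by (simp add: FF_def PP_def r_def UU_def)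
  qed
  have \<gamma>eq: "eventually (\<lambda>n. \<gamma> n = exp (\<tau> n) / sqrt (FF n (\<tau> n))) sequentially"
    using FFeq
  proof eventually_elim
    case (elim n)
    have "FF n (\<tau> n) = (r n)\<^sup>2 * (lam n * h (r n) * f1 (u n (r n)))" using elim by simp
    moreover have "r n > 0" by (simp add: r_def)
    ultimately have "sqrt (FF n (\<tau> n)) = r n * sqrt (lam n * h (r n) * f1 (u n (r n)))"
      by (simp add: real_sqrt_mult)
    then show ?case using \<open>r n > 0\<close> by (simp add: \<gamma>_def r_def)
  qed
  \<comment> \<open>gamma equals exp tau / sqrt F, and F only tends to a^2/2. Moving the time by
    this null sequence gives gamma = exp tau' times sqrt 2 / a exactly for large n.\<close>
  define \<iota> where "\<iota> n = ln (a / (sqrt 2 * sqrt (FF n (\<tau> n))))" for n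
  have "(\<lambda>n. a / (sqrt 2 * sqrt (FF n (\<tau> n)))) \<longlonglongrightarrow> a / (sqrt 2 * sqrt (a\<^sup>2 / 2))"
    using a by (intro tendsto_intros F) auto
  moreover have "a / (sqrt 2 * sqrt (a\<^sup>2 / 2)) = 1" using a by (simp add: real_sqrt_divide)
  ultimately have "(\<lambda>n. a / (sqrt 2 * sqrt (FF n (\<tau> n)))) \<longlonglongrightarrow> 1" by simp
  from tendsto_ln[OF this] have \<iota>: "\<iota> \<longlonglongrightarrow> 0" by (simp add: \<iota>_def[abs_def])
  define \<tau>' where "\<tau>' n = \<tau> n + \<iota> n" for n
  have b': "bubble a \<eta> \<tau>'" unfolding \<tau>'_def[abs_def] by (rule bubble_shift[OF b \<iota>])
  have Fpos: "eventually (\<lambda>n. FF n (\<tau> n) > 0) sequentially"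
    using ev0 by eventually_elim (rule FF_pos[OF \<tau>])
  have \<gamma>': "eventually (\<lambda>n. \<gamma> n = exp (\<tau>' n) * (sqrt 2 / a)) sequentially"
    using \<gamma>eq Fpos
  proof eventually_elim
    case (elim n)
    have "exp (\<iota> n) = a / (sqrt 2 * sqrt (FF n (\<tau> n)))" unfolding \<iota>_def using elim a by (intro exp_ln) auto
    then show ?case using elim a by (simp add: \<tau>'_def exp_add)
  qed
  have c': "(\<lambda>n. c n / g1 (UU n (\<tau>' n))) \<longlonglongrightarrow> 1"
  proof -
    have "at_scale \<eta> \<tau>'" using b' by (simp add: bubble_def)
    from good_g1_ratio[OF good_r at_scale_good[OF this a(3)]] show ?thesis by (simp add: c_def)
  qed
  have v': "(\<lambda>n. c n * (UU n (\<tau>' n) - u n (r n))) \<longlonglongrightarrow> 0"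
  proof -
    have i1: "eventually (\<lambda>n. \<bar>\<iota> n\<bar> \<le> 1) sequentially"
      using tendstoD[OF \<iota>, of 1] by (auto elim!: eventually_mono)
    have c1: "(\<lambda>n. c n / g1 (UU n (\<tau> n))) \<longlonglongrightarrow> 1"
    proof (rule tendsto_eventually)
      show "eventually (\<lambda>n. c n / g1 (UU n (\<tau> n)) = 1) sequentially"
        using ev0
      proof eventually_elim
        case (elim n)
        then show ?case using g1_UU_pos[OF \<tau> elim] by (simp add: c_def ur)
      qed
    qed
    have c2: "(\<lambda>n. c n * (UU n (\<tau> n) - u n (r n))) \<longlonglongrightarrow> 0" by (simp add: ur)
    have "(\<lambda>n. c n * (UU n (\<tau>' n) - u n (r n)) + prim a (\<iota> n)) \<longlonglongrightarrow> 0"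
    proof (rule tendsto_zero_of_linear_bound[where C = 1])
      fix e :: real assume e: "e > 0"
      from rescaled_window[OF b zero_less_one e c1 c2] i1
      show "eventually (\<lambda>n. \<bar>c n * (UU n (\<tau>' n) - u n (r n)) + prim a (\<iota> n)\<bar> \<le> e * 1) sequentially"
        by eventually_elim (simp add: \<tau>'_def)
    qed
    moreover have "(\<lambda>n. prim a (\<iota> n)) \<longlonglongrightarrow> 0"
      using isCont_tendsto_compose[OF DERIV_isCont[OF prim_deriv] \<iota>, of a] by simp
    ultimately have "(\<lambda>n. (c n * (UU n (\<tau>' n) - u n (r n)) + prim a (\<iota> n)) - prim a (\<iota> n)) \<longlonglongrightarrow> 0 - 0"
      by (rule tendsto_diff)
    then show ?thesis by simp
  qed
  note window = c2_window[OF b' c' v' \<gamma>']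
  let ?G = "\<lambda>j n x. t0 < u n (\<gamma> n * x) \<and> \<bar>g (u n (\<gamma> n * x)) / NN n - \<eta>\<bar> \<le> 1 / (real j + 1) \<and>
    \<bar>c n * mass n (\<gamma> n * x) - slope a (ln (x * k))\<bar> \<le> 1 / (real j + 1)"
  \<comment> \<open>The bound 1/(j + 1) on gamma (j + 1) is what later forces rho to 0.\<close>
  let ?Q = "\<lambda>j n. \<gamma> n > 0 \<and> \<gamma> n * (real j + 1) \<le> 1 / (real j + 1) \<and> \<gamma> n * (real j + 1) < 1 \<and>
    ?G j n (real j + 1) \<and> ?G j n (1 / (real j + 1)) \<and>
    (\<forall>x. (if first then 0 else 1 / (real j + 1)) \<le> x \<and> x \<le> real j + 1 \<longrightarrow>
       c2_error a (\<gamma> n) (c n) (u n (r n)) n x < 1 / (real j + 1))"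
  have "eventually (?Q j) sequentially" for j
  proof -
    let ?m = "real j + 1"
    have m: "0 < 1 / ?m" "1 / ?m \<le> ?m" by (auto simp: field_simps)
    \<comment> \<open>For the first bubble the estimate at the centre covers [0, y0] and the annulus
      estimate [y0, j + 1]. The bound y0 <= 1/(j + 1) lets the same annulus serve the other
      bubbles.\<close>
    obtain y0 where y0: "y0 > 0" "y0 \<le> 1 / ?m"
      "first \<Longrightarrow> eventually (\<lambda>n. \<forall>x\<in>{0..y0}. c2_error a (\<gamma> n) (c n) (u n (r n)) n x < 1 / ?m) sequentially"
    proof (cases first)
      case True
      obtain x0 where x0: "x0 > 0"
        "eventually (\<lambda>n. \<forall>x\<in>{0..x0}. c2_error a (\<gamma> n) (c n) (u n (r n)) n x < 1 / ?m) sequentially"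
        using c2_zero[OF b' c' v' \<gamma>' _ _ m(1)] first[OF True] by blast
      have "eventually (\<lambda>n. \<forall>x\<in>{0..min x0 (1 / ?m)}. c2_error a (\<gamma> n) (c n) (u n (r n)) n x < 1 / ?m) sequentially"
        using x0(2) by eventually_elim auto
      then show ?thesis using that[of "min x0 (1 / ?m)"] x0(1) m by simp
    next
      case False
      then show ?thesis using that[of "1 / ?m"] m by simp
    qed
    have y1: "y0 \<le> ?m" using y0 m by linarith
    have near: "eventually (\<lambda>n. first \<longrightarrow> (\<forall>x\<in>{0..y0}. c2_error a (\<gamma> n) (c n) (u n (r n)) n x < 1 / ?m)) sequentially"
      using y0(3) by (cases first) auto
    show ?thesis
      using window[OF y0(1) y1 m(1)] near
    proof eventually_elim
      case (elim n)
      note W = elim(1)[THEN conjunct2, rule_format]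
      have i: "?m \<in> {y0..?m}" "1 / ?m \<in> {y0..?m}" using y1 y0(2) m by auto
      have "c2_error a (\<gamma> n) (c n) (u n (r n)) n x < 1 / ?m"
        if "(if first then 0 else 1 / ?m) \<le> x" "x \<le> ?m" for x
      proof (cases "x \<ge> y0")
        case True
        then show ?thesis using W[of x] that by auto
      next
        case False
        then have first using that y0(2) by (auto split: if_splits)
        then show ?thesis using elim(2) False that by auto
      qed
      then show ?case
        using elim(1)[THEN conjunct1] W[OF i(1)] W[OF i(2)] unfolding k_def by blast
    qed
  qed
  then obtain J where J: "filterlim J at_top sequentially" "eventually (\<lambda>n. ?Q (J n) n) sequentially"
    by (rule diagonal_sequence[of ?Q]) auto
  define M where "M n = real (J n) + 1" for n
  have Mtop: "filterlim M at_top sequentially"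
    unfolding M_def[abs_def]
    by (rule filterlim_compose[OF real_plus_one_at_top J(1)])
  have M1: "M n \<ge> 1" for n by (simp add: M_def)
  have MI: "1 / M n \<le> M n" for n
  proof -
    have "1 / M n \<le> 1" using M1[of n] by simp
    then show ?thesis using M1[of n] by linarith
  qed
  have M0: "(\<lambda>n. 1 / M n) \<longlonglongrightarrow> 0"
    by (rule tendsto_divide_0[OF tendsto_const]) (rule filterlim_at_top_imp_at_infinity[OF Mtop])
  \<comment> \<open>For large n the conditions hold; the default 0 keeps the required range for the
    remaining n.\<close>
  define \<rho> where "\<rho> n = (if 0 \<le> \<gamma> n * M n \<and> \<gamma> n * M n < 1 then \<gamma> n * M n else 0)" for n
  define \<rho>b where "\<rho>b n = (if first then 0 else if 0 \<le> \<gamma> n * (1 / M n) \<and> \<gamma> n * (1 / M n) < 1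
      then \<gamma> n * (1 / M n) else 0)" for n
  have Q: "eventually (\<lambda>n. \<gamma> n > 0 \<and> \<gamma> n * M n \<le> 1 / M n \<and> \<gamma> n * M n < 1 \<and>
    ?G (J n) n (M n) \<and> ?G (J n) n (1 / M n) \<and>
    (\<forall>x. (if first then 0 else 1 / M n) \<le> x \<and> x \<le> M n \<longrightarrow>
       c2_error a (\<gamma> n) (c n) (u n (r n)) n x < 1 / M n)) sequentially"
    using J(2) by (simp only: M_def)
  have \<rho>eq: "eventually (\<lambda>n. \<gamma> n > 0 \<and> \<rho> n = \<gamma> n * M n \<and>
      \<rho>b n = (if first then 0 else \<gamma> n * (1 / M n))) sequentially"
    using Q
  proof eventually_elim
    case (elim n)
    have gp: "\<gamma> n > 0" "\<gamma> n * M n < 1" using elim by blast+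
    have "\<gamma> n * (1 / M n) \<le> \<gamma> n * M n" by (rule mult_left_mono[OF MI]) (use gp in simp)
    then have "\<gamma> n * (1 / M n) < 1" using gp by linarith
    moreover have "0 \<le> \<gamma> n * (1 / M n)" using gp M1[of n] by simp
    ultimately have B: "0 \<le> \<gamma> n * (1 / M n) \<and> \<gamma> n * (1 / M n) < 1" by blast
    have A: "0 \<le> \<gamma> n * M n \<and> \<gamma> n * M n < 1"
      using gp M1[of n] by (intro conjI mult_nonneg_nonneg) auto
    show ?case unfolding \<rho>_def \<rho>b_def if_P[OF A] if_P[OF B] using gp by blast
  qed
  have Ggood: "good \<eta> (\<lambda>n. u n (\<gamma> n * X n))"
    if "eventually (\<lambda>n. ?G (J n) n (X n)) sequentially" for X
    unfolding good_def
  proof (intro conjI a(3))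
    show "eventually (\<lambda>n. t0 < u n (\<gamma> n * X n)) sequentially"
      using that by eventually_elim blast
    show "(\<lambda>n. g (u n (\<gamma> n * X n)) / NN n) \<longlonglongrightarrow> \<eta>"
      by (rule tendsto_via_diagonal[OF J(1) tendsto_const]) (use that in \<open>eventually_elim, blast\<close>)
  qed
  have QM: "eventually (\<lambda>n. ?G (J n) n (M n)) sequentially" "eventually (\<lambda>n. ?G (J n) n (1 / M n)) sequentially"
    using Q by (eventually_elim, blast)+
  have good_\<rho>: "good \<eta> (\<lambda>n. u n (\<rho> n))"
    by (rule good_cong[OF Ggood[OF QM(1)]]) (use \<rho>eq in \<open>eventually_elim, simp\<close>)
  have good_\<rho>b: "good \<eta> (\<lambda>n. u n (\<rho>b n))"
  proof (cases first)
    case True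
    then show ?thesis using good_mu first by (simp add: \<rho>b_def u_0)
  next
    case False
    show ?thesis
      by (rule good_cong[OF Ggood[OF QM(2)]]) (use \<rho>eq in \<open>eventually_elim, simp add: False\<close>)
  qed
  have lnk: "filterlim (\<lambda>j. ln ((real j + 1) * k)) at_top sequentially"
    by (rule filterlim_compose[OF ln_at_top])
      (rule filterlim_at_top_mult_tendsto_pos[OF tendsto_const k real_plus_one_at_top])
  have lnk': "filterlim (\<lambda>j. ln (1 / (real j + 1) * k)) at_bot sequentially"
  proof -
    have "filterlim (\<lambda>j. - ln (k) + ln (real j + 1)) at_top sequentially"
      by (intro filterlim_tendsto_add_at_top[OF tendsto_const] filterlim_compose[OF ln_at_top]
          real_plus_one_at_top)
    then have "filterlim (\<lambda>j. - (- ln (k) + ln (real j + 1))) at_bot sequentially"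
      by (simp only: filterlim_uminus_at_top[symmetric] minus_minus)
    moreover have "- (- ln k + ln (real j + 1)) = ln (1 / (real j + 1) * k)" for j
      using k by (simp add: ln_mult ln_div)
    ultimately show ?thesis by simp
  qed
  have c\<rho>: "(\<lambda>n. c n * mass n (\<rho> n)) \<longlonglongrightarrow> 2 + a"
  proof -
    have "(\<lambda>n. c n * mass n (\<gamma> n * M n)) \<longlonglongrightarrow> 2 + a"
      by (rule tendsto_via_diagonal[OF J(1) filterlim_compose[OF slope_tendsto(1)[OF a(1)] lnk]])
        (use QM(1) in \<open>eventually_elim, simp add: M_def\<close>)
    then show ?thesis
      by (rule Lim_transform_eventually) (use \<rho>eq in \<open>eventually_elim, simp\<close>)
  qed
  have c\<rho>b: "(\<lambda>n. c n * mass n (\<rho>b n)) \<longlonglongrightarrow> 2 - a"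
  proof (cases first)
    case True
    then show ?thesis using first by (simp add: \<rho>b_def)
  next
    case False
    have "(\<lambda>n. c n * mass n (\<gamma> n * (1 / M n))) \<longlonglongrightarrow> 2 - a"
      by (rule tendsto_via_diagonal[OF J(1) filterlim_compose[OF slope_at_bot[OF a(1)] lnk']])
        (use QM(2) in \<open>eventually_elim, simp add: M_def\<close>)
    then show ?thesis
      by (rule Lim_transform_eventually) (use \<rho>eq in \<open>eventually_elim, simp add: False\<close>)
  qed
  have bounds: "\<forall>n. 0 \<le> \<rho> n \<and> \<rho> n < 1 \<and> 0 \<le> \<rho>b n \<and> \<rho>b n < 1"
    by (auto simp: \<rho>_def \<rho>b_def)
  have oeq: "oint (\<rho>b n) (\<rho> n) (\<lambda>x. lam n * h x * f (u n x) * x) = mass n (\<rho> n) - mass n (\<rho>b n)" for n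
    using bounds by (intro oint_mass) auto
  have cdiff: "(\<lambda>n. c n * (mass n (\<rho> n) - mass n (\<rho>b n))) \<longlonglongrightarrow> 2 * a"
    using tendsto_diff[OF c\<rho> c\<rho>b] by (simp add: right_diff_distrib)
  have cpos: "eventually (\<lambda>n. c n > 0) sequentially"
    using ev0 by eventually_elim (simp add: c_def ur g1_UU_pos[OF \<tau>])
  have f1int: "(\<lambda>n. oint (\<rho>b n) (\<rho> n) (\<lambda>x. lam n * h x * f1 (u n x) * x)) \<longlonglongrightarrow> 2 * a"
  proof (rule tendsto_sandwich)
    have "eventually (\<lambda>n. t0 < u n (\<rho> n)) sequentially" using good_\<rho> by (simp add: good_def)
    with \<rho>eq have ev: "eventually (\<lambda>n. 0 \<le> \<rho>b n \<and> \<rho>b n \<le> \<rho> n \<and> 0 < \<rho> n \<and> \<rho> n < 1 \<and> t0 < u n (\<rho> n)) sequentially"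
    proof eventually_elim
      case (elim n)
      have "\<gamma> n * (1 / M n) \<le> \<gamma> n * M n" by (rule mult_left_mono[OF MI]) (use elim in simp)
      moreover have "0 < \<gamma> n * M n" using elim M1[of n] by simp
      ultimately have "\<rho>b n \<le> \<rho> n" "0 < \<rho> n" using elim by (cases first; simp)+
      then show ?case using elim bounds by blast
    qed
    show "eventually (\<lambda>n. g1 (u n (\<rho> n)) / c n * (c n * (mass n (\<rho> n) - mass n (\<rho>b n)))
        \<le> oint (\<rho>b n) (\<rho> n) (\<lambda>x. lam n * h x * f1 (u n x) * x)) sequentially"
      using ev cpos
    proof eventually_elim
      case (elim n)
      then show ?case using oint_f1_bounds(1)[of "\<rho>b n" "\<rho> n" n] by simp
    qed
    show "eventually (\<lambda>n. oint (\<rho>b n) (\<rho> n) (\<lambda>x. lam n * h x * f1 (u n x) * x)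
        \<le> g1 (u n (\<rho>b n)) / c n * (c n * (mass n (\<rho> n) - mass n (\<rho>b n)))) sequentially"
      using ev cpos
    proof eventually_elim
      case (elim n)
      then show ?case using oint_f1_bounds(2)[of "\<rho>b n" "\<rho> n" n] by simp
    qed
    show "(\<lambda>n. g1 (u n (\<rho> n)) / c n * (c n * (mass n (\<rho> n) - mass n (\<rho>b n)))) \<longlonglongrightarrow> 2 * a"
      using tendsto_mult[OF good_g1_ratio[OF good_\<rho> good_r] cdiff] by (simp add: c_def)
    show "(\<lambda>n. g1 (u n (\<rho>b n)) / c n * (c n * (mass n (\<rho> n) - mass n (\<rho>b n)))) \<longlonglongrightarrow> 2 * a"
      using tendsto_mult[OF good_g1_ratio[OF good_\<rho>b good_r] cdiff] by (simp add: c_def)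
  qed
  \<comment> \<open>Passage from the unit g'(u(r_n)) of this bubble to the common unit g'(mu): the
    quotient of the two tends to eta^(1/q).\<close>
  have mm: "(\<lambda>n. g1 (mu n) * X n) \<longlonglongrightarrow> l / \<eta> powr (1 / q)" if "(\<lambda>n. c n * X n) \<longlonglongrightarrow> l" for X l
  proof -
    have "(\<lambda>n. (c n * X n) / (c n / g1 (mu n))) \<longlonglongrightarrow> l / \<eta> powr (1 / q)"
      using that good_g1[OF good_r] a(3) by (intro tendsto_divide) (auto simp: c_def)
    then show ?thesis
      by (rule Lim_transform_eventually) (use cpos in \<open>eventually_elim, simp\<close>)
  qed
  have \<gamma>0: "\<gamma> \<longlonglongrightarrow> 0"
  proof (rule tendsto_sandwich[OF _ _ tendsto_const M0])
    show "eventually (\<lambda>n. 0 \<le> \<gamma> n) sequentially" using Q by eventually_elim simp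
    show "eventually (\<lambda>n. \<gamma> n \<le> 1 / M n) sequentially"
      using Q
    proof eventually_elim
      case (elim n)
      have "\<gamma> n * 1 \<le> \<gamma> n * M n" using elim M1 by (intro mult_left_mono) auto
      then show ?case using elim by linarith
    qed
  qed
  have \<rho>0: "\<rho> \<longlonglongrightarrow> 0"
  proof (rule tendsto_sandwich[OF _ _ tendsto_const M0])
    show "eventually (\<lambda>n. 0 \<le> \<rho> n) sequentially" using bounds by simp
    show "eventually (\<lambda>n. \<rho> n \<le> 1 / M n) sequentially"
      using Q \<rho>eq by eventually_elim simp
  qed
  have \<rho>b\<gamma>eq: "eventually (\<lambda>n. \<rho>b n / \<gamma> n = (if first then 0 else 1 / M n)) sequentially"
    using \<rho>eq by eventually_elim simp
  have \<rho>\<gamma>eq: "eventually (\<lambda>n. \<rho> n / \<gamma> n = M n) sequentially"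
    using \<rho>eq by eventually_elim simp
  have \<rho>b\<gamma>: "(\<lambda>n. \<rho>b n / \<gamma> n) \<longlonglongrightarrow> 0"
  proof -
    have "(\<lambda>n. if first then 0 else 1 / M n) \<longlonglongrightarrow> 0" using M0 by (cases first) auto
    then show ?thesis
      by (rule Lim_transform_eventually) (use \<rho>b\<gamma>eq in \<open>eventually_elim, simp\<close>)
  qed
  have \<rho>\<gamma>: "filterlim (\<lambda>n. \<rho> n / \<gamma> n) at_top sequentially"
    using filterlim_cong[OF refl refl \<rho>\<gamma>eq] Mtop by blast
  have C2: "C2_to_zero (\<lambda>n. \<rho>b n / \<gamma> n) (\<lambda>n. \<rho> n / \<gamma> n)
          (\<lambda>n x. c n * (u n (\<gamma> n * x) - u n (r n)))
          (\<lambda>n x. c n * \<gamma> n * u1 n (\<gamma> n * x))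
          (\<lambda>n x. c n * (\<gamma> n)\<^sup>2 * u2 n (\<gamma> n * x)) (zprof a) (zprof1 a) (zprof2 a)"
    unfolding C2_to_zero_def
  proof (intro allI impI)
    fix e :: real assume e: "e > 0"
    have "eventually (\<lambda>n. 1 / M n < e) sequentially" using order_tendstoD(2)[OF M0 e] .
    with Q \<rho>b\<gamma>eq \<rho>\<gamma>eq
    show "eventually (\<lambda>n. \<forall>x\<in>{\<rho>b n / \<gamma> n..\<rho> n / \<gamma> n}.
        \<bar>c n * (u n (\<gamma> n * x) - u n (r n)) - zprof a x\<bar> + \<bar>c n * \<gamma> n * u1 n (\<gamma> n * x) - zprof1 a x\<bar> +
        \<bar>c n * (\<gamma> n)\<^sup>2 * u2 n (\<gamma> n * x) - zprof2 a x\<bar> < e) sequentially"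
    proof eventually_elim
      case (elim n)
      then have *: "c2_error a (\<gamma> n) (c n) (u n (r n)) n x < 1 / M n"
        if "(if first then 0 else 1 / M n) \<le> x" "x \<le> M n" for x using that by blast
      show ?case
      proof
        fix x assume "x \<in> {\<rho>b n / \<gamma> n..\<rho> n / \<gamma> n}"
        then have "c2_error a (\<gamma> n) (c n) (u n (r n)) n x < e"
          using *[of x] elim(2-4) by fastforce
        then show "\<bar>c n * (u n (\<gamma> n * x) - u n (r n)) - zprof a x\<bar> + \<bar>c n * \<gamma> n * u1 n (\<gamma> n * x) - zprof1 a x\<bar> +
          \<bar>c n * (\<gamma> n)\<^sup>2 * u2 n (\<gamma> n * x) - zprof2 a x\<bar> < e" by (simp add: c2_error_def)
      qed
    qed
  qed
  have Fr: "(\<lambda>n. lam n * (r n)\<^sup>2 * h (r n) * f1 (u n (r n))) \<longlonglongrightarrow> a\<^sup>2 / 2"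
    by (rule Lim_transform_eventually[OF F FFeq])
  have \<gamma>fun: "\<gamma> = (\<lambda>n. 1 / sqrt (lam n * h (r n) * f1 (u n (r n))))"
    and cfun: "c = (\<lambda>n. g1 (u n (r n)))" by (auto simp: \<gamma>_def c_def)
  have "profile_limit a \<eta> first r \<rho> \<rho>b"
    unfolding profile_limit_def Let_def \<gamma>fun[symmetric] cfun[symmetric] oeq
    by (intro conjI bounds good_r good_\<rho> good_\<rho>b Fr \<gamma>0 \<rho>0 \<rho>b\<gamma> \<rho>\<gamma> f1int cdiff mm c\<rho> c\<rho>b C2)
      (simp add: \<rho>b_def)
  then show ?thesis unfolding r_def[abs_def] by blast
qed

text \<open>In units of g'(mu) the flux tends to (2 + a_k) / eta_k^(1/q) at the right end of bubble
  k and to (2 - a_(k+1)) / eta_(k+1)^(1/q) at the left end of bubble k+1. The recursions for a and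
  eta make the two limits equal, so the integral over the gap vanishes in the limit.\<close>

lemma bubble_tower:
  "\<exists>r rho rhob :: nat \<Rightarrow> nat \<Rightarrow> real. \<forall>k\<ge>1.
      (\<forall>n. 0 < r k n \<and> r k n < 1 \<and> 0 \<le> rho k n \<and> rho k n < 1 \<and>
           0 \<le> rhob k n \<and> rhob k n < 1) \<and>
      (k = 1 \<longrightarrow> (\<forall>n. rhob 1 n = 0)) \<and>
      ((\<lambda>n. u n (r k n) / mu n) \<longlonglongrightarrow> delta_seq q k) \<and>
      ((\<lambda>n. lam n * (r k n)^2 * h (r k n) * f1 (u n (r k n)))
          \<longlonglongrightarrow> (a_seq q k)^2 / 2) \<and>
      (let \<gamma> = (\<lambda>n. 1 / sqrt (lam n * h (r k n) * f1 (u n (r k n))));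
           c = (\<lambda>n. g1 (u n (r k n))) in
        (\<gamma> \<longlonglongrightarrow> 0) \<and>
        (rho k \<longlonglongrightarrow> 0) \<and>
        ((\<lambda>n. rhob k n / \<gamma> n) \<longlonglongrightarrow> 0) \<and>
        filterlim (\<lambda>n. rho k n / \<gamma> n) at_top sequentially \<and>
        ((\<lambda>n. u n (rhob k n) / mu n) \<longlonglongrightarrow> delta_seq q k) \<and>
        ((\<lambda>n. u n (rho k n) / mu n) \<longlonglongrightarrow> delta_seq q k) \<and>
        C2_to_zero (\<lambda>n. rhob k n / \<gamma> n) (\<lambda>n. rho k n / \<gamma> n)
          (\<lambda>n x. c n * (u n (\<gamma> n * x) - u n (r k n)))
          (\<lambda>n x. c n * \<gamma> n * u1 n (\<gamma> n * x))
          (\<lambda>n x. c n * (\<gamma> n)^2 * u2 n (\<gamma> n * x))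
          (zprof (a_seq q k)) (zprof1 (a_seq q k)) (zprof2 (a_seq q k)) \<and>
        ((\<lambda>n. c n * oint (rhob k n) (rho k n)
                 (\<lambda>x. lam n * h x * f (u n x) * x)) \<longlonglongrightarrow> 2 * a_seq q k) \<and>
        ((\<lambda>n. oint (rhob k n) (rho k n)
                 (\<lambda>x. lam n * h x * f1 (u n x) * x)) \<longlonglongrightarrow> 2 * a_seq q k)) \<and>
      ((\<lambda>n. g1 (mu n) * oint (rho k n) (rhob (k + 1) n)
               (\<lambda>x. lam n * h x * f (u n x) * x)) \<longlonglongrightarrow> 0) \<and>
      (q = 1 \<longrightarrow> (\<forall>rr \<in> {r k, rho k, rhob k}. \<exists>e :: nat \<Rightarrow> real. (e \<longlonglongrightarrow> 0) \<and>
          eventually (\<lambda>n. u n (rr n) =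
             mu n - (ln (1 / eta_seq q k) + e n) * g (mu n) / g1 (mu n))
            sequentially))"
  (is "\<exists>r rho rhob. \<forall>k\<ge>1. ?P r rho rhob k")
proof -
  note q = q_ge_1 q_less_2
  have "\<exists>\<tau> \<rho> \<rho>b. (\<forall>n. \<tau> n < 0) \<and> profile_limit (a_seq q k) (eta_seq q k) (k = 1) (\<lambda>n. exp (\<tau> n)) \<rho> \<rho>b"
    if k: "k \<ge> 1" for k
  proof -
    obtain \<tau> where "bubble (a_seq q k) (eta_seq q k) \<tau>" using bubbles_exist[OF k] by blast
    then obtain \<tau>' where \<tau>': "bubble (a_seq q k) (eta_seq q k) \<tau>'" "\<And>n. \<tau>' n < 0"
      using bubble_ex_neg by blast
    have "k = 1 \<Longrightarrow> a_seq q k = 2 \<and> eta_seq q k = 1" using seq_1[OF q] by simp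
    from bubble_profile_limit[OF \<tau>' this] \<tau>'(2) show ?thesis by blast
  qed
  then obtain T rho rhob where out: "\<And>k. k \<ge> 1 \<Longrightarrow> (\<forall>n. T k n < 0) \<and>
      profile_limit (a_seq q k) (eta_seq q k) (k = 1) (\<lambda>n. exp (T k n)) (rho k) (rhob k)"
    by metis
  define r where "r k n = exp (T k n)" for k n :: nat
  have O: "profile_limit (a_seq q k) (eta_seq q k) (k = 1) (r k) (rho k) (rhob k)" if "k \<ge> 1" for k
    using out[OF that] by (simp add: r_def[abs_def])
  have r01: "0 < r k n \<and> r k n < 1" if "k \<ge> 1" for k n
    using out[OF that] by (simp add: r_def)
  show ?thesis
  proof (rule exI[of _ r], rule exI[of _ rho], rule exI[of _ rhob], intro allI impI)
    fix k :: nat assume k: "1 \<le> k"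
    let ?a = "a_seq q k" and ?\<eta> = "eta_seq q k"
    note Ok = O[OF k, unfolded profile_limit_def Let_def]
    have k1: "1 \<le> k + 1" by simp
    note Ok1 = O[OF k1, unfolded profile_limit_def Let_def]
    have g: "good ?\<eta> (\<lambda>n. u n (r k n))" "good ?\<eta> (\<lambda>n. u n (rho k n))" "good ?\<eta> (\<lambda>n. u n (rhob k n))"
      using Ok by blast+
    have ratio: "(\<lambda>n. v n / mu n) \<longlonglongrightarrow> delta_seq q k" if "good ?\<eta> v" for v
      using good_ratio[OF that] delta_seq_eq[OF q k] by simp
    have expn: "q = 1 \<longrightarrow> (\<forall>rr \<in> {r k, rho k, rhob k}. \<exists>e. e \<longlonglongrightarrow> 0 \<and>
      eventually (\<lambda>n. u n (rr n) = mu n - (ln (1 / ?\<eta>) + e n) * g (mu n) / g1 (mu n)) sequentially)"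
      using good_expansion[OF g(1)] good_expansion[OF g(2)] good_expansion[OF g(3)] by blast
    let ?\<sigma> = "gap_root q ?a"
    note a = a_seq_bounds[OF q k] and \<eta> = eta_seq_pos[OF q k]
    note \<sigma> = gap_root_bounds[OF q a]
    have m1: "(\<lambda>n. g1 (mu n) * mass n (rho k n)) \<longlonglongrightarrow> (2 + ?a) / ?\<eta> powr (1 / q)"
      using Ok by blast
    have m2: "(\<lambda>n. g1 (mu n) * mass n (rhob (k + 1) n)) \<longlonglongrightarrow>
        (2 - a_seq q (k + 1)) / eta_seq q (k + 1) powr (1 / q)"
      using Ok1 by blast
    have "(2 - a_seq q (k + 1)) / eta_seq q (k + 1) powr (1 / q) = (2 + ?a) / ?\<eta> powr (1 / q)"
      using a_seq_Suc[OF q k] eta_seq_Suc[OF q k] \<sigma> \<eta> by (simp add: powr_mult)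
    with tendsto_diff[OF m2 m1]
    have gapint: "(\<lambda>n. g1 (mu n) * (mass n (rhob (k + 1) n) - mass n (rho k n))) \<longlonglongrightarrow> 0"
      by (simp add: right_diff_distrib)
    have "oint (rho k n) (rhob (k + 1) n) (\<lambda>x. lam n * h x * f (u n x) * x)
        = mass n (rhob (k + 1) n) - mass n (rho k n)" for n
      using Ok Ok1 by (intro oint_mass) blast+
    then have last: "(\<lambda>n. g1 (mu n) * oint (rho k n) (rhob (k + 1) n) (\<lambda>x. lam n * h x * f (u n x) * x)) \<longlonglongrightarrow> 0"
      using gapint by simp
    have b: "\<forall>n. 0 < r k n \<and> r k n < 1 \<and> 0 \<le> rho k n \<and> rho k n < 1 \<and> 0 \<le> rhob k n \<and> rhob k n < 1"
      using r01[OF k] Ok by blast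
    have z: "k = 1 \<longrightarrow> (\<forall>n. rhob 1 n = 0)" using Ok by blast
    show "?P r rho rhob k"
      unfolding Let_def
      using b z ratio[OF g(1)] ratio[OF g(2)] ratio[OF g(3)] last expn Ok by blast
  qed
qed

end

theorem theorem1p2:
  fixes h h1 f f1 f2 g1 g2 :: "real \<Rightarrow> real" and t0 q :: real and p :: ereal
    and lam mu :: "nat \<Rightarrow> real" and u u1 u2 :: "nat \<Rightarrow> real \<Rightarrow> real"
  assumes h_pos: "\<forall>r\<in>{0..1}. h r > 0"
    and h_C1: "\<forall>r\<in>{0..1}. (h has_real_derivative h1 r) (at r within {0..1})"
              "continuous_on {0..1} h1"
    and f_nonneg: "\<forall>t\<ge>0. f t \<ge> 0"
    and f_C1: "\<forall>t\<ge>0. (f has_real_derivative f1 t) (at t within {0..})"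
              "continuous_on {0..} f1"
    and t0: "t0 \<ge> 0"
    and f_pos: "\<forall>t\<ge>t0. f t > 0"
    and f_C2: "\<forall>t\<ge>t0. (f1 has_real_derivative f2 t) (at t within {t0..})"
              "continuous_on {t0..} f2"
    and g_d1: "\<forall>t\<ge>t0. ((\<lambda>s. ln (f s)) has_real_derivative g1 t) (at t within {t0..})"
    and g_d2: "\<forall>t\<ge>t0. (g1 has_real_derivative g2 t) (at t within {t0..})"
    and H1_pos: "\<forall>t\<ge>t0. g1 t > 0 \<and> g2 t > 0"
    and H1_qp: "(q = 1 \<and> 0 < p) \<or> (1 < q \<and> 0 < p \<and> p < \<infinity>)"
    and H1_lim_q: "((\<lambda>t. (g1 t)^2 / (ln (f t) * g2 t)) \<longlongrightarrow> q) at_top"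
    and H1_lim_p: "((\<lambda>t. ereal (t * g1 t / ln (f t))) \<longlongrightarrow> p) at_top"
    and H1_ii: "q = 1 \<longrightarrow>
        (mono_on {t0..} (\<lambda>t. t * g1 t / ln (f t)) \<and>
         (\<exists>k::nat. k \<ge> 1 \<and> (\<exists>gh gh1 gh2 :: real \<Rightarrow> real.
            (\<forall>t\<ge>t0. (gh has_real_derivative gh1 t) (at t within {t0..}) \<and>
                     (gh1 has_real_derivative gh2 t) (at t within {t0..})) \<and>
            continuous_on {t0..} gh2 \<and>
            (\<forall>t\<ge>t0. f t = (exp ^^ k) (gh t)) \<and>
            antimono_on {t0..} (\<lambda>t. gh1 t / gh t))))"
    and q_range: "1 \<le> q" "q < 2"
    and lam_pos: "\<forall>n. lam n > 0"
    and mu_pos: "\<forall>n. mu n > 0"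
    and u_C2: "\<forall>n. \<forall>r\<in>{0..1}. (u n has_real_derivative u1 n r) (at r within {0..1}) \<and>
                                (u1 n has_real_derivative u2 n r) (at r within {0..1})"
    and u2_cont: "\<forall>n. continuous_on {0..1} (u2 n)"
    and ode: "\<forall>n. \<forall>r\<in>{0<..<1}. - u2 n r - u1 n r / r = lam n * h r * f (u n r)"
    and u_pos: "\<forall>n. \<forall>r\<in>{0<..<1}. u n r > 0"
    and bc: "\<forall>n. u n 0 = mu n \<and> u1 n 0 = 0 \<and> u n 1 = 0"
    and mu_inf: "filterlim mu at_top sequentially"
  shows "\<exists>s::nat \<Rightarrow> nat. strict_mono s \<and>
    (\<exists>r rho rhob :: nat \<Rightarrow> nat \<Rightarrow> real. \<forall>k\<ge>1.
      (\<forall>n. 0 < r k n \<and> r k n < 1 \<and> 0 \<le> rho k n \<and> rho k n < 1 \<and>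
           0 \<le> rhob k n \<and> rhob k n < 1) \<and>
      (k = 1 \<longrightarrow> (\<forall>n. rhob 1 n = 0)) \<and>
      ((\<lambda>n. u (s n) (r k n) / mu (s n)) \<longlonglongrightarrow> delta_seq q k) \<and>
      ((\<lambda>n. lam (s n) * (r k n)^2 * h (r k n) * f1 (u (s n) (r k n)))
          \<longlonglongrightarrow> (a_seq q k)^2 / 2) \<and>
      (let \<gamma> = (\<lambda>n. 1 / sqrt (lam (s n) * h (r k n) * f1 (u (s n) (r k n))));
           c = (\<lambda>n. g1 (u (s n) (r k n))) in
        (\<gamma> \<longlonglongrightarrow> 0) \<and>
        (rho k \<longlonglongrightarrow> 0) \<and>
        ((\<lambda>n. rhob k n / \<gamma> n) \<longlonglongrightarrow> 0) \<and>
        filterlim (\<lambda>n. rho k n / \<gamma> n) at_top sequentially \<and>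
        ((\<lambda>n. u (s n) (rhob k n) / mu (s n)) \<longlonglongrightarrow> delta_seq q k) \<and>
        ((\<lambda>n. u (s n) (rho k n) / mu (s n)) \<longlonglongrightarrow> delta_seq q k) \<and>
        C2_to_zero (\<lambda>n. rhob k n / \<gamma> n) (\<lambda>n. rho k n / \<gamma> n)
          (\<lambda>n x. c n * (u (s n) (\<gamma> n * x) - u (s n) (r k n)))
          (\<lambda>n x. c n * \<gamma> n * u1 (s n) (\<gamma> n * x))
          (\<lambda>n x. c n * (\<gamma> n)^2 * u2 (s n) (\<gamma> n * x))
          (zprof (a_seq q k)) (zprof1 (a_seq q k)) (zprof2 (a_seq q k)) \<and>
        ((\<lambda>n. c n * oint (rhob k n) (rho k n)
                 (\<lambda>x. lam (s n) * h x * f (u (s n) x) * x)) \<longlonglongrightarrow> 2 * a_seq q k) \<and>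
        ((\<lambda>n. oint (rhob k n) (rho k n)
                 (\<lambda>x. lam (s n) * h x * f1 (u (s n) x) * x)) \<longlonglongrightarrow> 2 * a_seq q k)) \<and>
      ((\<lambda>n. g1 (mu (s n)) * oint (rho k n) (rhob (k + 1) n)
               (\<lambda>x. lam (s n) * h x * f (u (s n) x) * x)) \<longlonglongrightarrow> 0) \<and>
      (q = 1 \<longrightarrow> (\<forall>rr \<in> {r k, rho k, rhob k}. \<exists>e :: nat \<Rightarrow> real. (e \<longlonglongrightarrow> 0) \<and>
          eventually (\<lambda>n. u (s n) (rr n) =
             mu (s n) - (ln (1 / eta_seq q k) + e n) * ln (f (mu (s n))) / g1 (mu (s n)))
            sequentially)))"
proof -
  interpret radial_family "\<lambda>t. ln (f t)" g1 g2 t0 q h h1 f f1 lam mu u u1 u2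
  proof
    show "f t = exp (ln (f t))" if "t0 \<le> t" for t using f_pos that by simp
  qed (use assms in auto)
  \<comment> \<open>Every limit holds along the whole sequence, so the identity serves as the
    extraction.\<close>
  show ?thesis
    by (intro exI[of _ "\<lambda>n. n"] conjI bubble_tower) (simp add: strict_mono_def)
qed

end
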